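(* Let $G$ be a finitely generated group and let $d(G)$ be the minimal number of generators of $G$. Let $S$ be a simplicial $G$–tree with finite quotient graph $\overline S=G\backslash S$ in which every edge stabilizer is finite. Then for any compressing forest $F$ of $\overline S$, $$\eta(S)=\sum_{e\in E\overline S\setminus EF}\frac{1}{|G(e)|}\le d(G),$$ where $G(e)$ is the stabilizer of a lift of $e$ to $S$.
   Context: For a simplicial $G$–tree $S$ with finite quotient graph $\overline S=G\backslash S$, denote by $G(v)$, $G(e)$ the stabilizers in $G$ of chosen lifts of a vertex $v$ or edge $e$ of $\overline S$ (compatible, so that for an edge from $\iota e$ to $\tau e$ its stabilizer is a subgroup of the stabilizers of the lifted endpoints). A compressing forest is a subgraph $F$ of $\overline S$ containing no cycle, with $VF=V\overline S$, whose edges are oriented so that each vertex has at most one edge of $F$ oriented away from it, such that every edge $e\in EF$ oriented from $\iota e$ to $\tau e$ satisfies $G(e)=G(\iota e)$ (for the lift of $e$ and its initial vertex), and which is maximal with respect to these properties. Collapsing the $G$–orbits of edges lying over $F$ yields a reduced $G$–tree $S^*$ whose quotient graph $\overline{S^*}$ has edge set $E\overline S\setminus EF$ with the same edge groups; thus $\eta(S)=\sum_{e\in E\overline{S^*}}1/|G(e)|$. *)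

theory Defs
  imports Complex_Main "HOL-Algebra.Group_Action" "HOL-Algebra.Generated_Groups"
begin

text \<open>Graphs in the sense of Dicks--Dunwoody: a vertex set V, an edge set E and
incidence functions iota, tau (initial / terminal vertex). Paths and cycles are taken
in the underlying undirected multigraph (each edge may be traversed in either direction).\<close>

definition is_walk :: "'e set \<Rightarrow> ('e \<Rightarrow> 'v) \<Rightarrow> ('e \<Rightarrow> 'v) \<Rightarrow> 'v list \<Rightarrow> 'e list \<Rightarrow> bool" where
  "is_walk E \<iota> \<tau> vs es \<longleftrightarrow>
     length vs = Suc (length es) \<and> set es \<subseteq> E \<and>
     (\<forall>i<length es. (\<iota> (es!i) = vs!i \<and> \<tau> (es!i) = vs!Suc i) \<or>
                    (\<tau> (es!i) = vs!i \<and> \<iota> (es!i) = vs!Suc i))"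

text \<open>A cycle: a closed walk of positive length with pairwise distinct edges and
pairwise distinct vertices (apart from first = last). Loops and pairs of parallel
edges are cycles.\<close>
definition is_cycle :: "'e set \<Rightarrow> ('e \<Rightarrow> 'v) \<Rightarrow> ('e \<Rightarrow> 'v) \<Rightarrow> 'v list \<Rightarrow> 'e list \<Rightarrow> bool" where
  "is_cycle E \<iota> \<tau> vs es \<longleftrightarrow>
     is_walk E \<iota> \<tau> vs es \<and> es \<noteq> [] \<and> hd vs = last vs \<and>
     distinct es \<and> distinct (butlast vs)"

definition has_no_cycle :: "'e set \<Rightarrow> ('e \<Rightarrow> 'v) \<Rightarrow> ('e \<Rightarrow> 'v) \<Rightarrow> bool" where
  "has_no_cycle E \<iota> \<tau> \<longleftrightarrow> (\<nexists>vs es. is_cycle E \<iota> \<tau> vs es)"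

definition is_graph :: "'v set \<Rightarrow> 'e set \<Rightarrow> ('e \<Rightarrow> 'v) \<Rightarrow> ('e \<Rightarrow> 'v) \<Rightarrow> bool" where
  "is_graph V E \<iota> \<tau> \<longleftrightarrow> (\<forall>e\<in>E. \<iota> e \<in> V \<and> \<tau> e \<in> V)"

definition is_tree :: "'v set \<Rightarrow> 'e set \<Rightarrow> ('e \<Rightarrow> 'v) \<Rightarrow> ('e \<Rightarrow> 'v) \<Rightarrow> bool" where
  "is_tree V E \<iota> \<tau> \<longleftrightarrow> is_graph V E \<iota> \<tau> \<and> V \<noteq> {} \<and>
     (\<forall>u\<in>V. \<forall>v\<in>V. \<exists>vs es. is_walk E \<iota> \<tau> vs es \<and> hd vs = u \<and> last vs = v) \<and>
     has_no_cycle E \<iota> \<tau>"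

definition G_tree ::
  "('g, 'b) monoid_scheme \<Rightarrow> 'v set \<Rightarrow> 'e set \<Rightarrow> ('e \<Rightarrow> 'v) \<Rightarrow> ('e \<Rightarrow> 'v) \<Rightarrow>
   ('g \<Rightarrow> 'v \<Rightarrow> 'v) \<Rightarrow> ('g \<Rightarrow> 'e \<Rightarrow> 'e) \<Rightarrow> bool" where
  "G_tree G V E \<iota> \<tau> \<phi>V \<phi>E \<longleftrightarrow>
     group G \<and> group_action G V \<phi>V \<and> group_action G E \<phi>E \<and>
     is_tree V E \<iota> \<tau> \<and>
     (\<forall>g\<in>carrier G. \<forall>e\<in>E. \<iota> (\<phi>E g e) = \<phi>V g (\<iota> e) \<and> \<tau> (\<phi>E g e) = \<phi>V g (\<tau> e))"

text \<open>The quotient graph G\S: vertices are the G-orbits of vertices, edges are the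
G-orbits of edges; the incidence functions are induced via a chosen lift.\<close>
definition lift :: "'a set \<Rightarrow> 'a" where
  "lift X = (SOME x. x \<in> X)"

definition q_iota :: "('g, 'b) monoid_scheme \<Rightarrow> ('g \<Rightarrow> 'v \<Rightarrow> 'v) \<Rightarrow> ('e \<Rightarrow> 'v) \<Rightarrow> 'e set \<Rightarrow> 'v set" where
  "q_iota G \<phi>V \<iota> X = orbit G \<phi>V (\<iota> (lift X))"

text \<open>Compressing forest F (a set of edges of the quotient graph) together with an
orientation ori (ori X = True: X oriented from iota to tau; False: reversed).\<close>
definition forest_conditions ::
  "('g, 'b) monoid_scheme \<Rightarrow> 'v set \<Rightarrow> 'e set \<Rightarrow> ('e \<Rightarrow> 'v) \<Rightarrow> ('e \<Rightarrow> 'v) \<Rightarrow>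
   ('g \<Rightarrow> 'v \<Rightarrow> 'v) \<Rightarrow> ('g \<Rightarrow> 'e \<Rightarrow> 'e) \<Rightarrow> 'e set set \<Rightarrow> ('e set \<Rightarrow> bool) \<Rightarrow> bool" where
  "forest_conditions G V E \<iota> \<tau> \<phi>V \<phi>E F ori \<longleftrightarrow>
     F \<subseteq> orbits G E \<phi>E \<and>
     has_no_cycle F (q_iota G \<phi>V \<iota>) (q_iota G \<phi>V \<tau>) \<and>
     (\<forall>W\<in>orbits G V \<phi>V.
        card {X\<in>F. (if ori X then q_iota G \<phi>V \<iota> X else q_iota G \<phi>V \<tau> X) = W} \<le> 1) \<and>
     (\<forall>X\<in>F. \<forall>e\<in>X. stabilizer G \<phi>E e = stabilizer G \<phi>V (if ori X then \<iota> e else \<tau> e))"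

definition compressing_forest ::
  "('g, 'b) monoid_scheme \<Rightarrow> 'v set \<Rightarrow> 'e set \<Rightarrow> ('e \<Rightarrow> 'v) \<Rightarrow> ('e \<Rightarrow> 'v) \<Rightarrow>
   ('g \<Rightarrow> 'v \<Rightarrow> 'v) \<Rightarrow> ('g \<Rightarrow> 'e \<Rightarrow> 'e) \<Rightarrow> 'e set set \<Rightarrow> ('e set \<Rightarrow> bool) \<Rightarrow> bool" where
  "compressing_forest G V E \<iota> \<tau> \<phi>V \<phi>E F ori \<longleftrightarrow>
     forest_conditions G V E \<iota> \<tau> \<phi>V \<phi>E F ori \<and>
     (\<nexists>F' ori'. F \<subset> F' \<and> forest_conditions G V E \<iota> \<tau> \<phi>V \<phi>E F' ori')"

definition finitely_generated :: "('g, 'b) monoid_scheme \<Rightarrow> bool" where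
  "finitely_generated G \<longleftrightarrow>
     (\<exists>A. A \<subseteq> carrier G \<and> finite A \<and> generate G A = carrier G)"

definition min_gens :: "('g, 'b) monoid_scheme \<Rightarrow> nat" where
  "min_gens G = (LEAST n. \<exists>A. A \<subseteq> carrier G \<and> finite A \<and> card A = n \<and> generate G A = carrier G)"

end

theory Submission
  imports Defs
begin

text \<open>
  Weigh an orbit by the reciprocal of the order of its stabilizer (0 if infinite). In a \<open>G\<close>-graph,
  call a vertex \<open>u\<close> compressible into a neighbour \<open>v\<close> if some edge joining them has the same
  stabilizer as \<open>u\<close>, and call an invariant set \<open>R\<close> of vertices absorbing if every vertex can be
  compressed into \<open>R\<close> in finitely many steps. The cost of \<open>R\<close> is the weight of the edges minus the
  weight of the vertices plus the weight of \<open>R\<close>.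

  A connected \<open>G\<close>-graph over the tree \<open>S\<close> of cost at most \<open>d(G)\<close> is obtained from \<open>G \<times> X\<close>, with \<open>X\<close>
  a finite subtree of \<open>S\<close> meeting every vertex orbit, by identifying \<open>(1, a v0)\<close> with \<open>(a, v0)\<close> for
  each generator \<open>a\<close>. Stallings folds do not increase the minimal cost: a proper inclusion of finite
  groups at least halves the weight. They terminate because the edge stabilizers of \<open>S\<close> are finite,
  and a \<open>G\<close>-graph over \<open>S\<close> that cannot be folded any more is \<open>S\<close> itself. So \<open>S\<close> has an absorbing set
  of cost at most \<open>d(G)\<close>. For a compressing forest \<open>F\<close>, the weight of the edges outside \<open>F\<close> is the
  cost formula with \<open>R\<close> replaced by the roots of \<open>F\<close>, and by maximality of \<open>F\<close> the roots with finite
  stabilizer inject, with equal weights, into the orbits of any absorbing set.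
\<close>

section \<open>Reduced walks in forests\<close>

text \<open>The obstacle is that a fold can enlarge the stabilizer of the merged vertex, and then
  that vertex may no longer be compressible. Its orbit must in that case join the absorbing set. The
  price is covered exactly when two of the inclusions between the stabilizers at the fold are
  proper: each halves a weight, and the two halves together make up for the lost edge orbit. With
  fewer proper inclusions the order of the stabilizers leaves so little room that the merged vertex
  can be shown to reach the old absorbing set after all. Absorbing sets replace forests during the
  folding because they ask for reachability only: no acyclicity, orientation or maximality has to be
  carried through a fold. Maximality of \<open>F\<close> enters once, in \<open>S\<close> itself.
  The bound comes from an Euler characteristic. The free graph on a finite tree, with one orbit of
  roots, costs edges minus vertices plus one, which is 0, and each generator adds at most the weight
  of one vertex, hence at most 1.\<close>

fun walk :: "'e set \<Rightarrow> ('e \<Rightarrow> 'v) \<Rightarrow> ('e \<Rightarrow> 'v) \<Rightarrow> 'v \<Rightarrow> 'e list \<Rightarrow> 'v \<Rightarrow> bool" where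
  "walk E i t u [] v \<longleftrightarrow> u = v"
| "walk E i t u (e # es) v \<longleftrightarrow> e \<in> E \<and>
     (i e = u \<and> walk E i t (t e) es v \<or> t e = u \<and> walk E i t (i e) es v)"

definition adj :: "'e set \<Rightarrow> ('e \<Rightarrow> 'v) \<Rightarrow> ('e \<Rightarrow> 'v) \<Rightarrow> ('v \<times> 'v) set" where
  "adj E i t = {(u, v). \<exists>e\<in>E. i e = u \<and> t e = v \<or> t e = u \<and> i e = v}"

lemma adj_rtrancl_sym: "(u, v) \<in> (adj E i t)\<^sup>* \<Longrightarrow> (v, u) \<in> (adj E i t)\<^sup>*"
  by (rule symD[OF sym_rtrancl]) (auto simp: adj_def sym_def)

text \<open>Here \<open>distinct_adj\<close> says that no edge is followed by itself. An edge put in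
  front of a reduced walk either keeps it reduced or cancels against its first edge.\<close>

lemma reduced_walk_exists:
  assumes "(u, v) \<in> (adj E i t)\<^sup>*"
  obtains es where "walk E i t u es v" "distinct_adj es"
proof -
  have "\<exists>es. walk E i t u es v \<and> distinct_adj es"
    using assms
  proof (induction rule: converse_rtrancl_induct)
    case base
    show ?case by (rule exI[of _ "[]"]) simp
  next
    case (step u u')
    then obtain es where es: "walk E i t u' es v" "distinct_adj es" by blast
    from step obtain e where e: "e \<in> E" "i e = u \<and> t e = u' \<or> t e = u \<and> i e = u'"
      by (auto simp: adj_def)
    show ?case
    proof (cases "es \<noteq> [] \<and> hd es = e")
      case True
      then obtain es' where es': "es = e # es'" by (metis list.collapse)
      have "walk E i t u es' v" "distinct_adj es'"
        using es e by (auto simp: es' distinct_adj_Cons)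
      then show ?thesis by blast
    next
      case False
      then have "walk E i t u (e # es) v" "distinct_adj (e # es)"
        using es e by (auto simp: distinct_adj_Cons)
      then show ?thesis by blast
    qed
  qed
  with that show ?thesis by blast
qed

lemma walk_append:
  "walk E i t u (es @ fs) v \<longleftrightarrow> (\<exists>w. walk E i t u es w \<and> walk E i t w fs v)"
  by (induction es arbitrary: u) auto

lemma walk_mono: "walk E i t u es v \<Longrightarrow> E \<subseteq> E' \<Longrightarrow> walk E' i t u es v"
  by (induction es arbitrary: u) auto

lemma walk_set: "walk E i t u es v \<Longrightarrow> set es \<subseteq> E"
  by (induction es arbitrary: u) auto

lemma walk_imp_is_walk:
  "walk E i t u es v \<Longrightarrow> \<exists>vs. is_walk E i t vs es \<and> hd vs = u \<and> last vs = v"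
proof (induction es arbitrary: u)
  case Nil
  then show ?case by (intro exI[of _ "[u]"]) (simp add: is_walk_def)
next
  case (Cons e es)
  then obtain u' where u': "e \<in> E" "i e = u \<and> t e = u' \<or> t e = u \<and> i e = u'" "walk E i t u' es v"
    by auto
  with Cons.IH obtain vs where vs: "is_walk E i t vs es" "hd vs = u'" "last vs = v" by blast
  then have ne: "vs \<noteq> []" by (auto simp: is_walk_def)
  have "is_walk E i t (u # vs) (e # es)"
    unfolding is_walk_def
  proof (intro conjI allI impI)
    fix k assume "k < length (e # es)"
    then show "i ((e # es) ! k) = (u # vs) ! k \<and> t ((e # es) ! k) = (u # vs) ! Suc k \<or>
       t ((e # es) ! k) = (u # vs) ! k \<and> i ((e # es) ! k) = (u # vs) ! Suc k"
      using vs u' ne by (cases k) (auto simp: is_walk_def hd_conv_nth)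
  qed (use vs u' in \<open>auto simp: is_walk_def\<close>)
  then show ?case using vs ne by (intro exI[of _ "u # vs"]) simp
qed

lemma is_walk_rtrancl:
  assumes "is_walk E i t vs es" "a \<le> b" "b \<le> length es"
  shows "(vs ! a, vs ! b) \<in> (adj (set es) i t)\<^sup>*"
  using assms(2,3)
proof (induction b rule: dec_induct)
  case (step n)
  then have n: "n < length es" by simp
  then have "i (es ! n) = vs ! n \<and> t (es ! n) = vs ! Suc n \<or>
      t (es ! n) = vs ! n \<and> i (es ! n) = vs ! Suc n"
    using assms(1) by (simp add: is_walk_def)
  then have "(vs ! n, vs ! Suc n) \<in> adj (set es) i t"
    using nth_mem[OF n] unfolding adj_def by blast
  with step show ?case by (simp add: rtrancl_into_rtrancl)
qed simp

lemma is_walk_segment: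
  assumes "is_walk E i t vs es" "a \<le> b" "b \<le> length es"
  shows "is_walk E i t (take (Suc (b - a)) (drop a vs)) (take (b - a) (drop a es))"
  using assms unfolding is_walk_def
  by (auto dest: in_set_takeD in_set_dropD)

lemma distinct_adj_segment: "distinct_adj es \<Longrightarrow> distinct_adj (take m (drop k es))"
  by (metis append_take_drop_id distinct_adj_appendD1 distinct_adj_appendD2)

text \<open>A shortest counterexample would be a cycle: a repeated vertex cuts off a shorter reduced
  closed walk, and distinct vertices leave no room for a repeated edge.\<close>

lemma no_reduced_closed_is_walk:
  assumes "has_no_cycle E i t" "is_walk E i t vs es" "hd vs = last vs" "distinct_adj es"
  shows "es = []"
  using assms(2-)
proof (induction "length es" arbitrary: vs es rule: less_induct)
  case less
  note len = less.prems(1)[unfolded is_walk_def, THEN conjunct1]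
  show ?case
  proof (rule ccontr)
    assume ne: "es \<noteq> []"
    have closed: "vs ! 0 = vs ! length es"
      using less.prems(2) len by (metis Suc_neq_Zero diff_Suc_1 hd_conv_nth last_conv_nth length_0_conv)
    \<comment> \<open>The condition \<open>b - a < length es\<close> exempts only the pair formed by
      the two ends of the walk.\<close>
    have dist: "vs ! a \<noteq> vs ! b" if "a < b" "b \<le> length es" "b - a < length es" for a b
    proof
      assume eq: "vs ! a = vs ! b"
      let ?vs = "take (Suc (b - a)) (drop a vs)" and ?es = "take (b - a) (drop a es)"
      have "is_walk E i t ?vs ?es" using is_walk_segment[OF less.prems(1)] that by simp
      moreover have "hd ?vs = last ?vs"
        using that eq len by (simp add: hd_conv_nth last_conv_nth)
      moreover have "length ?es < length es" using that by simp
      ultimately have "?es = []"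
        using less.hyps distinct_adj_segment[OF less.prems(3)] by blast
      with that show False by simp
    qed
    have dbut: "distinct (butlast vs)"
      unfolding distinct_conv_nth
    proof (intro allI impI)
      fix a b assume "a < length (butlast vs)" "b < length (butlast vs)" "a \<noteq> b"
      then show "butlast vs ! a \<noteq> butlast vs ! b"
        using dist[of a b] dist[of b a] len
        by (cases "a < b") (auto simp: nth_butlast less_imp_diff_less)
    qed
    have "es ! a \<noteq> es ! b" if ab: "a < b" "b < length es" for a b
    proof
      assume eq: "es ! a = es ! b"
      have wa: "(i (es!a) = vs!a \<and> t (es!a) = vs!Suc a) \<or> (t (es!a) = vs!a \<and> i (es!a) = vs!Suc a)"
        and wb: "(i (es!b) = vs!b \<and> t (es!b) = vs!Suc b) \<or> (t (es!b) = vs!b \<and> i (es!b) = vs!Suc b)"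
        using less.prems(1) ab by (auto simp: is_walk_def)
      have nab: "vs ! a \<noteq> vs ! b" using dist ab by simp
      \<comment> \<open>Traversals of one edge from different vertices run in opposite directions.
        By \<open>dist\<close> they are then consecutive, which \<open>distinct_adj\<close>
        forbids.\<close>
      with wa wb eq have *: "vs ! a = vs ! Suc b" "vs ! Suc a = vs ! b" by auto
      from *(1) dist[of a "Suc b"] ab have "a = 0" "Suc b = length es" by force+
      from *(2) dist[of "Suc a" b] ab have "Suc a = b" by force
      with ab have "es ! a \<noteq> es ! b"
        using less.prems(3) by (auto simp: distinct_adj_conv_nth)
      with eq show False by simp
    qed
    then have "distinct es" by (metis distinct_conv_nth nat_neq_iff)
    with less.prems ne dbut have "is_cycle E i t vs es" by (simp add: is_cycle_def)
    with assms(1) show False by (simp add: has_no_cycle_def)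
  qed
qed

lemma no_reduced_closed_walk:
  assumes "has_no_cycle E i t" "walk E i t u es u" "distinct_adj es"
  shows "es = []"
  using walk_imp_is_walk[OF assms(2)] no_reduced_closed_is_walk[OF assms(1)] assms(3) by metis

lemma no_loop: "has_no_cycle E i t \<Longrightarrow> e \<in> E \<Longrightarrow> i e \<noteq> t e"
  using no_reduced_closed_walk[of E i t "i e" "[e]"] by auto

text \<open>A reduced walk in \<open>E'\<close> between the ends of an edge outside
  \<open>E'\<close> closes up, through that edge, to a reduced closed walk.\<close>

lemma edge_is_bridge:
  assumes "has_no_cycle E i t" "e \<in> E" "E' \<subseteq> E" "(i e, t e) \<in> (adj E' i t)\<^sup>*"
  shows "e \<in> E'"
proof (rule ccontr)
  assume e: "e \<notin> E'"
  obtain es where es: "walk E' i t (i e) es (t e)" "distinct_adj es"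
    using reduced_walk_exists[OF assms(4)] .
  have last: "last es \<noteq> e" if "es \<noteq> []"
    using walk_set[OF es(1)] e last_in_set[OF that] by blast
  have "walk E i t (i e) (es @ [e]) (i e)"
    using walk_mono[OF es(1) assms(3)] assms(2) by (auto simp: walk_append)
  moreover have "distinct_adj (es @ [e])"
    using es last by (auto simp: distinct_adj_append_iff)
  ultimately show False using no_reduced_closed_walk[OF assms(1)] by blast
qed

section \<open>Weighted orbit sums\<close>

text \<open>In contrast to \<open>group_action\<close>, nothing is required of the values outside
  \<open>\<Omega>\<close>, so quotients and invariant subsets qualify as they stand.\<close>

locale gset = group G for G (structure) +
  fixes \<Omega> :: "'a set" and \<alpha> :: "'g \<Rightarrow> 'a \<Rightarrow> 'a"
  assumes act_closed: "g \<in> carrier G \<Longrightarrow> x \<in> \<Omega> \<Longrightarrow> \<alpha> g x \<in> \<Omega>"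
    and act_one: "x \<in> \<Omega> \<Longrightarrow> \<alpha> \<one> x = x"
    and act_mult: "g \<in> carrier G \<Longrightarrow> h \<in> carrier G \<Longrightarrow> x \<in> \<Omega> \<Longrightarrow> \<alpha> (g \<otimes> h) x = \<alpha> g (\<alpha> h x)"

definition weight :: "('g, 'b) monoid_scheme \<Rightarrow> ('g \<Rightarrow> 'a \<Rightarrow> 'a) \<Rightarrow> 'a \<Rightarrow> real" where
  "weight G \<alpha> x = 1 / real (card (stabilizer G \<alpha> x))"

text \<open>The values lie in a monoid because the same sums are formed of real weights and of
  natural numbers (\<open>defect\<close>). For the invariant functions used here the choice made by
  \<open>lift\<close> does not matter.\<close>

definition orbit_sum ::
  "('g, 'b) monoid_scheme \<Rightarrow> ('a \<Rightarrow> 'n::comm_monoid_add) \<Rightarrow> ('g \<Rightarrow> 'a \<Rightarrow> 'a) \<Rightarrow> 'a set \<Rightarrow> 'n" where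
  "orbit_sum G w \<alpha> \<Omega> = (\<Sum>X\<in>orbits G \<Omega> \<alpha>. w (lift X))"

definition equivariant :: "('g, 'b) monoid_scheme \<Rightarrow> 'a set \<Rightarrow> ('g \<Rightarrow> 'a \<Rightarrow> 'a) \<Rightarrow> ('g \<Rightarrow> 'c \<Rightarrow> 'c) \<Rightarrow> ('a \<Rightarrow> 'c) \<Rightarrow> bool" where
  "equivariant G \<Omega> \<alpha> \<beta> f \<longleftrightarrow> (\<forall>g\<in>carrier G. \<forall>x\<in>\<Omega>. f (\<alpha> g x) = \<beta> g (f x))"

lemma lift_in: "x \<in> X \<Longrightarrow> lift X \<in> X"
  unfolding lift_def by (rule someI)

lemma in_stabilizer_iff: "g \<in> stabilizer G \<alpha> x \<longleftrightarrow> g \<in> carrier G \<and> \<alpha> g x = x"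
  by (simp add: stabilizer_def)

lemma stabilizer_subset_carrier: "stabilizer G \<alpha> x \<subseteq> carrier G"
  by (auto simp: stabilizer_def)

lemma weight_nonneg: "0 \<le> weight G \<alpha> x"
  by (simp add: weight_def)

lemma weight_le_1: "weight G \<alpha> x \<le> 1"
  by (cases "card (stabilizer G \<alpha> x) = 0") (auto simp: weight_def divide_simps)

section \<open>Orbits, stabilizers and invariant functions\<close>

context gset begin

lemma act_inv_left: "g \<in> carrier G \<Longrightarrow> x \<in> \<Omega> \<Longrightarrow> \<alpha> (inv g) (\<alpha> g x) = x"
  by (metis act_mult act_one inv_closed l_inv)

lemma act_inv_right: "g \<in> carrier G \<Longrightarrow> x \<in> \<Omega> \<Longrightarrow> \<alpha> g (\<alpha> (inv g) x) = x"
  by (metis act_mult act_one inv_closed r_inv)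

lemma act_eq_move: "g \<in> carrier G \<Longrightarrow> h \<in> carrier G \<Longrightarrow> x \<in> \<Omega> \<Longrightarrow> y \<in> \<Omega> \<Longrightarrow>
    \<alpha> g x = \<alpha> h y \<longleftrightarrow> \<alpha> (inv h \<otimes> g) x = y"
  by (metis act_closed act_inv_left act_inv_right act_mult inv_closed)

lemma stabilizer_subgroup: "x \<in> \<Omega> \<Longrightarrow> subgroup (stabilizer G \<alpha> x) G"
proof (rule subgroupI)
  fix a assume "x \<in> \<Omega>" "a \<in> stabilizer G \<alpha> x"
  then show "inv a \<in> stabilizer G \<alpha> x"
    using act_inv_left[of a x] by (simp add: in_stabilizer_iff)
next
  assume "x \<in> \<Omega>"
  then have "\<one> \<in> stabilizer G \<alpha> x" by (simp add: in_stabilizer_iff act_one)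
  then show "stabilizer G \<alpha> x \<noteq> {}" by blast
qed (auto simp: in_stabilizer_iff act_mult)

lemma in_orbit_iff: "y \<in> orbit G \<alpha> x \<longleftrightarrow> (\<exists>g\<in>carrier G. y = \<alpha> g x)"
  by (auto simp: orbit_def)

lemma orbit_refl: "x \<in> \<Omega> \<Longrightarrow> x \<in> orbit G \<alpha> x"
  using act_one[of x] one_closed unfolding orbit_def by force

lemma orbit_subset: "x \<in> \<Omega> \<Longrightarrow> orbit G \<alpha> x \<subseteq> \<Omega>"
  by (auto simp: in_orbit_iff act_closed)

lemma orbit_eq:
  assumes "x \<in> \<Omega>" "y \<in> orbit G \<alpha> x"
  shows "orbit G \<alpha> y = orbit G \<alpha> x"
proof -
  obtain g where g: "g \<in> carrier G" "y = \<alpha> g x" using assms in_orbit_iff by auto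
  then show ?thesis
    unfolding set_eq_iff in_orbit_iff
    by (metis act_closed act_inv_left act_mult assms(1) inv_closed m_closed)
qed

lemma orbit_act: "x \<in> \<Omega> \<Longrightarrow> g \<in> carrier G \<Longrightarrow> orbit G \<alpha> (\<alpha> g x) = orbit G \<alpha> x"
  by (rule orbit_eq) (auto simp: in_orbit_iff)

lemma orbit_eq_iff: "x \<in> \<Omega> \<Longrightarrow> y \<in> \<Omega> \<Longrightarrow> orbit G \<alpha> y = orbit G \<alpha> x \<longleftrightarrow> y \<in> orbit G \<alpha> x"
  using orbit_eq orbit_refl by blast

lemma orbit_sym: "x \<in> \<Omega> \<Longrightarrow> y \<in> orbit G \<alpha> x \<Longrightarrow> x \<in> orbit G \<alpha> y"
  using orbit_eq orbit_refl by blast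

lemma in_orbits_orbit: "x \<in> \<Omega> \<Longrightarrow> orbit G \<alpha> x \<in> orbits G \<Omega> \<alpha>"
  by (auto simp: orbits_def)

lemma orbits_elem: "X \<in> orbits G \<Omega> \<alpha> \<Longrightarrow> x \<in> X \<Longrightarrow> x \<in> \<Omega> \<and> orbit G \<alpha> x = X"
  unfolding orbits_def using orbit_subset orbit_eq by blast

lemma lift_orbit: "x \<in> \<Omega> \<Longrightarrow> lift (orbit G \<alpha> x) \<in> orbit G \<alpha> x"
  by (rule lift_in[OF orbit_refl])

lemma lift_orbits:
  assumes "X \<in> orbits G \<Omega> \<alpha>"
  shows "lift X \<in> X" "lift X \<in> \<Omega>" "orbit G \<alpha> (lift X) = X"
proof -
  obtain x where x: "x \<in> \<Omega>" "X = orbit G \<alpha> x" using assms by (auto simp: orbits_def)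
  show "lift X \<in> X" using lift_orbit x by simp
  then show "lift X \<in> \<Omega>" "orbit G \<alpha> (lift X) = X" using orbits_elem[OF assms] by auto
qed

lemma stabilizer_act:
  assumes "x \<in> \<Omega>" "g \<in> carrier G"
  shows "stabilizer G \<alpha> (\<alpha> g x) = (\<lambda>h. g \<otimes> h \<otimes> inv g) ` stabilizer G \<alpha> x"
proof (intro Set.set_eqI iffI)
  fix h assume "h \<in> stabilizer G \<alpha> (\<alpha> g x)"
  then have h: "h \<in> carrier G" "\<alpha> h (\<alpha> g x) = \<alpha> g x" by (auto simp: in_stabilizer_iff)
  have "\<alpha> (inv g \<otimes> h \<otimes> g) x = x"
    using assms h by (simp add: act_mult act_closed act_inv_left)
  moreover have "h = g \<otimes> (inv g \<otimes> h \<otimes> g) \<otimes> inv g"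
    using assms h by (simp add: conjugation_is_surj)
  ultimately show "h \<in> (\<lambda>h. g \<otimes> h \<otimes> inv g) ` stabilizer G \<alpha> x"
    using assms h by (auto simp: in_stabilizer_iff)
qed (use assms in \<open>auto simp: in_stabilizer_iff act_mult act_closed act_inv_left\<close>)

lemma conj_inj: "g \<in> carrier G \<Longrightarrow> inj_on (\<lambda>h. g \<otimes> h \<otimes> inv g) (carrier G)"
  using conjugation_is_inj by (auto intro: inj_onI)

lemma card_stabilizer_act:
  "x \<in> \<Omega> \<Longrightarrow> g \<in> carrier G \<Longrightarrow> card (stabilizer G \<alpha> (\<alpha> g x)) = card (stabilizer G \<alpha> x)"
  by (simp only: stabilizer_act) (rule card_image, rule inj_on_subset[OF conj_inj stabilizer_subset_carrier])

lemma weight_act: "x \<in> \<Omega> \<Longrightarrow> g \<in> carrier G \<Longrightarrow> weight G \<alpha> (\<alpha> g x) = weight G \<alpha> x"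
  by (simp add: weight_def card_stabilizer_act)

lemma card_stabilizer_orbit:
  "x \<in> \<Omega> \<Longrightarrow> y \<in> orbit G \<alpha> x \<Longrightarrow> card (stabilizer G \<alpha> y) = card (stabilizer G \<alpha> x)"
  by (auto simp: in_orbit_iff card_stabilizer_act)

lemma gset_subset:
  assumes "R \<subseteq> \<Omega>" "\<And>g x. g \<in> carrier G \<Longrightarrow> x \<in> R \<Longrightarrow> \<alpha> g x \<in> R"
  shows "gset G R \<alpha>"
  by unfold_locales (use assms act_one act_mult in auto)

lemma gset_orbit: "x \<in> \<Omega> \<Longrightarrow> gset G (orbit G \<alpha> x) \<alpha>"
  by (rule gset_subset) (auto simp: in_orbit_iff act_closed, metis act_mult m_closed)

lemma orbits_orbit: "x \<in> \<Omega> \<Longrightarrow> orbits G (orbit G \<alpha> x) \<alpha> = {orbit G \<alpha> x}"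
  unfolding orbits_def using orbit_eq orbit_refl by blast

definition invariant_fun :: "('a \<Rightarrow> 'n) \<Rightarrow> bool" where
  "invariant_fun w \<longleftrightarrow> (\<forall>g\<in>carrier G. \<forall>x\<in>\<Omega>. w (\<alpha> g x) = w x)"

lemma invariant_weight: "invariant_fun (weight G \<alpha>)"
  by (simp add: invariant_fun_def weight_act)

lemma orbit_sum_orbit:
  "invariant_fun w \<Longrightarrow> x \<in> \<Omega> \<Longrightarrow> orbit_sum G w \<alpha> (orbit G \<alpha> x) = w x"
  using lift_orbit[of x] by (auto simp: orbit_sum_def orbits_orbit in_orbit_iff invariant_fun_def)

end

lemma orbits_mono: "R \<subseteq> \<Omega> \<Longrightarrow> orbits G R \<alpha> \<subseteq> orbits G \<Omega> \<alpha>"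
  by (auto simp: orbits_def)

lemma orbits_image: "orbits G \<Omega> \<alpha> = orbit G \<alpha> ` \<Omega>"
  by (auto simp: orbits_def)

lemma orbit_sum_Un:
  assumes "gset G R \<alpha>" "gset G R' \<alpha>" "R \<inter> R' = {}"
    "finite (orbits G R \<alpha>)" "finite (orbits G R' \<alpha>)"
  shows "orbit_sum G w \<alpha> (R \<union> R') = orbit_sum G w \<alpha> R + orbit_sum G w \<alpha> R'"
proof -
  interpret R: gset G R \<alpha> by fact
  interpret R': gset G R' \<alpha> by fact
  have "orbits G (R \<union> R') \<alpha> = orbits G R \<alpha> \<union> orbits G R' \<alpha>" by (auto simp: orbits_image)
  moreover have "orbits G R \<alpha> \<inter> orbits G R' \<alpha> = {}"
    using R.lift_orbits(2) R'.lift_orbits(2) assms(3) by blast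
  ultimately show ?thesis using assms by (simp add: orbit_sum_def sum.union_disjoint)
qed

lemma orbit_sum_bij:
  assumes "gset G \<Omega> \<alpha>" "gset G \<Omega>' \<alpha>'" "bij_betw f \<Omega> \<Omega>'" "equivariant G \<Omega> \<alpha> \<alpha>' f"
    and w: "\<And>x. x \<in> \<Omega> \<Longrightarrow> w' (f x) = w x"
    and inv: "\<And>g x. g \<in> carrier G \<Longrightarrow> x \<in> \<Omega> \<Longrightarrow> w (\<alpha> g x) = w x"
  shows "orbit_sum G w' \<alpha>' \<Omega>' = orbit_sum G w \<alpha> \<Omega>"
    and "bij_betw ((`) f) (orbits G \<Omega> \<alpha>) (orbits G \<Omega>' \<alpha>')"
proof -
  interpret A: gset G \<Omega> \<alpha> by fact
  interpret B: gset G \<Omega>' \<alpha>' by fact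
  have orb: "f ` orbit G \<alpha> x = orbit G \<alpha>' (f x)" if "x \<in> \<Omega>" for x
  proof -
    have "f ` orbit G \<alpha> x = (\<lambda>g. f (\<alpha> g x)) ` carrier G" by (auto simp: orbit_def)
    also have "\<dots> = (\<lambda>g. \<alpha>' g (f x)) ` carrier G"
      using that assms(4) by (intro image_cong) (auto simp: equivariant_def)
    also have "\<dots> = orbit G \<alpha>' (f x)" by (auto simp: orbit_def)
    finally show ?thesis .
  qed
  have inj: "inj_on f \<Omega>" and img: "f ` \<Omega> = \<Omega>'" using assms(3) by (auto simp: bij_betw_def)
  show bij: "bij_betw ((`) f) (orbits G \<Omega> \<alpha>) (orbits G \<Omega>' \<alpha>')"
    unfolding bij_betw_def
  proof
    have "X \<subseteq> \<Omega>" if "X \<in> orbits G \<Omega> \<alpha>" for X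
      using A.orbits_elem[OF that] by blast
    then show "inj_on ((`) f) (orbits G \<Omega> \<alpha>)"
      using inj by (intro inj_onI) (metis inj_on_image_eq_iff)
    show "(`) f ` orbits G \<Omega> \<alpha> = orbits G \<Omega>' \<alpha>'"
      unfolding orbits_image img[symmetric] image_image using orb by auto
  qed
  have "w' (lift (f ` X)) = w (lift X)" if X: "X \<in> orbits G \<Omega> \<alpha>" for X
  proof -
    have "lift (f ` X) \<in> f ` X" using lift_in[OF imageI[OF A.lift_orbits(1)[OF X]]] .
    then obtain y where y: "y \<in> X" "lift (f ` X) = f y" by blast
    with A.orbits_elem[OF X] A.lift_orbits[OF X] have "y \<in> \<Omega>" "y \<in> orbit G \<alpha> (lift X)" by auto
    with y show ?thesis using w inv A.lift_orbits(2)[OF X] by (auto simp: A.in_orbit_iff)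
  qed
  then show "orbit_sum G w' \<alpha>' \<Omega>' = orbit_sum G w \<alpha> \<Omega>"
    unfolding orbit_sum_def sum.reindex_bij_betw[OF bij, symmetric] by (auto intro!: sum.cong)
qed

text \<open>For the factor 2, the disjoint cosets \<open>H\<close> and \<open>k \<otimes> H\<close>
  both lie in \<open>K\<close>. If \<open>K\<close> is infinite then \<open>card K = 0\<close>, and
  its reciprocal is 0 as well.\<close>

lemma (in group) subgroup_weight_le:
  assumes "subgroup H G" "subgroup K G" "H \<subseteq> K" "finite H"
  shows "1 / real (card K) \<le> 1 / real (card H)"
    and "H \<noteq> K \<Longrightarrow> 1 / real (card K) \<le> 1 / real (card H) / 2"
proof -
  have H: "card H > 0" using assms(1,4) subgroup.one_closed card_gt_0_iff by blast
  show "1 / real (card K) \<le> 1 / real (card H)"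
    using card_mono[OF _ assms(3)] H by (cases "finite K") (auto intro!: divide_left_mono)
  assume "H \<noteq> K"
  then obtain k where k: "k \<in> K" "k \<notin> H" using assms(3) by blast
  show "1 / real (card K) \<le> 1 / real (card H) / 2"
  proof (cases "finite K")
    case True
    interpret H: subgroup H G by fact
    interpret K: subgroup K G by fact
    have kc: "k \<in> carrier G" using k by auto
    have "H \<inter> (\<lambda>h. k \<otimes> h) ` H = {}"
    proof (rule ccontr)
      assume "H \<inter> (\<lambda>h. k \<otimes> h) ` H \<noteq> {}"
      then obtain h h' where h: "h \<in> H" "h' \<in> H" "h = k \<otimes> h'" by blast
      then have "k = h \<otimes> inv h'" using kc by (simp add: m_assoc)
      moreover have "h \<otimes> inv h' \<in> H" using h(1,2) by simp
      ultimately show False using k(2) by metis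
    qed
    moreover have "inj_on (\<lambda>h. k \<otimes> h) H" using kc by (intro inj_onI) auto
    ultimately have "card (H \<union> (\<lambda>h. k \<otimes> h) ` H) = 2 * card H"
      using assms(4) by (simp add: card_Un_disjoint card_image)
    moreover have "H \<union> (\<lambda>h. k \<otimes> h) ` H \<subseteq> K" using assms(3) k by auto
    ultimately have "2 * card H \<le> card K" using True card_mono by metis
    then have "2 * real (card H) \<le> real (card K)" by linarith
    then show ?thesis using H by (simp add: divide_simps)
  qed (simp add: H)
qed

section \<open>Identifying two points of a G-set\<close>

lemma (in gset) quotient_gset:
  assumes r: "equiv \<Omega> r"
    and inv: "\<And>g x y. g \<in> carrier G \<Longrightarrow> (x, y) \<in> r \<Longrightarrow> (\<alpha> g x, \<alpha> g y) \<in> r"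
  obtains \<pi> :: "'a \<Rightarrow> 'a" and \<alpha>' where "gset G (\<pi> ` \<Omega>) \<alpha>'" "equivariant G \<Omega> \<alpha> \<alpha>' \<pi>"
    "\<And>x y. x \<in> \<Omega> \<Longrightarrow> y \<in> \<Omega> \<Longrightarrow> \<pi> x = \<pi> y \<longleftrightarrow> (x, y) \<in> r"
proof -
  define \<pi> where "\<pi> x = lift (r `` {x})" for x
  \<comment> \<open>Acting may lead out of the set of representatives, so \<open>\<pi>\<close> is
    applied afterwards.\<close>
  define \<alpha>' where "\<alpha>' g x = \<pi> (\<alpha> g x)" for g x
  have ker: "\<pi> x = \<pi> y \<longleftrightarrow> (x, y) \<in> r" if "x \<in> \<Omega>" "y \<in> \<Omega>" for x y
  proof
    have *: "(z, \<pi> z) \<in> r" if "z \<in> \<Omega>" for z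
      using lift_in[of z "r `` {z}"] equiv_class_self[OF r that] by (simp add: \<pi>_def)
    assume "\<pi> x = \<pi> y"
    with *[OF that(1)] *[OF that(2)] show "(x, y) \<in> r"
      using r by (metis equivE symE transE)
  next
    assume "(x, y) \<in> r"
    then show "\<pi> x = \<pi> y" using equiv_class_eq[OF r] by (simp add: \<pi>_def)
  qed
  have in_r: "(x, \<pi> x) \<in> r" if "x \<in> \<Omega>" for x
    using lift_in[of x "r `` {x}"] equiv_class_self[OF r that] by (simp add: \<pi>_def)
  have in_\<Omega>: "\<pi> x \<in> \<Omega>" if "x \<in> \<Omega>" for x
    using in_r[OF that] r by (auto elim!: equivE)
  have equi: "\<pi> (\<alpha> g x) = \<alpha>' g (\<pi> x)" if "g \<in> carrier G" "x \<in> \<Omega>" for g x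
    unfolding \<alpha>'_def using inv[OF that(1) in_r[OF that(2)]] ker that in_\<Omega> act_closed by blast
  have "gset G (\<pi> ` \<Omega>) \<alpha>'"
  proof (unfold_locales; clarify)
    fix g x assume "g \<in> carrier G" "x \<in> \<Omega>"
    then show "\<alpha>' g (\<pi> x) \<in> \<pi> ` \<Omega>" using equi act_closed by (metis imageI)
  next
    fix x assume "x \<in> \<Omega>"
    then show "\<alpha>' \<one> (\<pi> x) = \<pi> x" using equi[of \<one> x] act_one by simp
  next
    fix g h x assume "g \<in> carrier G" "h \<in> carrier G" "x \<in> \<Omega>"
    then show "\<alpha>' (g \<otimes> h) (\<pi> x) = \<alpha>' g (\<alpha>' h (\<pi> x))"
      by (simp add: equi[symmetric] act_closed act_mult)
  qed
  then show ?thesis using that[of \<pi> \<alpha>'] equi ker by (simp add: equivariant_def)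
qed

section \<open>The equivalence relation generated by identifying two points\<close>

context gset begin

text \<open>The future stabilizer of the merged point (\<open>stabilizer_glued\<close>): it has to
  contain both stabilizers and everything that carries \<open>x\<close> to \<open>y\<close>.\<close>

definition glue :: "'a \<Rightarrow> 'a \<Rightarrow> 'g set" where
  "glue x y = generate G {h \<in> carrier G. \<alpha> h x = x \<or> \<alpha> h y = y \<or> \<alpha> h x = y}"

definition block :: "'a \<Rightarrow> 'a \<Rightarrow> 'a set" where
  "block x y = {\<alpha> k c | k c. k \<in> glue x y \<and> (c = x \<or> c = y)}"

text \<open>The classes are the translates of \<open>block x y\<close>, and single points elsewhere.
  Writing them down explicitly gives control over the new stabilizers.\<close>

definition glue_rel :: "'a \<Rightarrow> 'a \<Rightarrow> ('a \<times> 'a) set" where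
  "glue_rel x y = {(a, b). a \<in> \<Omega> \<and> b \<in> \<Omega> \<and>
     (a = b \<or> (\<exists>h\<in>carrier G. \<exists>c\<in>block x y. \<exists>d\<in>block x y. a = \<alpha> h c \<and> b = \<alpha> h d))}"

lemma glue_relE:
  assumes "(a, b) \<in> glue_rel x y" "a \<noteq> b"
  obtains h c d where "h \<in> carrier G" "c \<in> block x y" "d \<in> block x y" "a = \<alpha> h c" "b = \<alpha> h d"
  using assms unfolding glue_rel_def by auto

lemma glue_subgroup: "subgroup (glue x y) G"
  unfolding glue_def by (rule generate_is_subgroup) auto

lemma glue_carrier: "k \<in> glue x y \<Longrightarrow> k \<in> carrier G"
  using glue_subgroup subgroup.mem_carrier by metis

lemma glue_stabilizer: "stabilizer G \<alpha> x \<subseteq> glue x y" "stabilizer G \<alpha> y \<subseteq> glue x y"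
  unfolding glue_def stabilizer_def by (auto intro: generate.incl)

lemma glue_incl: "h \<in> carrier G \<Longrightarrow> \<alpha> h x = y \<Longrightarrow> h \<in> glue x y"
  unfolding glue_def by (auto intro: generate.incl)

lemma glue_least:
  "subgroup H G \<Longrightarrow> stabilizer G \<alpha> x \<subseteq> H \<Longrightarrow> stabilizer G \<alpha> y \<subseteq> H \<Longrightarrow>
    (\<And>h. h \<in> carrier G \<Longrightarrow> \<alpha> h x = y \<Longrightarrow> h \<in> H) \<Longrightarrow> glue x y \<subseteq> H"
  unfolding glue_def by (rule generate_subgroup_incl) (auto simp: stabilizer_def)

context
  fixes x y assumes xy: "x \<in> \<Omega>" "y \<in> \<Omega>"
begin

lemma block_subset: "block x y \<subseteq> \<Omega>"
  using xy by (auto simp: block_def act_closed glue_carrier)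

lemma block_base: "x \<in> block x y" "y \<in> block x y"
proof -
  have "\<alpha> \<one> x \<in> block x y" "\<alpha> \<one> y \<in> block x y"
    using subgroup.one_closed[OF glue_subgroup[of x y]] unfolding block_def by blast+
  then show "x \<in> block x y" "y \<in> block x y" using xy by (simp_all add: act_one)
qed

lemma block_act: "k \<in> glue x y \<Longrightarrow> c \<in> block x y \<Longrightarrow> \<alpha> k c \<in> block x y"
proof -
  assume k: "k \<in> glue x y" and "c \<in> block x y"
  then obtain l a where l: "l \<in> glue x y" "a = x \<or> a = y" "c = \<alpha> l a" by (auto simp: block_def)
  then have "\<alpha> k c = \<alpha> (k \<otimes> l) a" using k xy by (auto simp: act_mult glue_carrier)
  moreover have "k \<otimes> l \<in> glue x y" using k l subgroup.m_closed[OF glue_subgroup] by simp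
  ultimately show "\<alpha> k c \<in> block x y" using l unfolding block_def by blast
qed

text \<open>Translates of the block that meet coincide, which is what transitivity needs. Pulling
  both points back by \<open>glue x y\<close> turns \<open>h\<close> into an element carrying one of
  \<open>x\<close>, \<open>y\<close> to one of \<open>x\<close>, \<open>y\<close>. Such an element
  is a generator of \<open>glue x y\<close>, or the inverse of one if it carries \<open>y\<close> to
  \<open>x\<close>.\<close>

lemma block_meets:
  assumes h: "h \<in> carrier G" and c: "c \<in> block x y" and d: "\<alpha> h c \<in> block x y"
  shows "h \<in> glue x y"
proof -
  obtain k a where k: "k \<in> glue x y" "a = x \<or> a = y" "c = \<alpha> k a" using c by (auto simp: block_def)
  obtain l b where l: "l \<in> glue x y" "b = x \<or> b = y" "\<alpha> h c = \<alpha> l b" using d by (auto simp: block_def)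
  have kc: "k \<in> carrier G" "l \<in> carrier G" using k l glue_carrier by auto
  define m where "m = inv l \<otimes> (h \<otimes> k)"
  have m: "m \<in> carrier G" using kc h by (simp add: m_def)
  have ab: "a \<in> \<Omega>" "b \<in> \<Omega>" using k l xy by auto
  have "\<alpha> (h \<otimes> k) a = \<alpha> l b" using l k h kc ab by (simp add: act_mult)
  then have ma: "\<alpha> m a = b" using act_eq_move[of "h \<otimes> k" l a b] kc h ab by (simp add: m_def)
  have "m \<in> glue x y"
  proof (cases "a = y \<and> b = x")
    case True
    then have "\<alpha> (inv m) x = y" using act_inv_left[OF m ab(1)] ma by simp
    then have "inv m \<in> glue x y" using m by (simp add: glue_incl)
    then have "inv (inv m) \<in> glue x y" by (rule subgroup.m_inv_closed[OF glue_subgroup])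
    then show ?thesis using m by simp
  next
    case False
    then have "\<alpha> m x = x \<or> \<alpha> m y = y \<or> \<alpha> m x = y" using ma k(2) l(2) by auto
    then show ?thesis using m unfolding glue_def by (auto intro: generate.incl)
  qed
  moreover have "h = l \<otimes> m \<otimes> inv k"
    using kc h by (simp add: m_def m_assoc[symmetric]) (simp add: m_assoc)
  ultimately show ?thesis
    using k l by (simp add: subgroup.m_closed[OF glue_subgroup] subgroup.m_inv_closed[OF glue_subgroup])
qed

lemma block_glue_rel:
  assumes "c \<in> block x y" "d \<in> block x y"
  shows "(c, d) \<in> glue_rel x y"
proof -
  have cd: "c \<in> \<Omega>" "d \<in> \<Omega>" using assms block_subset by auto
  have "\<exists>h\<in>carrier G. c = \<alpha> h c \<and> d = \<alpha> h d"
    using act_one[OF cd(1)] act_one[OF cd(2)] by (intro bexI[of _ \<one>]) auto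
  with assms cd show ?thesis unfolding glue_rel_def by blast
qed

lemma glue_rel_invariant:
  assumes "g \<in> carrier G" "(a, b) \<in> glue_rel x y"
  shows "(\<alpha> g a, \<alpha> g b) \<in> glue_rel x y"
proof -
  have ab: "a \<in> \<Omega>" "b \<in> \<Omega>" using assms by (auto simp: glue_rel_def)
  show ?thesis
  proof (cases "a = b")
    case False
    then obtain h c d where h: "h \<in> carrier G" "c \<in> block x y" "d \<in> block x y" "a = \<alpha> h c" "b = \<alpha> h d"
      using glue_relE[OF assms(2) False] by metis
    then have "\<alpha> g a = \<alpha> (g \<otimes> h) c" "\<alpha> g b = \<alpha> (g \<otimes> h) d"
      using assms(1) block_subset by (auto simp: act_mult)
    then show ?thesis using h assms(1) ab act_closed unfolding glue_rel_def by blast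
  qed (use assms ab act_closed in \<open>auto simp: glue_rel_def\<close>)
qed

lemma glue_rel_equiv: "equiv \<Omega> (glue_rel x y)"
proof (rule equivI)
  show "glue_rel x y \<subseteq> \<Omega> \<times> \<Omega>" by (auto simp: glue_rel_def)
  show "refl_on \<Omega> (glue_rel x y)" by (auto simp: glue_rel_def refl_on_def)
  show "sym (glue_rel x y)" unfolding glue_rel_def sym_def by blast
  show "trans (glue_rel x y)"
  proof (rule transI)
    fix a b e assume ab: "(a, b) \<in> glue_rel x y" and be: "(b, e) \<in> glue_rel x y"
    show "(a, e) \<in> glue_rel x y"
    proof (cases "a = b \<or> b = e")
      case False
      then have ne: "a \<noteq> b" "b \<noteq> e" by auto
      obtain h c d where
        h: "h \<in> carrier G" "c \<in> block x y" "d \<in> block x y" "a = \<alpha> h c" "b = \<alpha> h d"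
        by (rule glue_relE[OF ab ne(1)])
      obtain h' c' d' where
        h': "h' \<in> carrier G" "c' \<in> block x y" "d' \<in> block x y" "b = \<alpha> h' c'" "e = \<alpha> h' d'"
        by (rule glue_relE[OF be ne(2)])
      have \<Omega>: "c \<in> \<Omega>" "d \<in> \<Omega>" "c' \<in> \<Omega>" using h h' block_subset by auto
      have "\<alpha> (inv h' \<otimes> h) d = c'"
        using h(5) h'(4) act_eq_move[OF h(1) h'(1) \<Omega>(2,3)] by simp
      then have k: "inv h' \<otimes> h \<in> glue x y" using block_meets[of "inv h' \<otimes> h" d] h h' by simp
      have "a = \<alpha> h' (\<alpha> (inv h' \<otimes> h) c)"
        using h h' \<Omega> by (simp add: act_mult act_inv_right act_closed)
      moreover have "a \<in> \<Omega>" "e \<in> \<Omega>" using ab be by (auto simp: glue_rel_def)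
      ultimately show ?thesis using block_act[OF k h(2)] h' unfolding glue_rel_def by blast
    qed (use ab be in auto)
  qed
qed

end

end

text \<open>The map \<open>\<pi>\<close> is the quotient by the least invariant equivalence relation identifying \<open>x\<close>
  and \<open>y\<close>; representatives instead of classes keep the type fixed, as the induction over folds needs.\<close>

locale merge = gset G \<Omega> \<alpha>
  for G (structure) and \<Omega> :: "'a set" and \<alpha> :: "'g \<Rightarrow> 'a \<Rightarrow> 'a" +
  fixes x y :: 'a and \<pi> :: "'a \<Rightarrow> 'a" and \<alpha>' :: "'g \<Rightarrow> 'a \<Rightarrow> 'a"
  assumes xy: "x \<in> \<Omega>" "y \<in> \<Omega>"
    and target: "gset G (\<pi> ` \<Omega>) \<alpha>'"
    and equivariant: "equivariant G \<Omega> \<alpha> \<alpha>' \<pi>"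
    and kernel: "a \<in> \<Omega> \<Longrightarrow> b \<in> \<Omega> \<Longrightarrow> \<pi> a = \<pi> b \<longleftrightarrow> (a, b) \<in> glue_rel x y"

lemma (in gset) merge_exists:
  assumes "x \<in> \<Omega>" "y \<in> \<Omega>"
  obtains \<pi> \<alpha>' where "merge G \<Omega> \<alpha> x y \<pi> \<alpha>'"
proof -
  obtain \<pi> :: "'a \<Rightarrow> 'a" and \<alpha>' where *: "gset G (\<pi> ` \<Omega>) \<alpha>'" "equivariant G \<Omega> \<alpha> \<alpha>' \<pi>"
    "\<And>a b. a \<in> \<Omega> \<Longrightarrow> b \<in> \<Omega> \<Longrightarrow> \<pi> a = \<pi> b \<longleftrightarrow> (a, b) \<in> glue_rel x y"
    using quotient_gset[OF glue_rel_equiv[OF assms] glue_rel_invariant[OF assms]] by blast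
  have "merge G \<Omega> \<alpha> x y \<pi> \<alpha>'"
    by (intro merge.intro merge_axioms.intro gset_axioms) (use assms * in auto)
  then show ?thesis by (rule that)
qed

sublocale merge \<subseteq> T: gset G "\<pi> ` \<Omega>" \<alpha>'
  by (rule target)

context merge begin

lemma \<pi>_act: "g \<in> carrier G \<Longrightarrow> a \<in> \<Omega> \<Longrightarrow> \<pi> (\<alpha> g a) = \<alpha>' g (\<pi> a)"
  using equivariant by (simp add: equivariant_def)

lemma \<pi>_xy: "\<pi> x = \<pi> y"
  using block_glue_rel[OF xy block_base[OF xy]] kernel xy by simp

abbreviation "orbs \<equiv> orbit G \<alpha> x \<union> orbit G \<alpha> y"

lemma block_orbs: "c \<in> block x y \<Longrightarrow> h \<in> carrier G \<Longrightarrow> \<alpha> h c \<in> orbs"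
proof -
  assume h: "h \<in> carrier G" and "c \<in> block x y"
  then obtain l a where l: "l \<in> carrier G" "a = x \<or> a = y" "c = \<alpha> l a"
    using glue_carrier unfolding block_def by blast
  then have "\<alpha> h c = \<alpha> (h \<otimes> l) a" "h \<otimes> l \<in> carrier G" using h xy by (auto simp: act_mult)
  then show "\<alpha> h c \<in> orbs" using l(2) unfolding orbit_def by blast
qed

lemma \<pi>_eq_cases: "a \<in> \<Omega> \<Longrightarrow> b \<in> \<Omega> \<Longrightarrow> \<pi> a = \<pi> b \<Longrightarrow> a = b \<or> a \<in> orbs \<and> b \<in> orbs"
proof (rule ccontr)
  assume a: "a \<in> \<Omega>" "b \<in> \<Omega>" "\<pi> a = \<pi> b" and ne: "\<not> (a = b \<or> a \<in> orbs \<and> b \<in> orbs)"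
  then have r: "(a, b) \<in> glue_rel x y" and ab: "a \<noteq> b" using kernel by auto
  obtain h c d where h: "h \<in> carrier G" "c \<in> block x y" "d \<in> block x y" "a = \<alpha> h c" "b = \<alpha> h d"
    by (rule glue_relE[OF r ab])
  then have "a \<in> orbs" "b \<in> orbs" using block_orbs[OF h(2,1)] block_orbs[OF h(3,1)] by simp_all
  with ne show False by blast
qed

lemma stabilizer_mono: "a \<in> \<Omega> \<Longrightarrow> stabilizer G \<alpha> a \<subseteq> stabilizer G \<alpha>' (\<pi> a)"
  by (auto simp: in_stabilizer_iff \<pi>_act[symmetric])

lemma stabilizer_outside:
  assumes "a \<in> \<Omega>" "a \<notin> orbs"
  shows "stabilizer G \<alpha>' (\<pi> a) = stabilizer G \<alpha> a"
proof
  show "stabilizer G \<alpha>' (\<pi> a) \<subseteq> stabilizer G \<alpha> a"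
    using assms \<pi>_eq_cases[of _ a] by (auto simp: in_stabilizer_iff \<pi>_act[symmetric] act_closed)
qed (rule stabilizer_mono[OF assms(1)])

text \<open>An element fixes the merged point iff it moves \<open>x\<close> within its class, and
  this class is the block.\<close>

lemma stabilizer_glued: "stabilizer G \<alpha>' (\<pi> x) = glue x y"
proof (intro Set.set_eqI iffI)
  fix g assume "g \<in> stabilizer G \<alpha>' (\<pi> x)"
  then have g: "g \<in> carrier G" "\<pi> (\<alpha> g x) = \<pi> x" by (auto simp: in_stabilizer_iff \<pi>_act xy)
  then have r: "(\<alpha> g x, x) \<in> glue_rel x y" using kernel xy act_closed by blast
  show "g \<in> glue x y"
  proof (cases "\<alpha> g x = x")
    case True
    then show ?thesis using g glue_stabilizer(1) by (auto simp: stabilizer_def)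
  next
    case False
    then obtain h c d where h: "h \<in> carrier G" "c \<in> block x y" "d \<in> block x y" "\<alpha> g x = \<alpha> h c" "x = \<alpha> h d"
      using glue_relE[OF r False] by metis
    then have "h \<in> glue x y" using block_meets[OF xy h(1,3)] block_base(1)[OF xy] by simp
    then have "\<alpha> g x \<in> block x y" using h block_act[OF xy] by simp
    then show ?thesis using block_meets[OF xy g(1) block_base(1)[OF xy]] by simp
  qed
next
  fix g assume g: "g \<in> glue x y"
  then have gc: "g \<in> carrier G" by (rule glue_carrier)
  have "\<alpha> g x \<in> block x y" using block_act[OF xy g block_base(1)[OF xy]] .
  then have "(\<alpha> g x, x) \<in> glue_rel x y"
    using block_glue_rel[OF xy _ block_base(1)[OF xy]] by simp
  then show "g \<in> stabilizer G \<alpha>' (\<pi> x)"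
    using kernel xy gc act_closed by (simp add: in_stabilizer_iff \<pi>_act[symmetric])
qed

text \<open>The universal property of the quotient. The stabilizer of the common value
  \<open>f x = f y\<close> contains the generators of \<open>glue x y\<close>, so \<open>f\<close>
  is constant on the block and, by equivariance, on every translate of it.\<close>

lemma factors:
  assumes "gset G \<Omega>2 \<beta>" "f ` \<Omega> \<subseteq> \<Omega>2" "equivariant G \<Omega> \<alpha> \<beta> f" "f x = f y"
    and "a \<in> \<Omega>" "b \<in> \<Omega>" "\<pi> a = \<pi> b"
  shows "f a = f b"
proof (cases "a = b")
  case False
  interpret B: gset G \<Omega>2 \<beta> by fact
  have eq: "f (\<alpha> g z) = \<beta> g (f z)" if "g \<in> carrier G" "z \<in> \<Omega>" for g z
    using assms(3) that by (simp add: equivariant_def)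
  have fx: "f x \<in> \<Omega>2" using assms(2) xy by blast
  have "glue x y \<subseteq> stabilizer G \<beta> (f x)"
  proof (rule glue_least[OF B.stabilizer_subgroup[OF fx]])
    show "stabilizer G \<alpha> x \<subseteq> stabilizer G \<beta> (f x)"
      using eq[OF _ xy(1)] by (metis in_stabilizer_iff subsetI)
    show "stabilizer G \<alpha> y \<subseteq> stabilizer G \<beta> (f x)"
      using eq[OF _ xy(2)] assms(4) by (metis in_stabilizer_iff subsetI)
    show "h \<in> stabilizer G \<beta> (f x)" if "h \<in> carrier G" "\<alpha> h x = y" for h
      using eq[OF that(1) xy(1)] that assms(4) by (simp add: in_stabilizer_iff)
  qed
  then have blk: "f c = f x" if "c \<in> block x y" for c
    using that eq xy glue_carrier assms(4) unfolding block_def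
    by (auto simp: in_stabilizer_iff subset_iff)
  obtain h c d where h: "h \<in> carrier G" "c \<in> block x y" "d \<in> block x y" "a = \<alpha> h c" "b = \<alpha> h d"
    using glue_relE[of a b x y] False assms kernel by metis
  then show ?thesis using blk eq block_subset[OF xy] by (metis subsetD)
qed simp

lemma orbs_act: "g \<in> carrier G \<Longrightarrow> a \<in> \<Omega> \<Longrightarrow> \<alpha> g a \<in> orbs \<longleftrightarrow> a \<in> orbs"
  using orbit_eq_iff[of _ "\<alpha> g a"] orbit_eq_iff[of _ a] orbit_act[of a g] act_closed[of g a] xy
  by auto

lemma \<pi>_orbs: "a \<in> \<Omega> \<Longrightarrow> \<pi> a \<in> orbit G \<alpha>' (\<pi> x) \<longleftrightarrow> a \<in> orbs"
proof
  assume a: "a \<in> \<Omega>" "\<pi> a \<in> orbit G \<alpha>' (\<pi> x)"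
  then obtain g where "g \<in> carrier G" "\<pi> a = \<pi> (\<alpha> g x)" using xy by (auto simp: in_orbit_iff orbit_def \<pi>_act)
  then show "a \<in> orbs" using \<pi>_eq_cases[OF a(1), of "\<alpha> g x"] xy act_closed orbs_act orbit_refl by blast
next
  assume "a \<in> orbs"
  then show "\<pi> a \<in> orbit G \<alpha>' (\<pi> x)" using xy \<pi>_xy by (auto simp: orbit_def \<pi>_act)
qed

end

lemma orbit_sum_empty [simp]: "orbit_sum G w \<alpha> {} = 0"
  by (simp add: orbit_sum_def orbits_def)

lemma (in group) gset_empty: "gset G {} \<alpha>"
  by unfold_locales auto

lemma (in gset) gset_Un: "gset G R \<alpha> \<Longrightarrow> gset G (\<Omega> \<union> R) \<alpha>"
proof -
  assume "gset G R \<alpha>"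
  then interpret R: gset G R \<alpha> .
  show ?thesis
    by unfold_locales (auto simp: act_closed act_one act_mult R.act_closed R.act_one R.act_mult)
qed

lemma finite_orbits_Un:
  "finite (orbits G R \<alpha>) \<Longrightarrow> finite (orbits G R' \<alpha>) \<Longrightarrow> finite (orbits G (R \<union> R') \<alpha>)"
  by (simp add: orbits_image image_Un)

section \<open>Orbit sums before and after a merge\<close>

context merge begin

lemma finite_orbits_target:
  assumes "finite (orbits G \<Omega> \<alpha>)"
  shows "finite (orbits G (\<pi> ` \<Omega>) \<alpha>')"
proof -
  have "orbit G \<alpha>' (\<pi> a) = \<pi> ` orbit G \<alpha> a" if "a \<in> \<Omega>" for a
  proof -
    have "orbit G \<alpha>' (\<pi> a) = (\<lambda>g. \<alpha>' g (\<pi> a)) ` carrier G" by (auto simp: orbit_def)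
    also have "\<dots> = (\<lambda>g. \<pi> (\<alpha> g a)) ` carrier G"
      by (intro image_cong) (simp_all add: \<pi>_act that)
    also have "\<dots> = \<pi> ` orbit G \<alpha> a" by (auto simp: orbit_def)
    finally show ?thesis .
  qed
  then have "orbits G (\<pi> ` \<Omega>) \<alpha>' = (`) \<pi> ` orbits G \<Omega> \<alpha>"
    by (auto simp: orbits_image image_image)
  then show ?thesis using assms by simp
qed

context
  fixes R assumes R: "R \<subseteq> \<Omega>" "\<And>g a. g \<in> carrier G \<Longrightarrow> a \<in> R \<Longrightarrow> \<alpha> g a \<in> R"
    and fin: "finite (orbits G \<Omega> \<alpha>)"
begin

lemma in_R_iff: "a \<in> \<Omega> \<Longrightarrow> b \<in> orbit G \<alpha> a \<Longrightarrow> b \<in> R \<longleftrightarrow> a \<in> R"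
proof -
  have closed: "d \<in> R" if "c \<in> R" "d \<in> orbit G \<alpha> c" for c d
    using R(2) that by (auto simp: in_orbit_iff)
  assume "a \<in> \<Omega>" "b \<in> orbit G \<alpha> a"
  then show "b \<in> R \<longleftrightarrow> a \<in> R" using closed[of a b] closed[of b a] orbit_sym[of a b] by blast
qed

lemma finite_orbits_subset: "S \<subseteq> \<Omega> \<Longrightarrow> finite (orbits G S \<alpha>)"
  using finite_subset[OF orbits_mono fin] .

lemma outside_gset: "gset G (R - orbs) \<alpha>"
proof (rule gset_subset)
  fix g a assume "g \<in> carrier G" "a \<in> R - orbs"
  then show "\<alpha> g a \<in> R - orbs" using R(2)[of g a] orbs_act[of g a] R(1) by blast
qed (use R in auto)

lemma \<pi>_outside_bij: "bij_betw \<pi> (R - orbs) (\<pi> ` (R - orbs))"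
  unfolding bij_betw_def
proof (intro conjI inj_onI refl)
  fix a b assume "a \<in> R - orbs" "b \<in> R - orbs" "\<pi> a = \<pi> b"
  then show "a = b" using \<pi>_eq_cases[of a b] R(1) by blast
qed

lemma image_outside_gset: "gset G (\<pi> ` (R - orbs)) \<alpha>'"
proof (rule T.gset_subset)
  fix g b assume "g \<in> carrier G" "b \<in> \<pi> ` (R - orbs)"
  then obtain a where a: "a \<in> R - orbs" "b = \<pi> a" by blast
  then have "\<alpha>' g b = \<pi> (\<alpha> g a)" using R(1) \<open>g \<in> carrier G\<close> \<pi>_act[of g a] by auto
  then show "\<alpha>' g b \<in> \<pi> ` (R - orbs)"
    using gset.act_closed[OF outside_gset \<open>g \<in> carrier G\<close> a(1)] by simp
qed (use R in auto)

text \<open>If \<open>x\<close> and \<open>y\<close> share an orbit it must be counted once, hence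
  the extra condition in the last summand.\<close>

lemma orbit_sum_source:
  assumes w: "invariant_fun w"
  shows "orbit_sum G w \<alpha> R = orbit_sum G w \<alpha> (R - orbs) +
    (if x \<in> R then w x else 0) + (if y \<in> R \<and> y \<notin> orbit G \<alpha> x then w y else 0)"
proof -
  define A where "A = (if x \<in> R then orbit G \<alpha> x else {})"
  define B where "B = (if y \<in> R \<and> y \<notin> orbit G \<alpha> x then orbit G \<alpha> y else {})"
  have Rx: "orbit G \<alpha> x \<subseteq> R" if "x \<in> R" using that in_R_iff[OF xy(1)] by auto
  have Ry: "orbit G \<alpha> y \<subseteq> R" if "y \<in> R" using that in_R_iff[OF xy(2)] by auto
  have Nx: "orbit G \<alpha> x \<inter> R = {}" if "x \<notin> R" using that in_R_iff[OF xy(1)] by auto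
  have Ny: "orbit G \<alpha> y \<inter> R = {}" if "y \<notin> R" using that in_R_iff[OF xy(2)] by auto
  have oxy: "orbit G \<alpha> y = orbit G \<alpha> x" if "y \<in> orbit G \<alpha> x" using orbit_eq[OF xy(1) that] .
  have dxy: "orbit G \<alpha> x \<inter> orbit G \<alpha> y = {}" if "y \<notin> orbit G \<alpha> x"
    using that orbit_eq[OF xy(1)] orbit_eq[OF xy(2)] orbit_refl[OF xy(2)] by blast
  have split: "R = (R - orbs) \<union> A \<union> B"
    unfolding A_def B_def using Rx Ry Nx Ny oxy by (cases "x \<in> R"; cases "y \<in> R"; auto)
  have gA: "gset G A \<alpha>" "gset G B \<alpha>"
    using gset_orbit xy gset_empty by (auto simp: A_def B_def)
  have sub: "A \<subseteq> \<Omega>" "B \<subseteq> \<Omega>" using orbit_subset xy by (auto simp: A_def B_def)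
  have disj: "(R - orbs) \<inter> A = {}" "((R - orbs) \<union> A) \<inter> B = {}"
    using dxy by (auto simp: A_def B_def)
  have g1: "gset G ((R - orbs) \<union> A) \<alpha>" by (rule gset.gset_Un[OF outside_gset gA(1)])
  have sub0: "R - orbs \<subseteq> \<Omega>" using R(1) by blast
  note f = finite_orbits_subset
  have "orbit_sum G w \<alpha> R = orbit_sum G w \<alpha> ((R - orbs) \<union> A \<union> B)" using split by simp
  also have "\<dots> = orbit_sum G w \<alpha> (R - orbs) + orbit_sum G w \<alpha> A + orbit_sum G w \<alpha> B"
    using orbit_sum_Un[OF g1 gA(2) disj(2) finite_orbits_Un[OF f f] f, of w]
      orbit_sum_Un[OF outside_gset gA(1) disj(1) f f, of w] sub sub0 by simp
  also have "orbit_sum G w \<alpha> A = (if x \<in> R then w x else 0)"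
    using orbit_sum_orbit[OF w xy(1)] by (simp add: A_def)
  also have "orbit_sum G w \<alpha> B = (if y \<in> R \<and> y \<notin> orbit G \<alpha> x then w y else 0)"
    using orbit_sum_orbit[OF w xy(2)] by (simp add: B_def)
  finally show ?thesis .
qed

lemma orbit_sum_outside:
  assumes w: "invariant_fun w" and w': "\<And>a. a \<in> R - orbs \<Longrightarrow> w' (\<pi> a) = w a"
  shows "orbit_sum G w' \<alpha>' (\<pi> ` (R - orbs)) = orbit_sum G w \<alpha> (R - orbs)"
    and "finite (orbits G (\<pi> ` (R - orbs)) \<alpha>')"
proof -
  have e: "equivariant G (R - orbs) \<alpha> \<alpha>' \<pi>"
    using R by (auto simp: equivariant_def \<pi>_act)
  have i: "w (\<alpha> g a) = w a" if "g \<in> carrier G" "a \<in> R - orbs" for g a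
    using that w R by (auto simp: invariant_fun_def)
  show "orbit_sum G w' \<alpha>' (\<pi> ` (R - orbs)) = orbit_sum G w \<alpha> (R - orbs)"
    using orbit_sum_bij(1)[OF outside_gset image_outside_gset \<pi>_outside_bij e, of w' w] w' i by blast
  have "bij_betw ((`) \<pi>) (orbits G (R - orbs) \<alpha>) (orbits G (\<pi> ` (R - orbs)) \<alpha>')"
    using orbit_sum_bij(2)[OF outside_gset image_outside_gset \<pi>_outside_bij e, of w' w] w' i by blast
  moreover have "finite (orbits G (R - orbs) \<alpha>)"
    by (rule finite_orbits_subset) (use R(1) in blast)
  ultimately show "finite (orbits G (\<pi> ` (R - orbs)) \<alpha>')"
    by (simp add: bij_betw_finite)
qed

lemma image_R_split: "\<pi> ` R \<union> orbit G \<alpha>' (\<pi> x) = \<pi> ` (R - orbs) \<union> orbit G \<alpha>' (\<pi> x)"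
proof -
  have "\<pi> a \<in> orbit G \<alpha>' (\<pi> x)" if "a \<in> R" "a \<in> orbs" for a
    using \<pi>_orbs[of a] that R(1) by blast
  then show ?thesis by blast
qed

text \<open>No subtraction occurs, since the values only form a monoid. Adding the merged orbit to
  the image makes \<open>w' (\<pi> x)\<close> appear whether or not \<open>R\<close> contained
  \<open>x\<close> or \<open>y\<close>.\<close>

lemma orbit_sum_merge:
  assumes w: "invariant_fun w" and w': "\<And>a. a \<in> \<Omega> \<Longrightarrow> a \<notin> orbs \<Longrightarrow> w' (\<pi> a) = w a"
    and inv: "T.invariant_fun w'"
  shows "orbit_sum G w' \<alpha>' (\<pi> ` R \<union> orbit G \<alpha>' (\<pi> x)) +
     (if x \<in> R then w x else 0) + (if y \<in> R \<and> y \<notin> orbit G \<alpha> x then w y else 0) =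
   orbit_sum G w \<alpha> R + w' (\<pi> x)"
proof -
  have px: "\<pi> x \<in> \<pi> ` \<Omega>" using xy by simp
  have w1: "w' (\<pi> a) = w a" if "a \<in> R - orbs" for a using that w' R(1) by blast
  have "orbit_sum G w' \<alpha>' (\<pi> ` (R - orbs) \<union> orbit G \<alpha>' (\<pi> x)) =
      orbit_sum G w' \<alpha>' (\<pi> ` (R - orbs)) + orbit_sum G w' \<alpha>' (orbit G \<alpha>' (\<pi> x))"
  proof (rule orbit_sum_Un[OF image_outside_gset T.gset_orbit[OF px]])
    have "\<pi> a \<notin> orbit G \<alpha>' (\<pi> x)" if "a \<in> R - orbs" for a
      using \<pi>_orbs[of a] that R(1) by blast
    then show "\<pi> ` (R - orbs) \<inter> orbit G \<alpha>' (\<pi> x) = {}" by blast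
    show "finite (orbits G (\<pi> ` (R - orbs)) \<alpha>')" by (rule orbit_sum_outside(2)[OF w w1])
    show "finite (orbits G (orbit G \<alpha>' (\<pi> x)) \<alpha>')" using px by (simp add: T.orbits_orbit)
  qed
  also have "orbit_sum G w' \<alpha>' (orbit G \<alpha>' (\<pi> x)) = w' (\<pi> x)"
    by (rule T.orbit_sum_orbit[OF inv px])
  also have "orbit_sum G w' \<alpha>' (\<pi> ` (R - orbs)) = orbit_sum G w \<alpha> (R - orbs)"
    by (rule orbit_sum_outside(1)[OF w w1])
  finally show ?thesis by (simp add: image_R_split orbit_sum_source[OF w] add_ac)
qed

lemma orbit_sum_merge_outside:
  assumes w: "invariant_fun w" and w': "\<And>a. a \<in> \<Omega> \<Longrightarrow> a \<notin> orbs \<Longrightarrow> w' (\<pi> a) = w a"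
    and "x \<notin> R" "y \<notin> R"
  shows "orbit_sum G w' \<alpha>' (\<pi> ` R) = orbit_sum G w \<alpha> R"
proof -
  have "R - orbs = R" using assms(3,4) in_R_iff[OF xy(1)] in_R_iff[OF xy(2)] by blast
  then show ?thesis using orbit_sum_outside(1)[OF w, of w'] w' R(1) by auto
qed

end

lemma orbit_sum_merge_all:
  assumes fin: "finite (orbits G \<Omega> \<alpha>)" and w: "invariant_fun w"
    and w': "\<And>a. a \<in> \<Omega> \<Longrightarrow> a \<notin> orbs \<Longrightarrow> w' (\<pi> a) = w a" and inv: "T.invariant_fun w'"
  shows "orbit_sum G w' \<alpha>' (\<pi> ` \<Omega>) + w x + (if y \<notin> orbit G \<alpha> x then w y else 0) =
    orbit_sum G w \<alpha> \<Omega> + w' (\<pi> x)"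
proof -
  have "\<pi> ` \<Omega> \<union> orbit G \<alpha>' (\<pi> x) = \<pi> ` \<Omega>" using T.orbit_subset[of "\<pi> x"] xy by auto
  then show ?thesis
    using orbit_sum_merge[OF subset_refl act_closed fin w w' inv] xy by simp
qed

lemma weight_outside: "a \<in> \<Omega> \<Longrightarrow> a \<notin> orbs \<Longrightarrow> weight G \<alpha>' (\<pi> a) = weight G \<alpha> a"
  by (simp add: weight_def stabilizer_outside)

end

section \<open>Absorbing sets in graphs with a group action\<close>

locale ggraph = V: gset G V \<alpha> + E: gset G E \<beta>
  for G (structure) and V :: "'v set" and \<alpha> :: "'g \<Rightarrow> 'v \<Rightarrow> 'v"
    and E :: "'e set" and \<beta> :: "'g \<Rightarrow> 'e \<Rightarrow> 'e" +
  fixes i t :: "'e \<Rightarrow> 'v"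
  assumes ends_closed: "e \<in> E \<Longrightarrow> i e \<in> V" "e \<in> E \<Longrightarrow> t e \<in> V"
    and ends_act: "g \<in> carrier G \<Longrightarrow> e \<in> E \<Longrightarrow> i (\<beta> g e) = \<alpha> g (i e)"
      "g \<in> carrier G \<Longrightarrow> e \<in> E \<Longrightarrow> t (\<beta> g e) = \<alpha> g (t e)"

definition arrows ::
  "('g, 'b) monoid_scheme \<Rightarrow> ('g \<Rightarrow> 'v \<Rightarrow> 'v) \<Rightarrow> 'e set \<Rightarrow> ('g \<Rightarrow> 'e \<Rightarrow> 'e) \<Rightarrow>
   ('e \<Rightarrow> 'v) \<Rightarrow> ('e \<Rightarrow> 'v) \<Rightarrow> ('v \<times> 'v) set" where
  "arrows G \<alpha> E \<beta> i t = {(u, v). \<exists>e\<in>E. (i e = u \<and> t e = v \<or> t e = u \<and> i e = v) \<and>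
     stabilizer G \<beta> e = stabilizer G \<alpha> u}"

definition absorbing ::
  "('g, 'b) monoid_scheme \<Rightarrow> 'v set \<Rightarrow> ('g \<Rightarrow> 'v \<Rightarrow> 'v) \<Rightarrow> 'e set \<Rightarrow> ('g \<Rightarrow> 'e \<Rightarrow> 'e) \<Rightarrow>
   ('e \<Rightarrow> 'v) \<Rightarrow> ('e \<Rightarrow> 'v) \<Rightarrow> 'v set \<Rightarrow> bool" where
  "absorbing G V \<alpha> E \<beta> i t R \<longleftrightarrow> R \<subseteq> V \<and> (\<forall>g\<in>carrier G. \<forall>r\<in>R. \<alpha> g r \<in> R) \<and>
     (\<forall>v\<in>V. \<exists>r\<in>R. (v, r) \<in> (arrows G \<alpha> E \<beta> i t)\<^sup>*)"

definition cost ::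
  "('g, 'b) monoid_scheme \<Rightarrow> 'v set \<Rightarrow> ('g \<Rightarrow> 'v \<Rightarrow> 'v) \<Rightarrow> 'e set \<Rightarrow> ('g \<Rightarrow> 'e \<Rightarrow> 'e) \<Rightarrow>
   'v set \<Rightarrow> real" where
  "cost G V \<alpha> E \<beta> R = orbit_sum G (weight G \<beta>) \<beta> E - orbit_sum G (weight G \<alpha>) \<alpha> V
     + orbit_sum G (weight G \<alpha>) \<alpha> R"

lemma arrows_swap: "arrows G \<alpha> E \<beta> t i = arrows G \<alpha> E \<beta> i t"
  by (auto simp: arrows_def)

lemma adj_swap: "adj E t i = adj E i t"
  by (auto simp: adj_def)

lemma absorbing_swap: "absorbing G V \<alpha> E \<beta> t i R = absorbing G V \<alpha> E \<beta> i t R"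
  by (simp add: absorbing_def arrows_swap)

lemma rtrancl_image:
  assumes "(u, v) \<in> r\<^sup>*" "\<And>a b. (a, b) \<in> r \<Longrightarrow> (f a, f b) \<in> s"
  shows "(f u, f v) \<in> s\<^sup>*"
  using assms(1) by induction (auto intro: rtrancl_into_rtrancl assms(2))

section \<open>Stabilizers along arrows, and translation of arrows\<close>

context ggraph begin

lemma swap: "ggraph G V \<alpha> E \<beta> t i"
  by unfold_locales (auto simp: ends_closed ends_act)

lemma stabilizer_ends:
  assumes "e \<in> E"
  shows "stabilizer G \<beta> e \<subseteq> stabilizer G \<alpha> (i e)" "stabilizer G \<beta> e \<subseteq> stabilizer G \<alpha> (t e)"
proof -
  show "stabilizer G \<beta> e \<subseteq> stabilizer G \<alpha> (i e)"
  proof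
    fix g assume "g \<in> stabilizer G \<beta> e"
    then show "g \<in> stabilizer G \<alpha> (i e)" using ends_act(1)[of g e] assms by (simp add: in_stabilizer_iff)
  qed
  show "stabilizer G \<beta> e \<subseteq> stabilizer G \<alpha> (t e)"
  proof
    fix g assume "g \<in> stabilizer G \<beta> e"
    then show "g \<in> stabilizer G \<alpha> (t e)" using ends_act(2)[of g e] assms by (simp add: in_stabilizer_iff)
  qed
qed

abbreviation "arr \<equiv> arrows G \<alpha> E \<beta> i t"

lemma arrow_verts: "(u, v) \<in> arr \<Longrightarrow> u \<in> V \<and> v \<in> V"
  using ends_closed by (auto simp: arrows_def)

lemma arrow_stabilizer: "(u, v) \<in> arr \<Longrightarrow> stabilizer G \<alpha> u \<subseteq> stabilizer G \<alpha> v"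
proof -
  assume "(u, v) \<in> arr"
  then obtain e where "e \<in> E" "i e = u \<and> t e = v \<or> t e = u \<and> i e = v"
    "stabilizer G \<beta> e = stabilizer G \<alpha> u"
    by (auto simp: arrows_def)
  then show "stabilizer G \<alpha> u \<subseteq> stabilizer G \<alpha> v" using stabilizer_ends[of e] by auto
qed

lemma arrows_stabilizer: "(u, v) \<in> arr\<^sup>* \<Longrightarrow> stabilizer G \<alpha> u \<subseteq> stabilizer G \<alpha> v"
  by (induction rule: rtrancl_induct) (use arrow_stabilizer in auto)

text \<open>Finiteness of edge stabilizers passes to the source of an arrow, but not to its target.
  This is why the counting arguments below look at a vertex that is left by an arrow.\<close>

lemma arrow_finite: "(u, v) \<in> arr \<Longrightarrow> \<forall>e\<in>E. finite (stabilizer G \<beta> e) \<Longrightarrow> finite (stabilizer G \<alpha> u)"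
  by (auto simp: arrows_def)

lemma arrow_act:
  assumes "(u, v) \<in> arr" "g \<in> carrier G"
  shows "(\<alpha> g u, \<alpha> g v) \<in> arr"
proof -
  from assms(1) obtain e where e: "e \<in> E" "i e = u \<and> t e = v \<or> t e = u \<and> i e = v"
    "stabilizer G \<beta> e = stabilizer G \<alpha> u"
    by (auto simp: arrows_def)
  have "stabilizer G \<beta> (\<beta> g e) = stabilizer G \<alpha> (\<alpha> g u)"
    using e assms arrow_verts by (simp add: E.stabilizer_act V.stabilizer_act)
  moreover have "\<beta> g e \<in> E" using e assms E.act_closed by simp
  moreover have "i (\<beta> g e) = \<alpha> g u \<and> t (\<beta> g e) = \<alpha> g v \<or> t (\<beta> g e) = \<alpha> g u \<and> i (\<beta> g e) = \<alpha> g v"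
    using e assms ends_act by auto
  ultimately show ?thesis unfolding arrows_def by blast
qed

lemma arrows_act: "(u, v) \<in> arr\<^sup>* \<Longrightarrow> g \<in> carrier G \<Longrightarrow> (\<alpha> g u, \<alpha> g v) \<in> arr\<^sup>*"
  by (rule rtrancl_image[where f = "\<alpha> g"]) (auto intro: arrow_act)

lemma adj_act: "(u, v) \<in> (adj E i t)\<^sup>* \<Longrightarrow> g \<in> carrier G \<Longrightarrow> (\<alpha> g u, \<alpha> g v) \<in> (adj E i t)\<^sup>*"
proof (rule rtrancl_image[where f = "\<alpha> g"])
  fix a b assume g: "g \<in> carrier G" and "(a, b) \<in> adj E i t"
  then obtain e where e: "e \<in> E" "i e = a \<and> t e = b \<or> t e = a \<and> i e = b" by (auto simp: adj_def)
  then have "\<beta> g e \<in> E"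
    "i (\<beta> g e) = \<alpha> g a \<and> t (\<beta> g e) = \<alpha> g b \<or> t (\<beta> g e) = \<alpha> g a \<and> i (\<beta> g e) = \<alpha> g b"
    using g ends_act E.act_closed by auto
  then show "(\<alpha> g a, \<alpha> g b) \<in> adj E i t" unfolding adj_def by blast
qed

end

text \<open>The edge map \<open>\<pi>E\<close> is left open so as to cover two situations: a fold,
  where two edges are merged as well, and the gluing of vertices for a generator, where
  \<open>\<pi>E\<close> is the identity.\<close>

locale vmerge = ggraph G V \<alpha> E \<beta> i t + MV: merge G V \<alpha> x1 x2 \<pi>V \<alpha>' +
  D': ggraph G "\<pi>V ` V" \<alpha>' E' \<beta>' i' t'
  for G (structure) and V :: "'v set" and \<alpha> :: "'g \<Rightarrow> 'v \<Rightarrow> 'v"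
    and E :: "'e set" and \<beta> :: "'g \<Rightarrow> 'e \<Rightarrow> 'e" and i t :: "'e \<Rightarrow> 'v"
    and x1 x2 :: 'v and \<pi>V :: "'v \<Rightarrow> 'v" and \<alpha>' :: "'g \<Rightarrow> 'v \<Rightarrow> 'v"
    and E' :: "'e set" and \<beta>' :: "'g \<Rightarrow> 'e \<Rightarrow> 'e" and i' t' :: "'e \<Rightarrow> 'v" +
  fixes \<pi>E :: "'e \<Rightarrow> 'e"
  assumes \<pi>E_image: "\<pi>E ` E = E'"
    and \<pi>E_equivariant: "equivariant G E \<beta> \<beta>' \<pi>E"
    and \<pi>_ends: "e \<in> E \<Longrightarrow> i' (\<pi>E e) = \<pi>V (i e)" "e \<in> E \<Longrightarrow> t' (\<pi>E e) = \<pi>V (t e)"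
begin

abbreviation "arr' \<equiv> arrows G \<alpha>' E' \<beta>' i' t'"

lemma stabilizer_\<pi>E: "e \<in> E \<Longrightarrow> stabilizer G \<beta> e \<subseteq> stabilizer G \<beta>' (\<pi>E e)"
proof
  fix g assume "e \<in> E" "g \<in> stabilizer G \<beta> e"
  moreover have "\<pi>E (\<beta> g e) = \<beta>' g (\<pi>E e)"
    using calculation \<pi>E_equivariant unfolding equivariant_def stabilizer_def by blast
  ultimately show "g \<in> stabilizer G \<beta>' (\<pi>E e)" by (simp add: in_stabilizer_iff)
qed

lemma \<pi>E_in: "e \<in> E \<Longrightarrow> \<pi>E e \<in> E'"
  using \<pi>E_image by blast

text \<open>The stabilizer of the image edge lies between that of the edge and that of
  \<open>\<pi>V u\<close>, and these two agree.\<close>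

lemma arrow_persists:
  assumes "(u, v) \<in> arr" "stabilizer G \<alpha>' (\<pi>V u) = stabilizer G \<alpha> u"
  shows "(\<pi>V u, \<pi>V v) \<in> arr'"
proof -
  from assms(1) obtain e where e: "e \<in> E" "i e = u \<and> t e = v \<or> t e = u \<and> i e = v"
    "stabilizer G \<beta> e = stabilizer G \<alpha> u"
    by (auto simp: arrows_def)
  have ends: "i' (\<pi>E e) = \<pi>V u \<and> t' (\<pi>E e) = \<pi>V v \<or> t' (\<pi>E e) = \<pi>V u \<and> i' (\<pi>E e) = \<pi>V v"
    using e \<pi>_ends by auto
  then have "stabilizer G \<beta>' (\<pi>E e) \<subseteq> stabilizer G \<alpha>' (\<pi>V u)"
    using D'.stabilizer_ends[OF \<pi>E_in[OF e(1)]] by auto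
  then have "stabilizer G \<beta>' (\<pi>E e) = stabilizer G \<alpha>' (\<pi>V u)"
    using stabilizer_\<pi>E[OF e(1)] e(3) assms(2) by blast
  then show ?thesis using ends \<pi>E_in[OF e(1)] unfolding arrows_def by blast
qed

lemma adj_\<pi>: "(u, v) \<in> (adj E i t)\<^sup>* \<Longrightarrow> (\<pi>V u, \<pi>V v) \<in> (adj E' i' t')\<^sup>*"
proof (erule rtrancl_image)
  fix a b assume "(a, b) \<in> adj E i t"
  then obtain e where e: "e \<in> E" "i e = a \<and> t e = b \<or> t e = a \<and> i e = b" by (auto simp: adj_def)
  then have "\<pi>E e \<in> E'"
    "i' (\<pi>E e) = \<pi>V a \<and> t' (\<pi>E e) = \<pi>V b \<or> t' (\<pi>E e) = \<pi>V a \<and> i' (\<pi>E e) = \<pi>V b"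
    using \<pi>_ends \<pi>E_in by auto
  then show "(\<pi>V a, \<pi>V b) \<in> adj E' i' t'" unfolding adj_def by blast
qed

text \<open>An arrow can be destroyed only where it leaves a merged vertex.\<close>

lemma reaches_or_merged:
  assumes "(u, r) \<in> arr\<^sup>*" "u \<in> V" "r \<in> R"
  shows "\<exists>s\<in>\<pi>V ` R \<union> orbit G \<alpha>' (\<pi>V x1). (\<pi>V u, s) \<in> arr'\<^sup>*"
  using assms
proof (induction rule: converse_rtrancl_induct)
  case base
  then show ?case by blast
next
  case (step u v)
  show ?case
  proof (cases "u \<in> MV.orbs")
    case True
    then have "\<pi>V u \<in> orbit G \<alpha>' (\<pi>V x1)" using MV.\<pi>_orbs step by blast
    then show ?thesis by blast
  next
    case False
    then have "(\<pi>V u, \<pi>V v) \<in> arr'" using step arrow_persists MV.stabilizer_outside by blast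
    moreover obtain s where "s \<in> \<pi>V ` R \<union> orbit G \<alpha>' (\<pi>V x1)" "(\<pi>V v, s) \<in> arr'\<^sup>*"
      using step arrow_verts by blast
    ultimately show ?thesis by (meson converse_rtrancl_into_rtrancl)
  qed
qed

text \<open>In the second alternative \<open>z\<close> is the last merged vertex on the walk before
  \<open>R\<close>. Everything after \<open>(z, v)\<close> survives, so only this one arrow remains
  to be examined.\<close>

lemma last_merged:
  assumes "(u, r) \<in> arr\<^sup>*" "u \<in> V" "r \<in> R"
  shows "(\<exists>s\<in>\<pi>V ` R. (\<pi>V u, s) \<in> arr'\<^sup>*) \<or>
    (\<exists>z v. z \<in> MV.orbs \<and> (u, z) \<in> arr\<^sup>* \<and> (z, v) \<in> arr \<and> (\<exists>s\<in>\<pi>V ` R. (\<pi>V v, s) \<in> arr'\<^sup>*))"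
  using assms
proof (induction rule: converse_rtrancl_induct)
  case base
  then show ?case by blast
next
  case (step u v)
  then have v: "v \<in> V" using arrow_verts by blast
  from step.IH[OF v step.prems(2)] consider
    (A) "\<exists>s\<in>\<pi>V ` R. (\<pi>V v, s) \<in> arr'\<^sup>*" |
    (B) z w where "z \<in> MV.orbs" "(v, z) \<in> arr\<^sup>*" "(z, w) \<in> arr" "\<exists>s\<in>\<pi>V ` R. (\<pi>V w, s) \<in> arr'\<^sup>*"
    by blast
  then show ?case
  proof cases
    case A
    show ?thesis
    proof (cases "u \<in> MV.orbs")
      case True
      then show ?thesis using A step.hyps by blast
    next
      case False
      then have "(\<pi>V u, \<pi>V v) \<in> arr'" using step arrow_persists MV.stabilizer_outside by blast
      then show ?thesis using A by (meson converse_rtrancl_into_rtrancl)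
    qed
  next
    case B
    then show ?thesis using step.hyps by (meson converse_rtrancl_into_rtrancl)
  qed
qed

context
  fixes R assumes R: "absorbing G V \<alpha> E \<beta> i t R"
begin

lemma R_sub: "R \<subseteq> V" and R_act: "g \<in> carrier G \<Longrightarrow> r \<in> R \<Longrightarrow> \<alpha> g r \<in> R"
  and R_reach: "v \<in> V \<Longrightarrow> \<exists>r\<in>R. (v, r) \<in> arr\<^sup>*"
  using R by (auto simp: absorbing_def)

lemma image_R_act: "g \<in> carrier G \<Longrightarrow> s \<in> \<pi>V ` R \<Longrightarrow> \<alpha>' g s \<in> \<pi>V ` R"
proof -
  assume g: "g \<in> carrier G" and "s \<in> \<pi>V ` R"
  then obtain r where r: "r \<in> R" "s = \<pi>V r" by blast
  then have "\<alpha>' g s = \<pi>V (\<alpha> g r)" using MV.\<pi>_act[of g r] g R_sub by auto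
  then show ?thesis using R_act[OF g r(1)] by simp
qed

lemma absorbing_image_Un: "absorbing G (\<pi>V ` V) \<alpha>' E' \<beta>' i' t' (\<pi>V ` R \<union> orbit G \<alpha>' (\<pi>V x1))"
  unfolding absorbing_def
proof (intro conjI ballI)
  have x1: "\<pi>V x1 \<in> \<pi>V ` V" using MV.xy by simp
  show "\<pi>V ` R \<union> orbit G \<alpha>' (\<pi>V x1) \<subseteq> \<pi>V ` V"
    using R_sub MV.T.orbit_subset[OF x1] by blast
  fix g r assume "g \<in> carrier G" "r \<in> \<pi>V ` R \<union> orbit G \<alpha>' (\<pi>V x1)"
  then show "\<alpha>' g r \<in> \<pi>V ` R \<union> orbit G \<alpha>' (\<pi>V x1)"
    using image_R_act gset.act_closed[OF MV.T.gset_orbit[OF x1]] by blast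
next
  fix v assume "v \<in> \<pi>V ` V"
  then obtain u where u: "u \<in> V" "v = \<pi>V u" by blast
  then obtain r where "r \<in> R" "(u, r) \<in> arr\<^sup>*" using R_reach by blast
  then show "\<exists>s\<in>\<pi>V ` R \<union> orbit G \<alpha>' (\<pi>V x1). (v, s) \<in> arr'\<^sup>*"
    using reaches_or_merged u by blast
qed

lemma reach_act:
  assumes "g \<in> carrier G" "\<exists>s\<in>\<pi>V ` R. (u, s) \<in> arr'\<^sup>*"
  shows "\<exists>s\<in>\<pi>V ` R. (\<alpha>' g u, s) \<in> arr'\<^sup>*"
proof -
  obtain s where "s \<in> \<pi>V ` R" "(u, s) \<in> arr'\<^sup>*" using assms(2) by blast
  then show ?thesis using D'.arrows_act assms(1) image_R_act by blast
qed

text \<open>All of \<open>MV.orbs\<close> becomes one orbit, so a walk from any of its points can be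
  translated to start at \<open>\<pi>V x1\<close>.\<close>

lemma reach_orbit:
  assumes "z \<in> MV.orbs" "\<exists>s\<in>\<pi>V ` R. (\<pi>V z, s) \<in> arr'\<^sup>*"
  shows "\<exists>s\<in>\<pi>V ` R. (\<pi>V x1, s) \<in> arr'\<^sup>*"
proof -
  have z: "z \<in> V" using assms(1) V.orbit_subset MV.xy by blast
  then have "\<pi>V z \<in> orbit G \<alpha>' (\<pi>V x1)" using MV.\<pi>_orbs assms(1) by blast
  then have "\<pi>V x1 \<in> orbit G \<alpha>' (\<pi>V z)" using MV.T.orbit_sym[of "\<pi>V x1" "\<pi>V z"] MV.xy by blast
  then obtain g where "g \<in> carrier G" "\<pi>V x1 = \<alpha>' g (\<pi>V z)" using MV.T.in_orbit_iff by blast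
  then show ?thesis using reach_act[OF _ assms(2)] by metis
qed

lemma absorbing_image:
  assumes "\<exists>s\<in>\<pi>V ` R. (\<pi>V x1, s) \<in> arr'\<^sup>*"
  shows "absorbing G (\<pi>V ` V) \<alpha>' E' \<beta>' i' t' (\<pi>V ` R)"
  unfolding absorbing_def
proof (intro conjI ballI)
  show "\<pi>V ` R \<subseteq> \<pi>V ` V" using R_sub by blast
  fix g r assume "g \<in> carrier G" "r \<in> \<pi>V ` R"
  then show "\<alpha>' g r \<in> \<pi>V ` R" by (rule image_R_act)
next
  fix v assume "v \<in> \<pi>V ` V"
  then obtain s where s: "s \<in> \<pi>V ` R \<union> orbit G \<alpha>' (\<pi>V x1)" "(v, s) \<in> arr'\<^sup>*"
    using absorbing_image_Un unfolding absorbing_def by blast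
  show "\<exists>s\<in>\<pi>V ` R. (v, s) \<in> arr'\<^sup>*"
  proof (cases "s \<in> \<pi>V ` R")
    case False
    then obtain g where "g \<in> carrier G" "s = \<alpha>' g (\<pi>V x1)" using s MV.T.in_orbit_iff by blast
    then obtain s' where "s' \<in> \<pi>V ` R" "(s, s') \<in> arr'\<^sup>*" using reach_act[OF _ assms] by metis
    then show ?thesis using s by (meson rtrancl_trans)
  qed (use s in blast)
qed

lemma unbroken_reach:
  assumes "z \<in> MV.orbs" "(z, v) \<in> arr" "\<exists>s\<in>\<pi>V ` R. (\<pi>V v, s) \<in> arr'\<^sup>*"
    "stabilizer G \<alpha>' (\<pi>V z) = stabilizer G \<alpha> z"
  shows "\<exists>s\<in>\<pi>V ` R. (\<pi>V x1, s) \<in> arr'\<^sup>*"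
proof (rule reach_orbit[OF assms(1)])
  have "(\<pi>V z, \<pi>V v) \<in> arr'" using arrow_persists assms by blast
  then show "\<exists>s\<in>\<pi>V ` R. (\<pi>V z, s) \<in> arr'\<^sup>*"
    using assms(3) by (meson converse_rtrancl_into_rtrancl)
qed

lemma orbit_sum_image:
  assumes "finite (orbits G V \<alpha>)" "x1 \<notin> R" "x2 \<notin> R"
  shows "orbit_sum G (weight G \<alpha>') \<alpha>' (\<pi>V ` R) = orbit_sum G (weight G \<alpha>) \<alpha> R"
  using MV.orbit_sum_merge_outside[OF R_sub R_act assms(1) V.invariant_weight MV.weight_outside assms(2,3)] .

lemma orbit_sum_image_Un:
  assumes "finite (orbits G V \<alpha>)"
  shows "orbit_sum G (weight G \<alpha>') \<alpha>' (\<pi>V ` R \<union> orbit G \<alpha>' (\<pi>V x1)) +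
     (if x1 \<in> R then weight G \<alpha> x1 else 0) +
     (if x2 \<in> R \<and> x2 \<notin> orbit G \<alpha> x1 then weight G \<alpha> x2 else 0) =
   orbit_sum G (weight G \<alpha>) \<alpha> R + weight G \<alpha>' (\<pi>V x1)"
  using MV.orbit_sum_merge[OF R_sub R_act assms V.invariant_weight MV.weight_outside
      MV.T.invariant_weight] .

end

end

section \<open>Folding\<close>

text \<open>Only edges with a common initial vertex are folded. Edges with a common terminal vertex
  are reached by reversing the whole graph (\<open>swap_over\<close>).\<close>

locale fold = vmerge G V \<alpha> E \<beta> i t "t e1" "t e2" \<pi>V \<alpha>' "\<pi>E ` E" \<beta>' i' t' \<pi>E +
  ME: merge G E \<beta> e1 e2 \<pi>E \<beta>'
  for G (structure) and V :: "'v set" and \<alpha> :: "'g \<Rightarrow> 'v \<Rightarrow> 'v"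
    and E :: "'e set" and \<beta> :: "'g \<Rightarrow> 'e \<Rightarrow> 'e" and i t :: "'e \<Rightarrow> 'v"
    and e1 e2 :: 'e and \<pi>V :: "'v \<Rightarrow> 'v" and \<alpha>' :: "'g \<Rightarrow> 'v \<Rightarrow> 'v"
    and \<pi>E :: "'e \<Rightarrow> 'e" and \<beta>' :: "'g \<Rightarrow> 'e \<Rightarrow> 'e" and i' t' :: "'e \<Rightarrow> 'v" +
  assumes distinct_edges: "e1 \<noteq> e2" and common: "i e1 = i e2"
    and finite_stab: "\<forall>e\<in>E. finite (stabilizer G \<beta> e)"
    and finite_orbV: "finite (orbits G V \<alpha>)" and finite_orbE: "finite (orbits G E \<beta>)"
begin

abbreviation "x \<equiv> i e1"
abbreviation "x1 \<equiv> t e1"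
abbreviation "x2 \<equiv> t e2"
abbreviation "H1 \<equiv> stabilizer G \<beta> e1"
abbreviation "H2 \<equiv> stabilizer G \<beta> e2"
abbreviation "H' \<equiv> stabilizer G \<beta>' (\<pi>E e1)"
abbreviation "K1 \<equiv> stabilizer G \<alpha> (t e1)"
abbreviation "K2 \<equiv> stabilizer G \<alpha> (t e2)"
abbreviation "K' \<equiv> stabilizer G \<alpha>' (\<pi>V (t e1))"

lemmas e12 = ME.xy

lemma verts: "x \<in> V" "x1 \<in> V" "x2 \<in> V" "\<pi>V x1 \<in> \<pi>V ` V" "\<pi>E e1 \<in> \<pi>E ` E"
  using ends_closed e12 by auto

lemma subgroups: "subgroup H1 G" "subgroup H2 G" "subgroup H' G" "subgroup K1 G" "subgroup K2 G" "subgroup K' G"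
  "subgroup (stabilizer G \<alpha> x) G"
  using E.stabilizer_subgroup e12 V.stabilizer_subgroup verts D'.E.stabilizer_subgroup MV.T.stabilizer_subgroup
  by auto

lemma subs: "H1 \<subseteq> K1" "H2 \<subseteq> K2" "H1 \<subseteq> H'" "H2 \<subseteq> H'" "H' \<subseteq> K'" "H1 \<subseteq> stabilizer G \<alpha> x"
   "H2 \<subseteq> stabilizer G \<alpha> x" "K1 \<subseteq> K'" "K2 \<subseteq> K'"
  using stabilizer_ends[OF e12(1)] stabilizer_ends[OF e12(2)] stabilizer_\<pi>E[OF e12(1)]
    stabilizer_\<pi>E[OF e12(2)] ME.\<pi>_xy D'.stabilizer_ends(2)[OF verts(5)] \<pi>_ends(2)[OF e12(1)] common
    MV.stabilizer_mono[OF verts(2)] MV.stabilizer_mono[OF verts(3)] MV.\<pi>_xy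
  by auto

lemma finite_H: "finite H1" "finite H2"
  using finite_stab e12 by auto

lemma weights:
  "weight G \<alpha> x1 \<le> weight G \<beta> e1" "weight G \<alpha> x2 \<le> weight G \<beta> e2"
  "weight G \<beta>' (\<pi>E e1) \<le> weight G \<beta> e1" "weight G \<beta>' (\<pi>E e1) \<le> weight G \<beta> e2"
  unfolding weight_def
  using V.subgroup_weight_le(1)[OF subgroups(1,4) subs(1) finite_H(1)]
    V.subgroup_weight_le(1)[OF subgroups(2,5) subs(2) finite_H(2)]
    V.subgroup_weight_le(1)[OF subgroups(1,3) subs(3) finite_H(1)]
    V.subgroup_weight_le(1)[OF subgroups(2,3) subs(4) finite_H(2)]
  by simp_all

lemma weights_half:
  "H1 \<noteq> K1 \<Longrightarrow> weight G \<alpha> x1 \<le> weight G \<beta> e1 / 2" "H2 \<noteq> K2 \<Longrightarrow> weight G \<alpha> x2 \<le> weight G \<beta> e2 / 2"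
  "H1 \<noteq> H' \<Longrightarrow> weight G \<beta>' (\<pi>E e1) \<le> weight G \<beta> e1 / 2"
  "H2 \<noteq> H' \<Longrightarrow> weight G \<beta>' (\<pi>E e1) \<le> weight G \<beta> e2 / 2"
  unfolding weight_def
  using V.subgroup_weight_le(2)[OF subgroups(1,4) subs(1) finite_H(1)]
    V.subgroup_weight_le(2)[OF subgroups(2,5) subs(2) finite_H(2)]
    V.subgroup_weight_le(2)[OF subgroups(1,3) subs(3) finite_H(1)]
    V.subgroup_weight_le(2)[OF subgroups(2,3) subs(4) finite_H(2)]
  by simp_all

lemma sum_E: "orbit_sum G (weight G \<beta>') \<beta>' (\<pi>E ` E) + weight G \<beta> e1 +
    (if e2 \<notin> orbit G \<beta> e1 then weight G \<beta> e2 else 0) =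
    orbit_sum G (weight G \<beta>) \<beta> E + weight G \<beta>' (\<pi>E e1)"
  using ME.orbit_sum_merge_all[OF finite_orbE E.invariant_weight ME.weight_outside D'.E.invariant_weight] .

lemma sum_V: "orbit_sum G (weight G \<alpha>') \<alpha>' (\<pi>V ` V) + weight G \<alpha> x1 +
    (if x2 \<notin> orbit G \<alpha> x1 then weight G \<alpha> x2 else 0) =
    orbit_sum G (weight G \<alpha>) \<alpha> V + weight G \<alpha>' (\<pi>V x1)"
  using MV.orbit_sum_merge_all[OF finite_orbV V.invariant_weight MV.weight_outside MV.T.invariant_weight] .

lemma same_orbit: "e2 \<in> orbit G \<beta> e1 \<Longrightarrow> x2 \<in> orbit G \<alpha> x1"
  using ends_act(2) e12 by (auto simp: orbit_def)

lemma card_K_orbit: "z \<in> orbit G \<alpha> x1 \<Longrightarrow> card (stabilizer G \<alpha> z) = card K1"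
  "z \<in> orbit G \<alpha> x2 \<Longrightarrow> card (stabilizer G \<alpha> z) = card K2"
  using V.card_stabilizer_orbit verts by auto

lemma unbroken:
  "K' = K1 \<Longrightarrow> z \<in> orbit G \<alpha> x1 \<Longrightarrow> stabilizer G \<alpha>' (\<pi>V z) = stabilizer G \<alpha> z"
  "K' = K2 \<Longrightarrow> z \<in> orbit G \<alpha> x2 \<Longrightarrow> stabilizer G \<alpha>' (\<pi>V z) = stabilizer G \<alpha> z"
proof -
  have *: "stabilizer G \<alpha>' (\<pi>V (\<alpha> g y)) = stabilizer G \<alpha> (\<alpha> g y)"
    if "g \<in> carrier G" "y \<in> V" "stabilizer G \<alpha>' (\<pi>V y) = stabilizer G \<alpha> y" for g y
    using that MV.\<pi>_act[of g y] MV.T.stabilizer_act[of "\<pi>V y" g] V.stabilizer_act[of y g] by simp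
  show "K' = K1 \<Longrightarrow> z \<in> orbit G \<alpha> x1 \<Longrightarrow> stabilizer G \<alpha>' (\<pi>V z) = stabilizer G \<alpha> z"
    using * verts by (auto simp: V.in_orbit_iff)
  show "K' = K2 \<Longrightarrow> z \<in> orbit G \<alpha> x2 \<Longrightarrow> stabilizer G \<alpha>' (\<pi>V z) = stabilizer G \<alpha> z"
    using * verts MV.\<pi>_xy by (auto simp: V.in_orbit_iff)
qed

lemma arrow_to_x:
  assumes "K' \<subseteq> H'" shows "(\<pi>V x1, \<pi>V x) \<in> arr'"
proof -
  have "H' = K'" using assms subs by blast
  then show ?thesis
    unfolding arrows_def using \<pi>_ends[OF e12(1)] verts(5) by blast
qed

lemma K'_least:
  assumes "subgroup H G" "K1 \<subseteq> H" "K2 \<subseteq> H" "\<And>h. h \<in> carrier G \<Longrightarrow> \<alpha> h x1 = x2 \<Longrightarrow> h \<in> H"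
  shows "K' \<subseteq> H"
  unfolding MV.stabilizer_glued by (rule V.glue_least[OF assms])

section \<open>When the merged vertex still reaches the old absorbing set\<close>

context
  fixes R assumes R: "absorbing G V \<alpha> E \<beta> i t R" and notin: "x1 \<notin> R" "x2 \<notin> R"
begin

text \<open>As \<open>K' \<subseteq> H'\<close>, the folded edge is an arrow from the merged vertex
  back to \<open>x\<close>, and a walk from \<open>x\<close> to \<open>R\<close> can be followed.
  The assumption \<open>kept\<close> treats the case that this walk returns to a merged vertex; such
  a vertex has a stabilizer that is finite and contains that of \<open>x\<close>.\<close>

lemma via_x:
  assumes K: "H1 = K1" "H2 = K2" "K' \<subseteq> H'"
    and kept: "\<And>z. z \<in> MV.orbs \<Longrightarrow> stabilizer G \<alpha> x \<subseteq> stabilizer G \<alpha> z \<Longrightarrow> finite (stabilizer G \<alpha> z) \<Longrightarrow>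
       stabilizer G \<alpha>' (\<pi>V z) = stabilizer G \<alpha> z"
  shows "\<exists>s\<in>\<pi>V ` R. (\<pi>V x1, s) \<in> arr'\<^sup>*"
proof -
  obtain r where r: "r \<in> R" "(x, r) \<in> arr\<^sup>*" using R_reach[OF R verts(1)] by blast
  from last_merged[OF r(2) verts(1) r(1)] show ?thesis
  proof (elim disjE exE conjE)
    assume "\<exists>s\<in>\<pi>V ` R. (\<pi>V x, s) \<in> arr'\<^sup>*"
    then show ?thesis using arrow_to_x[OF K(3)] by (meson converse_rtrancl_into_rtrancl)
  next
    fix z v assume z: "z \<in> MV.orbs" "(x, z) \<in> arr\<^sup>*" "(z, v) \<in> arr" "\<exists>s\<in>\<pi>V ` R. (\<pi>V v, s) \<in> arr'\<^sup>*"
    have "stabilizer G \<alpha>' (\<pi>V z) = stabilizer G \<alpha> z"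
      by (rule kept[OF z(1) arrows_stabilizer[OF z(2)] arrow_finite[OF z(3) finite_stab]])
    then show ?thesis by (rule unbroken_reach[OF R z(1,3,4)])
  qed
qed

text \<open>The edge \<open>a\<close> compresses \<open>t a\<close>, while \<open>b\<close> does not
  compress \<open>t b\<close>. Since \<open>H'\<close> is the stabilizer of \<open>b\<close>, it
  contains that of \<open>a\<close>, so \<open>?Ka\<close> lies properly in \<open>?Kb\<close> and
  merging adds nothing to \<open>?Kb\<close>. Stabilizers only grow along a walk of arrows from
  \<open>t b\<close>, hence the walk cannot leave a vertex in the orbit of \<open>t a\<close>, whose
  stabilizer is too small; in the orbit of \<open>t b\<close> arrows survive.\<close>

lemma absorb_collapse:
  assumes ab: "a = e1 \<and> b = e2 \<or> a = e2 \<and> b = e1"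
    and H: "stabilizer G \<beta> b \<noteq> stabilizer G \<alpha> (t b)" "stabilizer G \<beta> a = stabilizer G \<alpha> (t a)"
      "H' = stabilizer G \<beta> b"
    and x12: "x2 \<notin> orbit G \<alpha> x1"
  shows "K' = stabilizer G \<alpha> (t b)" "\<exists>s\<in>\<pi>V ` R. (\<pi>V x1, s) \<in> arr'\<^sup>*"
proof -
  let ?Ka = "stabilizer G \<alpha> (t a)" and ?Kb = "stabilizer G \<alpha> (t b)"
  have no: "\<alpha> h x1 \<noteq> x2" if "h \<in> carrier G" for h using x12 that by (auto simp: V.in_orbit_iff)
  have b: "t b \<in> V" "subgroup ?Kb G" "\<pi>V (t b) = \<pi>V x1"
    using ab verts subgroups MV.\<pi>_xy by auto
  have S: "stabilizer G \<beta> b \<subset> ?Kb" "?Ka \<subseteq> stabilizer G \<beta> b" using ab H subs by auto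
  have "K' \<subseteq> ?Kb"
    by (rule K'_least[OF b(2)]) (use ab S no in auto)
  then show K: "K' = ?Kb" using ab subs by auto
  have orbs: "z \<in> orbit G \<alpha> (t a) \<or> z \<in> orbit G \<alpha> (t b)" if "z \<in> MV.orbs" for z
    using that ab by auto
  obtain r where r: "r \<in> R" "(t b, r) \<in> arr\<^sup>*" using R_reach[OF R b(1)] by blast
  from last_merged[OF r(2) b(1) r(1)] show "\<exists>s\<in>\<pi>V ` R. (\<pi>V x1, s) \<in> arr'\<^sup>*"
  proof (elim disjE exE conjE)
    assume "\<exists>s\<in>\<pi>V ` R. (\<pi>V (t b), s) \<in> arr'\<^sup>*"
    then show ?thesis using b(3) by simp
  next
    fix z v assume z: "z \<in> MV.orbs" "(t b, z) \<in> arr\<^sup>*" "(z, v) \<in> arr" "\<exists>s\<in>\<pi>V ` R. (\<pi>V v, s) \<in> arr'\<^sup>*"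
    have fz: "finite (stabilizer G \<alpha> z)" by (rule arrow_finite[OF z(3) finite_stab])
    have Kbz: "?Kb \<subseteq> stabilizer G \<alpha> z" by (rule arrows_stabilizer[OF z(2)])
    have zb: "z \<in> orbit G \<alpha> (t b)"
    proof (rule ccontr)
      assume "z \<notin> orbit G \<alpha> (t b)"
      then have "card (stabilizer G \<alpha> z) = card ?Ka" using orbs[OF z(1)] card_K_orbit ab by auto
      then have "card ?Kb \<le> card ?Ka" using card_mono[OF fz Kbz] by simp
      moreover have "?Ka \<subset> ?Kb" using S by blast
      then have "card ?Ka < card ?Kb" using psubset_card_mono finite_subset[OF Kbz fz] by blast
      ultimately show False by simp
    qed
    have "stabilizer G \<alpha>' (\<pi>V z) = stabilizer G \<alpha> z"
      using ab zb K unbroken[of z] by (elim disjE conjE) simp_all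
    then show ?thesis by (rule unbroken_reach[OF R z(1,3,4)])
  qed
qed

text \<open>Suppose the walk from \<open>x\<close> returns to, say, the orbit of \<open>x1\<close>.
  Its stabilizers have the order of \<open>K1 = H1\<close> and would have to accommodate that of
  \<open>x\<close>, which contains \<open>H1\<close>. So \<open>H1\<close> is the whole stabilizer
  of \<open>x\<close> and contains \<open>H2 = K2\<close>. Then merging does not enlarge
  \<open>K1\<close>, and the arrow leaving that vertex survives.\<close>

lemma absorb_both:
  assumes "H1 = K1" "H2 = K2" "x2 \<notin> orbit G \<alpha> x1"
  shows "K' = H'" "\<exists>s\<in>\<pi>V ` R. (\<pi>V x1, s) \<in> arr'\<^sup>*"
proof -
  have no: "\<alpha> h x1 \<noteq> x2" if "h \<in> carrier G" for h using assms(3) that by (auto simp: V.in_orbit_iff)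
  have K: "K' \<subseteq> H'"
    by (rule K'_least[OF subgroups(3)]) (use assms(1,2) subs no in auto)
  then show "K' = H'" using subs by blast
  show "\<exists>s\<in>\<pi>V ` R. (\<pi>V x1, s) \<in> arr'\<^sup>*"
  proof (rule via_x[OF assms(1,2) K])
    fix z assume z: "z \<in> MV.orbs" "stabilizer G \<alpha> x \<subseteq> stabilizer G \<alpha> z" "finite (stabilizer G \<alpha> z)"
    have le: "card (stabilizer G \<alpha> x) \<le> card (stabilizer G \<alpha> z)" using card_mono[OF z(3,2)] .
    have fx: "finite (stabilizer G \<alpha> x)" using finite_subset[OF z(2,3)] .
    show "stabilizer G \<alpha>' (\<pi>V z) = stabilizer G \<alpha> z"
    proof (cases "z \<in> orbit G \<alpha> x1")
      case True
      then have "H1 = stabilizer G \<alpha> x" using card_seteq[OF fx subs(6)] le card_K_orbit(1) assms(1) by simp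
      then have "K' \<subseteq> K1"
        by (intro K'_least[OF subgroups(4)]) (use assms(1,2) subs no in auto)
      then show ?thesis using unbroken(1)[OF _ True] subs by blast
    next
      case False
      then have z2: "z \<in> orbit G \<alpha> x2" using z by blast
      then have "H2 = stabilizer G \<alpha> x" using card_seteq[OF fx subs(7)] le card_K_orbit(2) assms(2) by simp
      then have "K' \<subseteq> K2"
        by (intro K'_least[OF subgroups(5)]) (use assms(1,2) subs no in auto)
      then show ?thesis using unbroken(2)[OF _ z2] subs by blast
    qed
  qed
qed

text \<open>An element \<open>g\<close> carrying \<open>e1\<close> to \<open>e2\<close> fixes
  \<open>x\<close>, and fixes the folded edge. A return of the walk from \<open>x\<close> to the
  merged orbit would make \<open>H1\<close> the whole stabilizer of \<open>x\<close>, so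
  \<open>g\<close> would fix \<open>e1\<close>, against \<open>e1 \<noteq> e2\<close>.\<close>

lemma absorb_same_orbit:
  assumes "H1 = K1" "e2 \<in> orbit G \<beta> e1"
  shows "K' = H'" "\<exists>s\<in>\<pi>V ` R. (\<pi>V x1, s) \<in> arr'\<^sup>*"
proof -
  obtain g where g: "g \<in> carrier G" "e2 = \<beta> g e1" using assms(2) by (auto simp: E.in_orbit_iff)
  have x2: "x2 = \<alpha> g x1" using g ends_act e12 by simp
  have gH': "g \<in> H'" using g ME.\<pi>_act[OF g(1) e12(1)] ME.\<pi>_xy by (simp add: in_stabilizer_iff)
  have H2: "H2 = K2"
    using assms(1) g x2 E.stabilizer_act[OF e12(1) g(1)] V.stabilizer_act[OF verts(2) g(1)] by simp
  have gx: "g \<in> stabilizer G \<alpha> x"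
    using g ends_act(1)[OF g(1) e12(1)] common by (simp add: in_stabilizer_iff)
  have K: "K' \<subseteq> H'"
  proof (rule K'_least[OF subgroups(3)])
    show "K1 \<subseteq> H'" "K2 \<subseteq> H'" using assms(1) H2 subs by auto
    fix h assume h: "h \<in> carrier G" "\<alpha> h x1 = x2"
    then have "\<alpha> (inv g \<otimes> h) x1 = x1" using V.act_eq_move[of h g x1 x1] g x2 verts by simp
    then have "inv g \<otimes> h \<in> K1" using g(1) h(1) by (simp add: in_stabilizer_iff)
    then have "inv g \<otimes> h \<in> H'" using assms(1) subs(3) by blast
    then have "g \<otimes> (inv g \<otimes> h) \<in> H'" using subgroup.m_closed[OF subgroups(3) gH'] by blast
    then show "h \<in> H'" using g h by (simp add: V.m_assoc[symmetric])
  qed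
  then show "K' = H'" using subs by blast
  show "\<exists>s\<in>\<pi>V ` R. (\<pi>V x1, s) \<in> arr'\<^sup>*"
  proof (rule via_x[OF assms(1) H2 K])
    fix z assume z: "z \<in> MV.orbs" "stabilizer G \<alpha> x \<subseteq> stabilizer G \<alpha> z" "finite (stabilizer G \<alpha> z)"
    have "z \<in> orbit G \<alpha> x1"
      using z(1) V.orbit_eq[OF verts(2), of x2] same_orbit[OF assms(2)] by blast
    then have "card (stabilizer G \<alpha> x) \<le> card H1"
      using card_mono[OF z(3,2)] card_K_orbit(1) assms(1) by simp
    then have "H1 = stabilizer G \<alpha> x"
      using card_seteq[OF finite_subset[OF z(2,3)] subs(6)] by blast
    with gx have "g \<in> H1" by blast
    then have "e2 = e1" using g by (simp add: in_stabilizer_iff)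
    with distinct_edges show "stabilizer G \<alpha>' (\<pi>V z) = stabilizer G \<alpha> z" by simp
  qed
qed

end

lemma absorbing_fold:
  assumes R: "absorbing G V \<alpha> E \<beta> i t R"
  obtains R' where "absorbing G (\<pi>V ` V) \<alpha>' (\<pi>E ` E) \<beta>' i' t' R'"
    "cost G (\<pi>V ` V) \<alpha>' (\<pi>E ` E) \<beta>' R' \<le> cost G V \<alpha> E \<beta> R"
proof -
  note result = that
  note nn = weight_nonneg
  let ?w1 = "weight G \<alpha> x1" and ?w2 = "weight G \<alpha> x2" and ?w' = "weight G \<alpha>' (\<pi>V x1)"
  let ?h1 = "weight G \<beta> e1" and ?h2 = "weight G \<beta> e2" and ?h' = "weight G \<beta>' (\<pi>E e1)"
  let ?U = "\<pi>V ` R \<union> orbit G \<alpha>' (\<pi>V x1)"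
  note sR = orbit_sum_image_Un[OF R finite_orbV]
  \<comment> \<open>The weight \<open>?w'\<close> is added both to the vertices and to the absorbing
    set and cancels. What has to be paid are the weights of \<open>x1\<close> and \<open>x2\<close>
    as far as these are not in \<open>R\<close>; what pays is the decrease of the edge sum.\<close>
  have U: thesis if "cost G (\<pi>V ` V) \<alpha>' (\<pi>E ` E) \<beta>' ?U \<le> cost G V \<alpha> E \<beta> R"
    by (rule result[OF absorbing_image_Un[OF R] that])
  \<comment> \<open>Without the merged orbit in the absorbing set, the new vertex weight
    \<open>?w'\<close> is a gain.\<close>
  have I: thesis if "x1 \<notin> R" "x2 \<notin> R" "\<exists>s\<in>\<pi>V ` R. (\<pi>V x1, s) \<in> arr'\<^sup>*"
    "?h' - ?h1 - (if e2 \<notin> orbit G \<beta> e1 then ?h2 else 0) + ?w1 + (if x2 \<notin> orbit G \<alpha> x1 then ?w2 else 0) - ?w' \<le> 0"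
  proof (rule result[OF absorbing_image[OF R that(3)]])
    show "cost G (\<pi>V ` V) \<alpha>' (\<pi>E ` E) \<beta>' (\<pi>V ` R) \<le> cost G V \<alpha> E \<beta> R"
      using sum_E sum_V orbit_sum_image[OF R finite_orbV that(1,2)] that(4) unfolding cost_def by linarith
  qed
  have inR: "x1 \<in> R \<longleftrightarrow> x2 \<in> R" if "x2 \<in> orbit G \<alpha> x1"
    using MV.in_R_iff[OF R_sub[OF R] R_act[OF R] finite_orbV verts(2) that] by simp
  have distE: "e2 \<notin> orbit G \<beta> e1" if "x2 \<notin> orbit G \<alpha> x1" using that same_orbit by blast
  consider (C) "e2 \<in> orbit G \<beta> e1" | (B) "e2 \<notin> orbit G \<beta> e1" "x2 \<in> orbit G \<alpha> x1" | (A) "x2 \<notin> orbit G \<alpha> x1"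
    by blast
  then show thesis
  proof cases
    case B
    \<comment> \<open>Two edge orbits are merged but only one vertex orbit is involved:
      \<open>?h' \<le> ?h2\<close> and \<open>?w1 \<le> ?h1\<close> suffice.\<close>
    show ?thesis
      by (rule U) (use B sR sum_E sum_V weights nn[of G \<alpha> x1] in \<open>simp add: cost_def split: if_splits\<close>)
  next
    case C
    then have C': "x2 \<in> orbit G \<alpha> x1" by (rule same_orbit)
    show ?thesis
    proof (cases "x1 \<in> R")
      case True
      show ?thesis
        by (rule U) (use True C C' sR sum_E sum_V weights in \<open>simp add: cost_def\<close>)
    next
      case False
      then have notin: "x1 \<notin> R" "x2 \<notin> R" using inR[OF C'] by auto
      show ?thesis
      proof (cases "H1 = K1")
        case True
        have w: "?w1 = ?h1" "?w' = ?h'" using True absorb_same_orbit(1)[OF R notin True C] by (simp_all add: weight_def)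
        show ?thesis
          by (rule I[OF notin absorb_same_orbit(2)[OF R notin True C]]) (use C C' w in simp)
      next
        case F: False
        \<comment> \<open>Both \<open>H1 \<subset> K1\<close> and \<open>H1 \<subset> H'\<close> are
          proper, so \<open>?w1\<close> and \<open>?h'\<close> are each at most half of
          \<open>?h1\<close>.\<close>
        obtain g where g: "g \<in> carrier G" "e2 = \<beta> g e1" using C by (auto simp: E.in_orbit_iff)
        then have "g \<in> H'" "g \<notin> H1"
          using ME.\<pi>_act[OF g(1) e12(1)] ME.\<pi>_xy distinct_edges by (auto simp: in_stabilizer_iff)
        then have "H1 \<noteq> H'" by blast
        then show ?thesis
          using U C C' False sR sum_E sum_V weights_half(1)[OF F] weights_half(3) by (simp add: cost_def)
      qed
    qed
  next
    case A
    note A' = distE[OF A]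
    show ?thesis
    proof (cases "x1 \<in> R \<or> x2 \<in> R")
      case True
      show ?thesis
        by (rule U) (use True A A' sR sum_E sum_V weights nn[of G \<alpha> x1] nn[of G \<alpha> x2] nn[of G \<beta> e1] nn[of G \<beta> e2]
            in \<open>auto simp: cost_def split: if_splits\<close>)
    next
      case False
      then have notin: "x1 \<notin> R" "x2 \<notin> R" by auto
      have tot: ?thesis if "?h' - ?h1 - ?h2 + ?w1 + ?w2 \<le> 0"
        by (rule U) (use that False A A' sR sum_E sum_V in \<open>simp add: cost_def\<close>)
      \<comment> \<open>Cases 1, 4 and 6 contain two proper inclusions, and the halved weights give
        \<open>tot\<close>. In cases 2, 3 and 5 the group \<open>K'\<close> is known exactly, and
        \<open>I\<close> breaks even.\<close>
      consider "H1 \<noteq> K1" "H2 \<noteq> K2" | "H1 = K1" "H2 = K2" | "H1 = K1" "H2 \<noteq> K2" "H' = H2"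
        | "H1 = K1" "H2 \<noteq> K2" "H2 \<noteq> H'" | "H2 = K2" "H1 \<noteq> K1" "H' = H1" | "H2 = K2" "H1 \<noteq> K1" "H1 \<noteq> H'"
        by blast
      then show ?thesis
      proof cases
        case 1
        show ?thesis by (rule tot) (use weights weights_half(1)[OF 1(1)] weights_half(2)[OF 1(2)] in simp)
      next
        case 2
        have w: "?w1 = ?h1" "?w2 = ?h2" "?w' = ?h'" using 2 absorb_both(1)[OF R notin 2 A] by (simp_all add: weight_def)
        show ?thesis by (rule I[OF notin absorb_both(2)[OF R notin 2 A]]) (use A A' w in simp)
      next
        case 3
        note c = absorb_collapse[OF R notin disjI1[OF conjI[OF refl refl]] 3(2,1,3) A]
        have w: "?w1 = ?h1" "?w' = ?w2" "?h' = ?h2" using 3 c(1) by (simp_all add: weight_def)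
        show ?thesis by (rule I[OF notin c(2)]) (use A A' w in simp)
      next
        case 4
        have "?w1 = ?h1" using 4 by (simp add: weight_def)
        then show ?thesis using tot weights_half(2)[OF 4(2)] weights_half(4)[OF 4(3)] by simp
      next
        case 5
        note c = absorb_collapse[OF R notin disjI2[OF conjI[OF refl refl]] 5(2,1,3) A]
        have w: "?w2 = ?h2" "?w' = ?w1" "?h' = ?h1" using 5 c(1) by (simp_all add: weight_def)
        show ?thesis by (rule I[OF notin c(2)]) (use A A' w in simp)
      next
        case 6
        have "?w2 = ?h2" using 6 by (simp add: weight_def)
        then show ?thesis using tot weights_half(1)[OF 6(2)] weights_half(3)[OF 6(3)] by simp
      qed
    qed
  qed
qed

end

section \<open>Folding a cover onto the tree\<close>

lemma has_no_cycle_swap: "has_no_cycle E t i \<longleftrightarrow> has_no_cycle E i t"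
proof -
  have "is_walk E t i = is_walk E i t" unfolding is_walk_def fun_eq_iff by metis
  then show ?thesis by (simp add: has_no_cycle_def is_cycle_def)
qed

text \<open>Surjectivity is demanded for vertices only. For edges it follows at the end, because
  every edge of a tree is a bridge.\<close>

locale over_graph = ggraph G V \<alpha> E \<beta> i t + S: ggraph G VS \<alpha>S ES \<beta>S \<iota> \<tau>
  for G (structure) and V :: "'v set" and \<alpha> :: "'g \<Rightarrow> 'v \<Rightarrow> 'v"
    and E :: "'e set" and \<beta> :: "'g \<Rightarrow> 'e \<Rightarrow> 'e" and i t :: "'e \<Rightarrow> 'v"
    and VS :: "'p set" and \<alpha>S :: "'g \<Rightarrow> 'p \<Rightarrow> 'p"
    and ES :: "'q set" and \<beta>S :: "'g \<Rightarrow> 'q \<Rightarrow> 'q" and \<iota> \<tau> :: "'q \<Rightarrow> 'p" +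
  fixes fV :: "'v \<Rightarrow> 'p" and fE :: "'e \<Rightarrow> 'q"
  assumes fV_image: "fV ` V = VS" and fE_in: "e \<in> E \<Longrightarrow> fE e \<in> ES"
    and fV_equivariant: "equivariant G V \<alpha> \<alpha>S fV" and fE_equivariant: "equivariant G E \<beta> \<beta>S fE"
    and f_ends: "e \<in> E \<Longrightarrow> \<iota> (fE e) = fV (i e)" "e \<in> E \<Longrightarrow> \<tau> (fE e) = fV (t e)"
    and fin_V: "finite (orbits G V \<alpha>)" and fin_E: "finite (orbits G E \<beta>)"
    and fin_stab: "q \<in> ES \<Longrightarrow> finite (stabilizer G \<beta>S q)"
begin

lemma fV_in: "v \<in> V \<Longrightarrow> fV v \<in> VS"
  using fV_image by blast

lemma fE_act: "g \<in> carrier G \<Longrightarrow> e \<in> E \<Longrightarrow> fE (\<beta> g e) = \<beta>S g (fE e)"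
  using fE_equivariant by (simp add: equivariant_def)

lemma fV_act: "g \<in> carrier G \<Longrightarrow> v \<in> V \<Longrightarrow> fV (\<alpha> g v) = \<alpha>S g (fV v)"
  using fV_equivariant by (simp add: equivariant_def)

lemma stabilizer_fE: "e \<in> E \<Longrightarrow> stabilizer G \<beta> e \<subseteq> stabilizer G \<beta>S (fE e)"
proof
  fix g assume "e \<in> E" "g \<in> stabilizer G \<beta> e"
  then show "g \<in> stabilizer G \<beta>S (fE e)" using fE_act[of g e] by (simp add: in_stabilizer_iff)
qed

lemma finite_stab_E: "e \<in> E \<Longrightarrow> finite (stabilizer G \<beta> e)"
  using finite_subset[OF stabilizer_fE fin_stab[OF fE_in]] .

text \<open>The factor 2 makes the orbit sum decrease also when a fold merges two edge orbits.\<close>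

definition defect :: "'e \<Rightarrow> nat" where
  "defect e = 2 * card (stabilizer G \<beta>S (fE e)) - card (stabilizer G \<beta> e)"

lemma defect_invariant: "E.invariant_fun defect"
  unfolding E.invariant_fun_def defect_def
  by (simp add: fE_act S.E.card_stabilizer_act E.card_stabilizer_act fE_in)

end

locale over_tree = over_graph G V \<alpha> E \<beta> i t VS \<alpha>S ES \<beta>S \<iota> \<tau> fV fE
  for G (structure) and V :: "'v set" and \<alpha> :: "'g \<Rightarrow> 'v \<Rightarrow> 'v"
    and E :: "'e set" and \<beta> :: "'g \<Rightarrow> 'e \<Rightarrow> 'e" and i t :: "'e \<Rightarrow> 'v"
    and VS :: "'p set" and \<alpha>S :: "'g \<Rightarrow> 'p \<Rightarrow> 'p"
    and ES :: "'q set" and \<beta>S :: "'g \<Rightarrow> 'q \<Rightarrow> 'q" and \<iota> \<tau> :: "'q \<Rightarrow> 'p"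
    and fV :: "'v \<Rightarrow> 'p" and fE :: "'e \<Rightarrow> 'q" +
  assumes connected: "u \<in> V \<Longrightarrow> v \<in> V \<Longrightarrow> (u, v) \<in> (adj E i t)\<^sup>*"
    and acyclic: "has_no_cycle ES \<iota> \<tau>"
begin

lemma swap_over: "over_tree G V \<alpha> E \<beta> t i VS \<alpha>S ES \<beta>S \<tau> \<iota> fV fE"
proof -
  interpret D': ggraph G V \<alpha> E \<beta> t i by (rule swap)
  interpret S': ggraph G VS \<alpha>S ES \<beta>S \<tau> \<iota> by (rule S.swap)
  show ?thesis
    by unfold_locales (use fV_image fE_in fV_equivariant fE_equivariant f_ends fin_V fin_E fin_stab
        connected acyclic in \<open>simp_all add: adj_swap[of E i t] has_no_cycle_swap[of ES \<iota> \<tau>]\<close>)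
qed

lemma fold_exists:
  assumes e: "e1 \<in> E" "e2 \<in> E" "e1 \<noteq> e2" and common: "i e1 = i e2" and fe: "fE e1 = fE e2"
    and R: "absorbing G V \<alpha> E \<beta> i t R"
  shows "\<exists>(V' :: 'v set) \<alpha>' (E' :: 'e set) \<beta>' i' t' fV' fE' R'. over_tree G V' \<alpha>' E' \<beta>' i' t' VS \<alpha>S ES \<beta>S \<iota> \<tau> fV' fE' \<and>
     absorbing G V' \<alpha>' E' \<beta>' i' t' R' \<and> cost G V' \<alpha>' E' \<beta>' R' \<le> cost G V \<alpha> E \<beta> R \<and>
     orbit_sum G (over_graph.defect G \<beta>' \<beta>S fE') \<beta>' E' < orbit_sum G defect \<beta> E"
proof -
  obtain \<pi>V \<alpha>' where "merge G V \<alpha> (t e1) (t e2) \<pi>V \<alpha>'"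
    using V.merge_exists[OF ends_closed(2)[OF e(1)] ends_closed(2)[OF e(2)]] .
  then interpret MV: merge G V \<alpha> "t e1" "t e2" \<pi>V \<alpha>' .
  obtain \<pi>E \<beta>' where "merge G E \<beta> e1 e2 \<pi>E \<beta>'"
    using E.merge_exists[OF e(1,2)] .
  then interpret ME: merge G E \<beta> e1 e2 \<pi>E \<beta>' .
  \<comment> \<open>The preimage picked by \<open>inv_into\<close> is arbitrary;
    \<open>factors\<close> shows below that the values do not depend on it.\<close>
  define i' where "i' e' = \<pi>V (i (inv_into E \<pi>E e'))" for e'
  define t' where "t' e' = \<pi>V (t (inv_into E \<pi>E e'))" for e'
  define fE' where "fE' e' = fE (inv_into E \<pi>E e')" for e'
  define fV' where "fV' v' = fV (inv_into V \<pi>V v')" for v'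
  have inE: "inv_into E \<pi>E (\<pi>E a) \<in> E" "\<pi>E (inv_into E \<pi>E (\<pi>E a)) = \<pi>E a" if "a \<in> E" for a
    using that by (auto intro: inv_into_into f_inv_into_f)
  have inV: "inv_into V \<pi>V (\<pi>V a) \<in> V" "\<pi>V (inv_into V \<pi>V (\<pi>V a)) = \<pi>V a" if "a \<in> V" for a
    using that by (auto intro: inv_into_into f_inv_into_f)
  have i': "i' (\<pi>E a) = \<pi>V (i a)" if "a \<in> E" for a
    unfolding i'_def
  proof (rule ME.factors[where f = "\<lambda>e. \<pi>V (i e)" and \<beta> = \<alpha>', OF MV.target])
    show "(\<lambda>e. \<pi>V (i e)) ` E \<subseteq> \<pi>V ` V" using ends_closed by blast
    show "equivariant G E \<beta> \<alpha>' (\<lambda>e. \<pi>V (i e))"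
      by (simp add: equivariant_def ends_act MV.\<pi>_act ends_closed)
  qed (use that inE common in simp_all)
  have t': "t' (\<pi>E a) = \<pi>V (t a)" if "a \<in> E" for a
    unfolding t'_def
  proof (rule ME.factors[where f = "\<lambda>e. \<pi>V (t e)" and \<beta> = \<alpha>', OF MV.target])
    show "(\<lambda>e. \<pi>V (t e)) ` E \<subseteq> \<pi>V ` V" using ends_closed by blast
    show "equivariant G E \<beta> \<alpha>' (\<lambda>e. \<pi>V (t e))"
      by (simp add: equivariant_def ends_act MV.\<pi>_act ends_closed)
  qed (use that inE MV.\<pi>_xy in simp_all)
  have fE': "fE' (\<pi>E a) = fE a" if "a \<in> E" for a
    unfolding fE'_def
    by (rule ME.factors[where f = fE and \<beta> = \<beta>S, OF S.E.gset_axioms])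
       (use that inE fe fE_in fE_equivariant in auto)
  have ft: "fV (t e1) = fV (t e2)" using f_ends(2) e fe by metis
  have fV': "fV' (\<pi>V a) = fV a" if "a \<in> V" for a
    unfolding fV'_def
    by (rule MV.factors[where f = fV and \<beta> = \<alpha>S, OF S.V.gset_axioms])
       (use that inV ft fV_in fV_equivariant in auto)
  interpret D': ggraph G "\<pi>V ` V" \<alpha>' "\<pi>E ` E" \<beta>' i' t'
  proof (intro ggraph.intro ggraph_axioms.intro MV.target ME.target; clarify?)
    fix a assume a: "a \<in> E"
    show "i' (\<pi>E a) \<in> \<pi>V ` V" "t' (\<pi>E a) \<in> \<pi>V ` V" using a i' t' ends_closed by auto
    fix g assume g: "g \<in> carrier G"
    have *: "\<beta>' g (\<pi>E a) = \<pi>E (\<beta> g a)" "\<beta> g a \<in> E" using g a ME.\<pi>_act E.act_closed by auto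
    show "i' (\<beta>' g (\<pi>E a)) = \<alpha>' g (i' (\<pi>E a))"
      using g a * by (simp add: i' ends_act ends_closed MV.\<pi>_act)
    show "t' (\<beta>' g (\<pi>E a)) = \<alpha>' g (t' (\<pi>E a))"
      using g a * by (simp add: t' ends_act ends_closed MV.\<pi>_act)
  qed
  interpret vmerge G V \<alpha> E \<beta> i t "t e1" "t e2" \<pi>V \<alpha>' "\<pi>E ` E" \<beta>' i' t' \<pi>E
    by unfold_locales (use i' t' ME.equivariant in simp_all)
  interpret fold G V \<alpha> E \<beta> i t e1 e2 \<pi>V \<alpha>' \<pi>E \<beta>' i' t'
    by unfold_locales (use e common finite_stab_E fin_V fin_E in simp_all)
  obtain R' where R': "absorbing G (\<pi>V ` V) \<alpha>' (\<pi>E ` E) \<beta>' i' t' R'"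
    "cost G (\<pi>V ` V) \<alpha>' (\<pi>E ` E) \<beta>' R' \<le> cost G V \<alpha> E \<beta> R"
    by (rule absorbing_fold[OF R])
  interpret O: over_tree G "\<pi>V ` V" \<alpha>' "\<pi>E ` E" \<beta>' i' t' VS \<alpha>S ES \<beta>S \<iota> \<tau> fV' fE'
  proof unfold_locales
    show "fV' ` \<pi>V ` V = VS" using fV' fV_image by (simp add: image_image)
    show "fE' a \<in> ES" if "a \<in> \<pi>E ` E" for a using that fE' fE_in by auto
    show "equivariant G (\<pi>V ` V) \<alpha>' \<alpha>S fV'"
      unfolding equivariant_def by (auto simp: MV.\<pi>_act[symmetric] V.act_closed fV' fV_act)
    show "equivariant G (\<pi>E ` E) \<beta>' \<beta>S fE'"
      unfolding equivariant_def by (auto simp: ME.\<pi>_act[symmetric] E.act_closed fE' fE_act)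
    show "\<iota> (fE' a) = fV' (i' a)" "\<tau> (fE' a) = fV' (t' a)" if "a \<in> \<pi>E ` E" for a
      using that by (auto simp: fE' i' t' fV' ends_closed f_ends)
    show "finite (orbits G (\<pi>V ` V) \<alpha>')" by (rule MV.finite_orbits_target[OF fin_V])
    show "finite (orbits G (\<pi>E ` E) \<beta>')" by (rule ME.finite_orbits_target[OF fin_E])
    show "(u, v) \<in> (adj (\<pi>E ` E) i' t')\<^sup>*" if "u \<in> \<pi>V ` V" "v \<in> \<pi>V ` V" for u v
      using that adj_\<pi> connected by blast
  qed (use fin_stab acyclic in auto)
  have "orbit_sum G O.defect \<beta>' (\<pi>E ` E) + defect e1 + (if e2 \<notin> orbit G \<beta> e1 then defect e2 else 0) =
      orbit_sum G defect \<beta> E + O.defect (\<pi>E e1)"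
    by (rule ME.orbit_sum_merge_all[OF fin_E defect_invariant _ O.defect_invariant])
       (simp add: O.defect_def defect_def fE' ME.stabilizer_outside)
  moreover have "O.defect (\<pi>E e1) < defect e1 + (if e2 \<notin> orbit G \<beta> e1 then defect e2 else 0)"
  proof -
    let ?C = "stabilizer G \<beta>S (fE e1)"
    have fC: "finite ?C" using fin_stab fE_in e by blast
    have H'C: "H' \<subseteq> ?C" using O.stabilizer_fE[of "\<pi>E e1"] e fE' by simp
    have fH': "finite H'" using finite_subset[OF H'C fC] .
    have c1: "card H1 \<le> card ?C" using card_mono[OF fC stabilizer_fE[OF e(1)]] .
    have c2: "card H2 \<le> card ?C" using card_mono[OF fC] stabilizer_fE[OF e(2)] fe by simp
    have c': "card H' \<le> card ?C" "card H1 \<le> card H'"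
      using card_mono[OF fC H'C] card_mono[OF fH' subs(3)] by auto
    have pos: "card H1 > 0" using subgroup.one_closed[OF subgroups(1)] finite_H(1) card_gt_0_iff by blast
    show ?thesis
    \<comment> \<open>In a common orbit, \<open>H'\<close> is properly larger than
      \<open>H1\<close>. Otherwise one orbit disappears, and its defect was at least
      \<open>card ?C\<close>.\<close>
    proof (cases "e2 \<in> orbit G \<beta> e1")
      case True
      then obtain g where g: "g \<in> carrier G" "e2 = \<beta> g e1" by (auto simp: E.in_orbit_iff)
      then have "g \<in> H'" "g \<notin> H1"
        using ME.\<pi>_act[OF g(1) e(1)] ME.\<pi>_xy e(3) by (auto simp: in_stabilizer_iff)
      then have "H1 \<subset> H'" using subs(3) by blast
      then have "card H1 < card H'" using psubset_card_mono[OF fH'] by blast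
      then show ?thesis using True c1 c' e by (simp add: O.defect_def defect_def fE')
    next
      case False
      then show ?thesis using c1 c2 c' pos e fe by (simp add: O.defect_def defect_def fE')
    qed
  qed
  ultimately have "orbit_sum G O.defect \<beta>' (\<pi>E ` E) < orbit_sum G defect \<beta> E" by linarith
  with R' O.over_tree_axioms show ?thesis by metis
qed

text \<open>The absence of folds is local injectivity, so backtracking cannot appear in the image of
  a reduced walk.\<close>

lemma unfoldable_walk:
  assumes unf: "\<And>e e'. e \<in> E \<Longrightarrow> e' \<in> E \<Longrightarrow> fE e = fE e' \<Longrightarrow> i e = i e' \<or> t e = t e' \<Longrightarrow> e = e'"
  shows "walk E i t u es v \<Longrightarrow> distinct_adj es \<Longrightarrow>
    walk ES \<iota> \<tau> (fV u) (map fE es) (fV v) \<and> distinct_adj (map fE es)"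
proof (induction es arbitrary: u)
  case (Cons e es)
  then obtain w where w: "e \<in> E" "i e = u \<and> t e = w \<or> t e = u \<and> i e = w" "walk E i t w es v"
    by auto
  have IH: "walk ES \<iota> \<tau> (fV w) (map fE es) (fV v)" "distinct_adj (map fE es)"
    using Cons.IH[OF w(3)] Cons.prems(2) by (auto simp: distinct_adj_Cons)
  have "walk ES \<iota> \<tau> (fV u) (map fE (e # es)) (fV v)"
    using IH(1) w fE_in f_ends by auto
  moreover have "fE e \<noteq> fE e'" if es: "es = e' # es'" for e' es'
  proof
    assume eq: "fE e = fE e'"
    have e': "e' \<in> E" "i e' = w \<or> t e' = w" using w(3) es by auto
    have ne: "e \<noteq> e'" using Cons.prems(2) es by (simp add: distinct_adj_Cons)
    \<comment> \<open>The tree has no loops, so edges with the same image that share the vertex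
      \<open>w\<close> meet it with the same end; they would form a fold.\<close>
    have "fV (i e) \<noteq> fV (t e)" using no_loop[OF acyclic fE_in[OF w(1)]] f_ends w(1) by simp
    moreover have "fV (i e) = fV (i e')" "fV (t e) = fV (t e')" using eq f_ends w(1) e'(1) by metis+
    ultimately have "i e = i e' \<or> t e = t e'" using w(2) e'(2) by metis
    with unf[OF w(1) e'(1) eq] ne show False by blast
  qed
  then have "distinct_adj (map fE (e # es))"
    using IH(2) by (cases es) (auto simp: distinct_adj_Cons)
  ultimately show ?case by blast
qed simp

text \<open>A reduced walk between two vertices with the same image maps to a reduced closed walk in
  a forest and is therefore empty. The image of the edges connects all vertices, so it contains
  every bridge, that is, every edge of the tree.\<close>

lemma unfoldable_iso:
  assumes unf: "\<And>e e'. e \<in> E \<Longrightarrow> e' \<in> E \<Longrightarrow> fE e = fE e' \<Longrightarrow> i e = i e' \<or> t e = t e' \<Longrightarrow> e = e'"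
  shows "bij_betw fV V VS" "bij_betw fE E ES"
proof -
  have inj: "u = v" if uv: "u \<in> V" "v \<in> V" "fV u = fV v" for u v
  proof -
    obtain es where es: "walk E i t u es v" "distinct_adj es"
      using reduced_walk_exists[OF connected[OF uv(1,2)]] .
    have w: "walk ES \<iota> \<tau> (fV u) (map fE es) (fV v)" and d: "distinct_adj (map fE es)"
      using unfoldable_walk[OF unf es] by blast+
    have "map fE es = []"
      by (rule no_reduced_closed_walk[OF acyclic w[folded uv(3)] d])
    then show ?thesis using es by simp
  qed
  then show "bij_betw fV V VS" using fV_image by (auto simp: bij_betw_def intro!: inj_onI)
  have "inj_on fE E"
  proof (rule inj_onI)
    fix e e' assume e: "e \<in> E" "e' \<in> E" "fE e = fE e'"
    then have "fV (i e) = fV (i e')" using f_ends by metis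
    then show "e = e'" using unf[OF e] inj ends_closed e by blast
  qed
  moreover have "ES \<subseteq> fE ` E"
  proof
    fix q assume q: "q \<in> ES"
    obtain a b where ab: "a \<in> V" "b \<in> V" "\<iota> q = fV a" "\<tau> q = fV b"
      using S.ends_closed[OF q] fV_image by blast
    have "(fV a, fV b) \<in> (adj (fE ` E) \<iota> \<tau>)\<^sup>*"
    proof (rule rtrancl_image[OF connected[OF ab(1,2)]])
      fix c d assume "(c, d) \<in> adj E i t"
      then show "(fV c, fV d) \<in> adj (fE ` E) \<iota> \<tau>"
        unfolding adj_def using f_ends by fastforce
    qed
    then show "q \<in> fE ` E"
      using edge_is_bridge[OF acyclic q, of "fE ` E"] fE_in ab by auto
  qed
  ultimately show "bij_betw fE E ES" using fE_in by (auto simp: bij_betw_def)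
qed

lemma transport_absorbing:
  assumes bij: "bij_betw fV V VS" "bij_betw fE E ES" and R: "absorbing G V \<alpha> E \<beta> i t R"
  shows "absorbing G VS \<alpha>S ES \<beta>S \<iota> \<tau> (fV ` R)" "cost G VS \<alpha>S ES \<beta>S (fV ` R) = cost G V \<alpha> E \<beta> R"
proof -
  have R': "R \<subseteq> V" "\<And>g r. g \<in> carrier G \<Longrightarrow> r \<in> R \<Longrightarrow> \<alpha> g r \<in> R"
    using R by (auto simp: absorbing_def)
  have stV: "stabilizer G \<alpha>S (fV v) = stabilizer G \<alpha> v" if "v \<in> V" for v
    unfolding stabilizer_def using that bij(1)
    by (auto simp: fV_act[symmetric] bij_betw_def inj_on_eq_iff V.act_closed)
  have stE: "stabilizer G \<beta>S (fE e) = stabilizer G \<beta> e" if "e \<in> E" for e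
    unfolding stabilizer_def using that bij(2)
    by (auto simp: fE_act[symmetric] bij_betw_def inj_on_eq_iff E.act_closed)
  have arr: "(fV u, fV v) \<in> arrows G \<alpha>S ES \<beta>S \<iota> \<tau>" if uv: "(u, v) \<in> arr" for u v
  proof -
    from uv obtain e where e: "e \<in> E" "i e = u \<and> t e = v \<or> t e = u \<and> i e = v"
      "stabilizer G \<beta> e = stabilizer G \<alpha> u"
      by (auto simp: arrows_def)
    have "stabilizer G \<beta>S (fE e) = stabilizer G \<alpha>S (fV u)"
      using e stE stV arrow_verts[OF uv] by simp
    moreover have "\<iota> (fE e) = fV u \<and> \<tau> (fE e) = fV v \<or> \<tau> (fE e) = fV u \<and> \<iota> (fE e) = fV v"
      using e f_ends by auto
    ultimately show ?thesis unfolding arrows_def using fE_in[OF e(1)] by blast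
  qed
  have act: "\<alpha>S g (fV r) \<in> fV ` R" if "g \<in> carrier G" "r \<in> R" for g r
    using fV_act[of g r] R'(1) R'(2)[OF that] that by (metis imageI subsetD)
  show "absorbing G VS \<alpha>S ES \<beta>S \<iota> \<tau> (fV ` R)"
    unfolding absorbing_def
  proof (intro conjI ballI)
    show "fV ` R \<subseteq> VS" using R'(1) fV_in by blast
    fix g r assume "g \<in> carrier G" "r \<in> fV ` R"
    then show "\<alpha>S g r \<in> fV ` R" using act by blast
  next
    fix v assume "v \<in> VS"
    then obtain u where u: "u \<in> V" "v = fV u" using fV_image by blast
    then obtain r where r: "r \<in> R" "(u, r) \<in> arr\<^sup>*" using R unfolding absorbing_def by blast
    have "(fV u, fV r) \<in> (arrows G \<alpha>S ES \<beta>S \<iota> \<tau>)\<^sup>*"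
      by (rule rtrancl_image[OF r(2)]) (rule arr)
    then show "\<exists>r\<in>fV ` R. (v, r) \<in> (arrows G \<alpha>S ES \<beta>S \<iota> \<tau>)\<^sup>*" using r(1) u(2) by blast
  qed
  have gR: "gset G R \<alpha>" by (rule V.gset_subset[OF R'])
  have gfR: "gset G (fV ` R) \<alpha>S"
    by (rule S.V.gset_subset) (use R'(1) fV_in act in auto)
  have bR: "bij_betw fV R (fV ` R)"
    using bij(1) R'(1) by (auto simp: bij_betw_def intro: inj_on_subset)
  have eR: "equivariant G R \<alpha> \<alpha>S fV" using fV_equivariant R'(1) by (auto simp: equivariant_def)
  have 1: "orbit_sum G (weight G \<alpha>S) \<alpha>S VS = orbit_sum G (weight G \<alpha>) \<alpha> V"
    by (rule orbit_sum_bij(1)[OF V.gset_axioms S.V.gset_axioms bij(1) fV_equivariant])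
       (simp_all add: weight_def stV V.card_stabilizer_act)
  have 2: "orbit_sum G (weight G \<beta>S) \<beta>S ES = orbit_sum G (weight G \<beta>) \<beta> E"
    by (rule orbit_sum_bij(1)[OF E.gset_axioms S.E.gset_axioms bij(2) fE_equivariant])
       (simp_all add: weight_def stE E.card_stabilizer_act)
  have 3: "orbit_sum G (weight G \<alpha>S) \<alpha>S (fV ` R) = orbit_sum G (weight G \<alpha>) \<alpha> R"
    by (rule orbit_sum_bij(1)[OF gR gfR bR eR])
       (use R'(1) in \<open>auto simp: weight_def stV V.card_stabilizer_act subset_iff\<close>)
  show "cost G VS \<alpha>S ES \<beta>S (fV ` R) = cost G V \<alpha> E \<beta> R"
    by (simp add: cost_def 1 2 3)
qed

end

lemma tree_absorbing_of_cover:
  fixes V :: "'v set" and E :: "'e set"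
  assumes "over_tree G V \<alpha> E \<beta> i t VS \<alpha>S ES \<beta>S \<iota> \<tau> fV fE" "absorbing G V \<alpha> E \<beta> i t R"
  shows "\<exists>RS. absorbing G VS \<alpha>S ES \<beta>S \<iota> \<tau> RS \<and> cost G VS \<alpha>S ES \<beta>S RS \<le> cost G V \<alpha> E \<beta> R"
  using assms
proof (induction "orbit_sum G (over_graph.defect G \<beta> \<beta>S fE) \<beta> E" arbitrary: V \<alpha> E \<beta> i t fV fE R
    rule: less_induct)
  case less
  interpret over_tree G V \<alpha> E \<beta> i t VS \<alpha>S ES \<beta>S \<iota> \<tau> fV fE by (rule less.prems)
  interpret sw: over_tree G V \<alpha> E \<beta> t i VS \<alpha>S ES \<beta>S \<tau> \<iota> fV fE by (rule swap_over)
  show ?case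
  proof (cases "\<forall>e\<in>E. \<forall>e'\<in>E. fE e = fE e' \<longrightarrow> i e = i e' \<or> t e = t e' \<longrightarrow> e = e'")
    case True
    then have "bij_betw fV V VS" "bij_betw fE E ES" using unfoldable_iso by blast+
    from transport_absorbing[OF this less.prems(2)] show ?thesis by (metis order_refl)
  next
    case False
    then obtain e1 e2 where e: "e1 \<in> E" "e2 \<in> E" "e1 \<noteq> e2" "fE e1 = fE e2" "i e1 = i e2 \<or> t e1 = t e2"
      by blast
    have "\<exists>(V' :: 'v set) \<alpha>' (E' :: 'e set) \<beta>' i' t' fV' fE' R'.
      over_tree G V' \<alpha>' E' \<beta>' i' t' VS \<alpha>S ES \<beta>S \<iota> \<tau> fV' fE' \<and>
      absorbing G V' \<alpha>' E' \<beta>' i' t' R' \<and> cost G V' \<alpha>' E' \<beta>' R' \<le> cost G V \<alpha> E \<beta> R \<and>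
      orbit_sum G (over_graph.defect G \<beta>' \<beta>S fE') \<beta>' E' < orbit_sum G (over_graph.defect G \<beta> \<beta>S fE) \<beta> E"
    proof (cases "i e1 = i e2")
      case True
      show ?thesis by (rule fold_exists[OF e(1-3) True e(4) less.prems(2)])
    next
      case False
      then have "t e1 = t e2" using e(5) by blast
      from sw.fold_exists[OF e(1-3) this e(4)] less.prems(2)
      obtain V' :: "'v set" and \<alpha>' and E' :: "'e set" and \<beta>' i' t' fV' fE' R' where
        "over_tree G V' \<alpha>' E' \<beta>' i' t' VS \<alpha>S ES \<beta>S \<tau> \<iota> fV' fE'"
        "absorbing G V' \<alpha>' E' \<beta>' i' t' R'" "cost G V' \<alpha>' E' \<beta>' R' \<le> cost G V \<alpha> E \<beta> R"
        "orbit_sum G (over_graph.defect G \<beta>' \<beta>S fE') \<beta>' E' < orbit_sum G (over_graph.defect G \<beta> \<beta>S fE) \<beta> E"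
        unfolding absorbing_swap[of G V \<alpha> E \<beta> t i] by blast
      then show ?thesis using over_tree.swap_over absorbing_swap by metis
    qed
    then obtain V' :: "'v set" and \<alpha>' and E' :: "'e set" and \<beta>' i' t' fV' fE' R' where
      N: "over_tree G V' \<alpha>' E' \<beta>' i' t' VS \<alpha>S ES \<beta>S \<iota> \<tau> fV' fE'"
      "absorbing G V' \<alpha>' E' \<beta>' i' t' R'" "cost G V' \<alpha>' E' \<beta>' R' \<le> cost G V \<alpha> E \<beta> R"
      "orbit_sum G (over_graph.defect G \<beta>' \<beta>S fE') \<beta>' E' < orbit_sum G (over_graph.defect G \<beta> \<beta>S fE) \<beta> E"
      by blast
    from less.hyps[OF N(4,1,2)] N(3) show ?thesis by (meson order_trans)
  qed
qed

section \<open>The initial cover\<close>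

text \<open>Each step attaches a leaf. What is used later is that vertices exceed edges by exactly
  one and that \<open>Y\<close> connects \<open>X\<close>.\<close>

inductive fin_tree :: "'e set \<Rightarrow> ('e \<Rightarrow> 'v) \<Rightarrow> ('e \<Rightarrow> 'v) \<Rightarrow> 'v \<Rightarrow> 'v set \<Rightarrow> 'e set \<Rightarrow> bool"
  for E i t v0 where
  base: "fin_tree E i t v0 {v0} {}"
| step: "fin_tree E i t v0 X Y \<Longrightarrow> e \<in> E \<Longrightarrow> u \<in> X \<Longrightarrow> v \<notin> X \<Longrightarrow>
    i e = u \<and> t e = v \<or> t e = u \<and> i e = v \<Longrightarrow> fin_tree E i t v0 (insert v X) (insert e Y)"

lemma fin_tree_props:
  assumes "fin_tree E i t v0 X Y"
  shows "finite X \<and> finite Y \<and> card X = Suc (card Y) \<and> v0 \<in> X \<and> Y \<subseteq> E \<and>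
    (\<forall>e\<in>Y. i e \<in> X \<and> t e \<in> X) \<and> (\<forall>x\<in>X. (x, v0) \<in> (adj Y i t)\<^sup>*)"
  using assms
proof induction
  case (step X Y e u v)
  have eY: "e \<notin> Y" using step by auto
  have mono: "(adj Y i t)\<^sup>* \<subseteq> (adj (insert e Y) i t)\<^sup>*"
    by (rule rtrancl_mono) (auto simp: adj_def)
  have "(v, u) \<in> adj (insert e Y) i t" using step by (auto simp: adj_def)
  moreover have "(u, v0) \<in> (adj (insert e Y) i t)\<^sup>*" using step mono by blast
  ultimately have "(v, v0) \<in> (adj (insert e Y) i t)\<^sup>*" by (rule converse_rtrancl_into_rtrancl)
  moreover have "\<forall>x\<in>X. (x, v0) \<in> (adj (insert e Y) i t)\<^sup>*" using step mono by blast
  ultimately show ?case using step eY by auto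
qed simp

lemma fin_tree_extend:
  assumes "fin_tree E i t v0 X Y" "u \<in> X" "(u, v) \<in> (adj E i t)\<^sup>*"
  shows "\<exists>X' Y'. fin_tree E i t v0 X' Y' \<and> X \<subseteq> X' \<and> v \<in> X'"
  using assms(3)
proof induction
  case base
  then show ?case using assms by blast
next
  case (step v w)
  then obtain X' Y' where X': "fin_tree E i t v0 X' Y'" "X \<subseteq> X'" "v \<in> X'" by blast
  obtain e where e: "e \<in> E" "i e = v \<and> t e = w \<or> t e = v \<and> i e = w"
    using step by (auto simp: adj_def)
  show ?case
  proof (cases "w \<in> X'")
    case False
    then have "fin_tree E i t v0 (insert w X') (insert e Y')"
      using fin_tree.step[OF X'(1) e(1) X'(3)] e(2) by blast
    then show ?thesis using X'(2) by blast
  qed (use X' in blast)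
qed

lemma fin_tree_covers:
  assumes "finite Z" "\<And>z. z \<in> Z \<Longrightarrow> (v0, z) \<in> (adj E i t)\<^sup>*"
  shows "\<exists>X Y. fin_tree E i t v0 X Y \<and> Z \<subseteq> X"
  using assms
proof induction
  case empty
  show ?case using fin_tree.base[of E i t v0] by blast
next
  case (insert z Z)
  then obtain X Y where X: "fin_tree E i t v0 X Y" "Z \<subseteq> X" by auto
  have v0: "v0 \<in> X" using fin_tree_props[OF X(1)] by blast
  have z: "(v0, z) \<in> (adj E i t)\<^sup>*" using insert.prems by simp
  obtain X' Y' where "fin_tree E i t v0 X' Y'" "X \<subseteq> X'" "z \<in> X'"
    using fin_tree_extend[OF X(1) v0 z] by blast
  then show ?case using X(2) by (intro exI[of _ X'] exI[of _ Y']) auto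
qed

definition left_mult :: "('g, 'b) monoid_scheme \<Rightarrow> 'g \<Rightarrow> 'g \<times> 'x \<Rightarrow> 'g \<times> 'x" where
  "left_mult G g p = (g \<otimes>\<^bsub>G\<^esub> fst p, snd p)"

context group begin

lemma left_mult_gset: "gset G (carrier G \<times> X) (left_mult G)"
  by unfold_locales (auto simp: left_mult_def m_assoc)

lemma left_mult_stabilizer: "p \<in> carrier G \<times> X \<Longrightarrow> stabilizer G (left_mult G) p = {\<one>}"
  by (auto simp: stabilizer_def left_mult_def)

lemma left_mult_orbit: "p \<in> carrier G \<times> X \<Longrightarrow> orbit G (left_mult G) p = carrier G \<times> {snd p}"
proof -
  assume p: "p \<in> carrier G \<times> X"
  have "\<exists>g\<in>carrier G. h = g \<otimes> fst p" if "h \<in> carrier G" for h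
    using that p by (intro bexI[of _ "h \<otimes> inv (fst p)"]) (auto simp: m_assoc)
  then show ?thesis using p by (auto simp: orbit_def left_mult_def)
qed

lemma left_mult_orbits: "orbits G (carrier G \<times> X) (left_mult G) = (\<lambda>x. carrier G \<times> {x}) ` X"
proof -
  have "orbits G (carrier G \<times> X) (left_mult G) = (\<lambda>p. carrier G \<times> {snd p}) ` (carrier G \<times> X)"
    unfolding orbits_image by (rule image_cong[OF refl left_mult_orbit])
  then show ?thesis by force
qed

lemma left_mult_orbit_sum:
  assumes "finite X"
  shows "orbit_sum G (weight G (left_mult G)) (left_mult G) (carrier G \<times> X) = real (card X)"
proof -
  interpret gset G "carrier G \<times> X" "left_mult G" by (rule left_mult_gset)
  have inj: "inj_on (\<lambda>x. carrier G \<times> {x}) X" using one_closed by (intro inj_onI) blast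
  have "weight G (left_mult G) (lift Q) = 1" if "Q \<in> orbits G (carrier G \<times> X) (left_mult G)" for Q
    using left_mult_stabilizer[OF lift_orbits(2)[OF that]] by (simp add: weight_def)
  then have "orbit_sum G (weight G (left_mult G)) (left_mult G) (carrier G \<times> X) =
      real (card (orbits G (carrier G \<times> X) (left_mult G)))"
    by (simp add: orbit_sum_def)
  then show ?thesis by (simp add: left_mult_orbits card_image[OF inj])
qed

end

text \<open>\<open>A'\<close> collects the generators already built in, each at a cost of at most 1.
  For every generator \<open>a\<close> the component of \<open>b\<close> keeps a vertex
  \<open>y\<close> over \<open>\<alpha>S a v0\<close>; identifying it with
  \<open>\<alpha> a b\<close>, which has the same image, joins \<open>b\<close> to
  \<open>\<alpha> a b\<close>.\<close>

definition rooted_cover where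
  "rooted_cover G V \<alpha> E \<beta> i t VS \<alpha>S ES \<beta>S \<iota> \<tau> fV fE R b v0 A A' \<longleftrightarrow>
     over_graph G V \<alpha> E \<beta> i t VS \<alpha>S ES \<beta>S \<iota> \<tau> fV fE \<and> absorbing G V \<alpha> E \<beta> i t R \<and>
     cost G V \<alpha> E \<beta> R \<le> real (card A') \<and> b \<in> R \<and> fV b = v0 \<and>
     (\<forall>v\<in>V. \<exists>g\<in>carrier G. (\<alpha> g b, v) \<in> (adj E i t)\<^sup>*) \<and>
     (\<forall>a\<in>A'. (b, \<alpha> a b) \<in> (adj E i t)\<^sup>*) \<and>
     (\<forall>a\<in>A. \<exists>y\<in>V. fV y = \<alpha>S a v0 \<and> (b, y) \<in> (adj E i t)\<^sup>*)"

text \<open>The edges are unchanged, and \<open>\<alpha> a b\<close> already lies in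
  \<open>R\<close>. So adding the merged orbit to the absorbing set raises the cost by at most the
  weight of \<open>y\<close>, hence by at most 1.\<close>

lemma cover_add_generator:
  fixes V :: "'v set" and E :: "'e set"
  assumes C: "rooted_cover G V \<alpha> E \<beta> i t VS \<alpha>S ES \<beta>S \<iota> \<tau> fV fE R b v0 A A'"
    and a: "a \<in> A" "a \<in> carrier G" "a \<notin> A'" "A \<subseteq> carrier G" "A' \<subseteq> A" "finite A'"
  shows "\<exists>(V' :: 'v set) \<alpha>' (E' :: 'e set) \<beta>' i' t' fV' fE' R' b'.
    rooted_cover G V' \<alpha>' E' \<beta>' i' t' VS \<alpha>S ES \<beta>S \<iota> \<tau> fV' fE' R' b' v0 A (insert a A')"
proof -
  interpret over_graph G V \<alpha> E \<beta> i t VS \<alpha>S ES \<beta>S \<iota> \<tau> fV fE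
    using C by (simp add: rooted_cover_def)
  have R: "absorbing G V \<alpha> E \<beta> i t R" and cost: "cost G V \<alpha> E \<beta> R \<le> real (card A')"
    and b: "b \<in> R" and fb: "fV b = v0"
    and conn: "\<And>v. v \<in> V \<Longrightarrow> \<exists>g\<in>carrier G. (\<alpha> g b, v) \<in> (adj E i t)\<^sup>*"
    and old: "\<And>a. a \<in> A' \<Longrightarrow> (b, \<alpha> a b) \<in> (adj E i t)\<^sup>*"
    and gens: "\<And>a. a \<in> A \<Longrightarrow> \<exists>y\<in>V. fV y = \<alpha>S a v0 \<and> (b, y) \<in> (adj E i t)\<^sup>*"
    using C by (auto simp: rooted_cover_def)
  have R': "R \<subseteq> V" "\<And>g r. g \<in> carrier G \<Longrightarrow> r \<in> R \<Longrightarrow> \<alpha> g r \<in> R"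
    using R by (auto simp: absorbing_def)
  have bV: "b \<in> V" using b R' by blast
  obtain y where y: "y \<in> V" "fV y = \<alpha>S a v0" "(b, y) \<in> (adj E i t)\<^sup>*" using gens[OF a(1)] by blast
  have abR: "\<alpha> a b \<in> R" using R'(2) a b by blast
  then have abV: "\<alpha> a b \<in> V" using R'(1) by blast
  obtain \<pi>V \<alpha>' where "merge G V \<alpha> y (\<alpha> a b) \<pi>V \<alpha>'" using V.merge_exists[OF y(1) abV] .
  then interpret MV: merge G V \<alpha> y "\<alpha> a b" \<pi>V \<alpha>' .
  define i' where "i' e = \<pi>V (i e)" for e
  define t' where "t' e = \<pi>V (t e)" for e
  define fV' where "fV' v' = fV (inv_into V \<pi>V v')" for v'
  interpret D': ggraph G "\<pi>V ` V" \<alpha>' E \<beta> i' t'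
    by unfold_locales (auto simp: i'_def t'_def ends_closed ends_act MV.\<pi>_act)
  interpret vmerge G V \<alpha> E \<beta> i t y "\<alpha> a b" \<pi>V \<alpha>' E \<beta> i' t' "\<lambda>e. e"
    by unfold_locales (auto simp: i'_def t'_def equivariant_def)
  have inV: "inv_into V \<pi>V (\<pi>V v) \<in> V" "\<pi>V (inv_into V \<pi>V (\<pi>V v)) = \<pi>V v" if "v \<in> V" for v
    using that by (auto intro: inv_into_into f_inv_into_f)
  have fy: "fV y = fV (\<alpha> a b)" using y fb fV_act[OF a(2) bV] by simp
  have fV': "fV' (\<pi>V v) = fV v" if "v \<in> V" for v
    unfolding fV'_def
    by (rule MV.factors[where f = fV and \<beta> = \<alpha>S, OF S.V.gset_axioms])
       (use that inV fy fV_in fV_equivariant in auto)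
  interpret O: over_graph G "\<pi>V ` V" \<alpha>' E \<beta> i' t' VS \<alpha>S ES \<beta>S \<iota> \<tau> fV' fE
  proof unfold_locales
    show "fV' ` \<pi>V ` V = VS" using fV' fV_image by (simp add: image_image)
    show "equivariant G (\<pi>V ` V) \<alpha>' \<alpha>S fV'"
      unfolding equivariant_def by (auto simp: MV.\<pi>_act[symmetric] V.act_closed fV' fV_act)
    show "\<iota> (fE e) = fV' (i' e)" "\<tau> (fE e) = fV' (t' e)" if "e \<in> E" for e
      using that by (auto simp: i'_def t'_def fV' ends_closed f_ends)
    show "finite (orbits G (\<pi>V ` V) \<alpha>')" by (rule MV.finite_orbits_target[OF fin_V])
  qed (use fE_in fE_equivariant fin_E fin_stab in auto)
  let ?R = "\<pi>V ` R \<union> orbit G \<alpha>' (\<pi>V y)"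
  have "cost G (\<pi>V ` V) \<alpha>' E \<beta> ?R \<le> cost G V \<alpha> E \<beta> R + 1"
    using orbit_sum_image_Un[OF R fin_V] abR weight_le_1[of G \<alpha> y] weight_nonneg[of G \<alpha> y]
      MV.orbit_sum_merge_all[OF fin_V V.invariant_weight MV.weight_outside MV.T.invariant_weight]
    by (simp add: cost_def split: if_splits)
  moreover have "real (card (insert a A')) = real (card A') + 1" using a by simp
  moreover have act_b: "\<alpha>' g (\<pi>V b) = \<pi>V (\<alpha> g b)" if "g \<in> carrier G" for g
    using MV.\<pi>_act[OF that bV] by simp
  have "rooted_cover G (\<pi>V ` V) \<alpha>' E \<beta> i' t' VS \<alpha>S ES \<beta>S \<iota> \<tau> fV' fE ?R (\<pi>V b) v0 A (insert a A')"
    unfolding rooted_cover_def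
  proof (intro conjI ballI O.over_graph_axioms absorbing_image_Un[OF R])
    show "cost G (\<pi>V ` V) \<alpha>' E \<beta> ?R \<le> real (card (insert a A'))" using calculation cost by linarith
    show "\<pi>V b \<in> ?R" using b by blast
    show "fV' (\<pi>V b) = v0" using fV' bV fb by simp
    show "\<exists>g\<in>carrier G. (\<alpha>' g (\<pi>V b), v) \<in> (adj E i' t')\<^sup>*" if v: "v \<in> \<pi>V ` V" for v
    proof -
      obtain u where u: "u \<in> V" "v = \<pi>V u" using v by blast
      obtain g where "g \<in> carrier G" "(\<alpha> g b, u) \<in> (adj E i t)\<^sup>*" using conn[OF u(1)] by blast
      then show ?thesis using adj_\<pi> act_b u(2) by metis
    qed
    show "(\<pi>V b, \<alpha>' c (\<pi>V b)) \<in> (adj E i' t')\<^sup>*" if c: "c \<in> insert a A'" for c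
    proof (cases "c = a")
      case True
      then show ?thesis using adj_\<pi>[OF y(3)] MV.\<pi>_xy act_b[OF a(2)] by simp
    next
      case False
      then have "c \<in> A'" "c \<in> carrier G" using c a by auto
      then show ?thesis using adj_\<pi>[OF old] act_b by simp
    qed
    show "\<exists>y\<in>\<pi>V ` V. fV' y = \<alpha>S c v0 \<and> (\<pi>V b, y) \<in> (adj E i' t')\<^sup>*" if "c \<in> A" for c
    proof -
      obtain z where z: "z \<in> V" "fV z = \<alpha>S c v0" "(b, z) \<in> (adj E i t)\<^sup>*" using gens[OF \<open>c \<in> A\<close>] by blast
      then show ?thesis using adj_\<pi>[OF z(3)] fV'[OF z(1)] by (intro bexI[of _ "\<pi>V z"]) auto
    qed
  qed
  then show ?thesis by blast
qed

locale tree_action = ggraph G VS \<alpha>S ES \<beta>S \<iota> \<tau>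
  for G (structure) and VS :: "'p set" and \<alpha>S :: "'g \<Rightarrow> 'p \<Rightarrow> 'p"
    and ES :: "'q set" and \<beta>S :: "'g \<Rightarrow> 'q \<Rightarrow> 'q" and \<iota> \<tau> :: "'q \<Rightarrow> 'p" +
  assumes tree_connected: "u \<in> VS \<Longrightarrow> v \<in> VS \<Longrightarrow> (u, v) \<in> (adj ES \<iota> \<tau>)\<^sup>*"
    and tree_acyclic: "has_no_cycle ES \<iota> \<tau>"
    and tree_fin_orbits: "finite (orbits G VS \<alpha>S)"
    and tree_fin_stab: "e \<in> ES \<Longrightarrow> finite (stabilizer G \<beta>S e)"
begin

lemma free_cover:
  assumes v0: "v0 \<in> VS" and A: "A \<subseteq> carrier G" "finite A"
  obtains V :: "('g \<times> 'p) set" and \<alpha> and E :: "('g \<times> 'q) set" and \<beta> i t fV fE R b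
  where "rooted_cover G V \<alpha> E \<beta> i t VS \<alpha>S ES \<beta>S \<iota> \<tau> fV fE R b v0 A {}"
proof -
  \<comment> \<open>The orbit representatives make \<open>fV\<close> surjective; the points
    \<open>\<alpha>S a v0\<close> supply the vertices to be glued later.\<close>
  define Z where "Z = lift ` orbits G VS \<alpha>S \<union> (\<lambda>a. \<alpha>S a v0) ` A"
  have Z: "Z \<subseteq> VS" "finite Z"
    using V.lift_orbits(2) V.act_closed v0 A tree_fin_orbits by (auto simp: Z_def)
  obtain X Y where XY: "fin_tree ES \<iota> \<tau> v0 X Y" "Z \<subseteq> X"
    using fin_tree_covers[of Z v0 ES \<iota> \<tau>] Z tree_connected[OF v0] by blast
  from fin_tree_props[OF XY(1)] have fin: "finite X" "finite Y" and card: "card X = Suc (card Y)"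
    and v0X: "v0 \<in> X" and YE: "Y \<subseteq> ES" and ends: "\<And>e. e \<in> Y \<Longrightarrow> \<iota> e \<in> X \<and> \<tau> e \<in> X"
    and conn: "\<And>x. x \<in> X \<Longrightarrow> (x, v0) \<in> (adj Y \<iota> \<tau>)\<^sup>*"
    by auto
  have XV: "X \<subseteq> VS"
  proof
    fix x assume "x \<in> X"
    then have "(x, v0) \<in> (adj Y \<iota> \<tau>)\<^sup>*" by (rule conn)
    then show "x \<in> VS"
      by (cases rule: converse_rtranclE) (use v0 YE ends_closed in \<open>auto simp: adj_def\<close>)
  qed
  define V where "V = carrier G \<times> X"
  define E where "E = carrier G \<times> Y"
  define i where "i p = (fst p, \<iota> (snd p))" for p :: "'g \<times> 'q"
  define t where "t p = (fst p, \<tau> (snd p))" for p :: "'g \<times> 'q"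
  define fV where "fV p = \<alpha>S (fst p) (snd p)" for p
  define fE where "fE p = \<beta>S (fst p) (snd p)" for p
  define R where "R = carrier G \<times> {v0}"
  let ?a = "left_mult G :: 'g \<Rightarrow> 'g \<times> 'p \<Rightarrow> 'g \<times> 'p"
  let ?b = "left_mult G :: 'g \<Rightarrow> 'g \<times> 'q \<Rightarrow> 'g \<times> 'q"
  interpret GV: gset G V ?a unfolding V_def by (rule V.left_mult_gset)
  interpret GE: gset G E ?b unfolding E_def by (rule V.left_mult_gset)
  interpret D: ggraph G V ?a E ?b i t
    by unfold_locales (use ends in \<open>auto simp: V_def E_def i_def t_def left_mult_def\<close>)
  interpret OG: over_graph G V ?a E ?b i t VS \<alpha>S ES \<beta>S \<iota> \<tau> fV fE
  proof unfold_locales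
    show "fV ` V = VS"
    proof
      show "fV ` V \<subseteq> VS" using XV V.act_closed by (auto simp: fV_def V_def)
      show "VS \<subseteq> fV ` V"
      proof
        fix v assume v: "v \<in> VS"
        have "lift (orbit G \<alpha>S v) \<in> X"
          using XY(2) V.in_orbits_orbit[OF v] by (auto simp: Z_def)
        moreover have "v \<in> orbit G \<alpha>S (lift (orbit G \<alpha>S v))"
          using V.orbit_sym[OF v V.lift_orbit[OF v]] .
        then obtain g where "g \<in> carrier G" "v = \<alpha>S g (lift (orbit G \<alpha>S v))"
          unfolding V.in_orbit_iff by blast
        ultimately show "v \<in> fV ` V"
          by (intro image_eqI[of _ _ "(g, lift (orbit G \<alpha>S v))"]) (auto simp: fV_def V_def)
      qed
    qed
    show "fE e \<in> ES" if "e \<in> E" for e using that YE E.act_closed by (auto simp: fE_def E_def)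
    show "equivariant G V ?a \<alpha>S fV"
      using XV by (auto simp: equivariant_def fV_def V_def left_mult_def V.act_mult)
    show "equivariant G E ?b \<beta>S fE"
      using YE by (auto simp: equivariant_def fE_def E_def left_mult_def E.act_mult)
    show "\<iota> (fE e) = fV (i e)" "\<tau> (fE e) = fV (t e)" if "e \<in> E" for e
      using that YE ends_act by (auto simp: fE_def fV_def E_def i_def t_def)
    show "finite (orbits G V ?a)" "finite (orbits G E ?b)"
      unfolding V_def E_def V.left_mult_orbits using fin by auto
    show "finite (stabilizer G \<beta>S q)" if "q \<in> ES" for q using that tree_fin_stab by blast
  qed
  \<comment> \<open>The action is free, so all stabilizers are trivial and every edge is an arrow in
    both directions.\<close>
  have arr: "((h, x), (h, y)) \<in> arrows G ?a E ?b i t" if h: "h \<in> carrier G" and xy: "(x, y) \<in> adj Y \<iota> \<tau>" for h x y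
  proof -
    obtain e where e: "e \<in> Y" "\<iota> e = x \<and> \<tau> e = y \<or> \<tau> e = x \<and> \<iota> e = y" using xy by (auto simp: adj_def)
    have "stabilizer G ?b (h, e) = stabilizer G ?a (h, x)"
      using V.left_mult_stabilizer[of "(h, e)" UNIV] V.left_mult_stabilizer[of "(h, x)" UNIV] h by simp
    moreover have "(h, e) \<in> E" using h e by (simp add: E_def)
    moreover have "i (h, e) = (h, x) \<and> t (h, e) = (h, y) \<or> t (h, e) = (h, x) \<and> i (h, e) = (h, y)"
      using e by (auto simp: i_def t_def)
    ultimately show ?thesis unfolding arrows_def by blast
  qed
  have reach: "((h, x), (h, v0)) \<in> (arrows G ?a E ?b i t)\<^sup>*" if "h \<in> carrier G" "x \<in> X" for h x
    using rtrancl_image[OF conn[OF that(2)], of "Pair h"] arr[OF that(1)] by blast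
  have sub: "arrows G ?a E ?b i t \<subseteq> adj E i t" by (auto simp: arrows_def adj_def)
  have reach': "((h, v0), (h, x)) \<in> (adj E i t)\<^sup>*" if "h \<in> carrier G" "x \<in> X" for h x
    by (rule adj_rtrancl_sym[OF subsetD[OF rtrancl_mono[OF sub] reach[OF that]]])
  have R: "absorbing G V ?a E ?b i t R"
    unfolding absorbing_def
  proof (intro conjI ballI)
    show "R \<subseteq> V" using v0X by (auto simp: R_def V_def)
    show "?a g r \<in> R" if "g \<in> carrier G" "r \<in> R" for g r using that by (auto simp: R_def left_mult_def)
    show "\<exists>r\<in>R. (v, r) \<in> (arrows G ?a E ?b i t)\<^sup>*" if "v \<in> V" for v
      using that reach by (auto simp: V_def R_def)
  qed
  \<comment> \<open>All weights are 1, so this is \<open>card Y - card X + 1\<close>.\<close>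
  have cost: "cost G V ?a E ?b R = 0"
    using card fin by (simp add: cost_def V_def E_def R_def V.left_mult_orbit_sum)
  have "rooted_cover G V ?a E ?b i t VS \<alpha>S ES \<beta>S \<iota> \<tau> fV fE R (\<one>, v0) v0 A {}"
    unfolding rooted_cover_def
  proof (intro conjI ballI OG.over_graph_axioms R)
    show "cost G V ?a E ?b R \<le> real (card {})" using cost by simp
    show "(\<one>, v0) \<in> R" by (simp add: R_def)
    show "fV (\<one>, v0) = v0" using V.act_one[OF v0] by (simp add: fV_def)
    show "\<exists>g\<in>carrier G. (?a g (\<one>, v0), v) \<in> (adj E i t)\<^sup>*" if v: "v \<in> V" for v
      by (rule bexI[of _ "fst v"]) (use v reach' in \<open>auto simp: V_def left_mult_def\<close>)
    show "\<exists>y\<in>V. fV y = \<alpha>S a v0 \<and> ((\<one>, v0), y) \<in> (adj E i t)\<^sup>*" if a: "a \<in> A" for a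
    proof (rule bexI[of _ "(\<one>, \<alpha>S a v0)"])
      have "\<alpha>S a v0 \<in> X" using XY(2) a by (auto simp: Z_def)
      then show "(\<one>, \<alpha>S a v0) \<in> V" "fV (\<one>, \<alpha>S a v0) = \<alpha>S a v0 \<and> ((\<one>, v0), \<one>, \<alpha>S a v0) \<in> (adj E i t)\<^sup>*"
        using reach' V.act_one XV by (auto simp: V_def fV_def)
    qed
  qed simp
  then show ?thesis by (rule that)
qed

lemma absorbing_cost_le_generators:
  assumes A: "A \<subseteq> carrier G" "finite A" "generate G A = carrier G" and v0: "v0 \<in> VS"
  shows "\<exists>RS. absorbing G VS \<alpha>S ES \<beta>S \<iota> \<tau> RS \<and> cost G VS \<alpha>S ES \<beta>S RS \<le> real (card A)"
proof -
  have "\<exists>(V :: ('g \<times> 'p) set) \<alpha> (E :: ('g \<times> 'q) set) \<beta> i t fV fE R b.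
      rooted_cover G V \<alpha> E \<beta> i t VS \<alpha>S ES \<beta>S \<iota> \<tau> fV fE R b v0 A A'" if "A' \<subseteq> A" for A'
    using finite_subset[OF that A(2)] that
  proof (induction A' rule: finite_induct)
    case empty
    show ?case using free_cover[OF v0 A(1,2)] by metis
  next
    case (insert a A')
    then obtain V :: "('g \<times> 'p) set" and \<alpha> and E :: "('g \<times> 'q) set" and \<beta> i t fV fE R b where
      C: "rooted_cover G V \<alpha> E \<beta> i t VS \<alpha>S ES \<beta>S \<iota> \<tau> fV fE R b v0 A A'" by blast
    show ?case by (rule cover_add_generator[OF C]) (use insert A in auto)
  qed
  from this[OF subset_refl]
  obtain V :: "('g \<times> 'p) set" and \<alpha> and E :: "('g \<times> 'q) set" and \<beta> i t fV fE R b where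
    C: "rooted_cover G V \<alpha> E \<beta> i t VS \<alpha>S ES \<beta>S \<iota> \<tau> fV fE R b v0 A A" by blast
  interpret C: over_graph G V \<alpha> E \<beta> i t VS \<alpha>S ES \<beta>S \<iota> \<tau> fV fE
    using C by (simp add: rooted_cover_def)
  have R: "absorbing G V \<alpha> E \<beta> i t R" and cost: "cost G V \<alpha> E \<beta> R \<le> real (card A)"
    and b: "b \<in> R" and conn: "\<And>v. v \<in> V \<Longrightarrow> \<exists>g\<in>carrier G. (\<alpha> g b, v) \<in> (adj E i t)\<^sup>*"
    and gens: "\<And>a. a \<in> A \<Longrightarrow> (b, \<alpha> a b) \<in> (adj E i t)\<^sup>*"
    using C by (auto simp: rooted_cover_def)
  have bV: "b \<in> V" using b R by (auto simp: absorbing_def)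
  \<comment> \<open>The elements that keep \<open>b\<close> in its component form a subgroup. It
    contains the generators, so every translate of \<open>b\<close>, and with it every vertex, is
    connected to \<open>b\<close>.\<close>
  let ?H = "{g \<in> carrier G. (b, \<alpha> g b) \<in> (adj E i t)\<^sup>*}"
  have "subgroup ?H G"
  proof (rule V.subgroupI)
    have "\<one> \<in> ?H" using C.V.act_one[OF bV] by simp
    then show "?H \<noteq> {}" by blast
    show "inv g \<in> ?H" if "g \<in> ?H" for g
      using that C.adj_act[of b "\<alpha> g b" "inv g"] C.V.act_inv_left[of g b] bV
      by (auto intro: adj_rtrancl_sym)
    show "g \<otimes> h \<in> ?H" if "g \<in> ?H" "h \<in> ?H" for g h
      using that C.adj_act[of b "\<alpha> h b" g] bV by (auto simp: C.V.act_mult)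
  qed auto
  then have "carrier G \<subseteq> ?H"
    using V.generate_subgroup_incl[of A ?H] A gens by auto
  then have from_b: "(b, v) \<in> (adj E i t)\<^sup>*" if "v \<in> V" for v
    using conn[OF that] by (blast intro: rtrancl_trans)
  interpret OT: over_tree G V \<alpha> E \<beta> i t VS \<alpha>S ES \<beta>S \<iota> \<tau> fV fE
  proof unfold_locales
    show "(u, v) \<in> (adj E i t)\<^sup>*" if "u \<in> V" "v \<in> V" for u v
      by (rule rtrancl_trans[OF adj_rtrancl_sym[OF from_b[OF that(1)]] from_b[OF that(2)]])
  qed (rule tree_acyclic)
  show ?thesis
    using tree_absorbing_of_cover[OF OT.over_tree_axioms R] cost by (meson order_trans)
qed

end

section \<open>Compressing forests\<close>

text \<open>A cycle through \<open>X\<close> crosses it once, so the rest of the cycle joins the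
  ends of \<open>X\<close> within \<open>F\<close>.\<close>

lemma no_cycle_insert:
  assumes F: "has_no_cycle F i t" and far: "(i X, t X) \<notin> (adj F i t)\<^sup>*"
  shows "has_no_cycle (insert X F) i t"
  unfolding has_no_cycle_def
proof (intro notI, elim exE)
  fix vs es assume c: "is_cycle (insert X F) i t vs es"
  then have w: "is_walk (insert X F) i t vs es" and ne: "es \<noteq> []" and cl: "hd vs = last vs"
    and d: "distinct es"
    by (auto simp: is_cycle_def)
  have len: "length vs = Suc (length es)" and sub: "set es \<subseteq> insert X F" using w by (auto simp: is_walk_def)
  have vs: "vs ! 0 = vs ! length es"
    using cl len by (metis Suc_neq_Zero diff_Suc_1 hd_conv_nth last_conv_nth length_0_conv)
  show False
  proof (cases "X \<in> set es")
    case False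
    then have "is_cycle F i t vs es" using c sub by (auto simp: is_cycle_def is_walk_def)
    with F show False by (auto simp: has_no_cycle_def)
  next
    case True
    then obtain k where k: "k < length es" "es ! k = X" by (auto simp: in_set_conv_nth)
    have seg: "(vs ! a, vs ! b) \<in> (adj F i t)\<^sup>*"
      if ab: "a \<le> b" "b \<le> length es" "\<And>j. a \<le> j \<Longrightarrow> j < b \<Longrightarrow> j \<noteq> k" for a b
      using ab
    proof (induction b rule: dec_induct)
      case (step n)
      then have n: "n < length es" "n \<noteq> k" by auto
      then have "es ! n \<noteq> X" using d k by (metis nth_eq_iff_index_eq)
      then have "es ! n \<in> F" using n sub nth_mem by blast
      moreover have "i (es ! n) = vs ! n \<and> t (es ! n) = vs ! Suc n \<or>
          t (es ! n) = vs ! n \<and> i (es ! n) = vs ! Suc n"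
        using w n by (simp add: is_walk_def)
      ultimately have "(vs ! n, vs ! Suc n) \<in> adj F i t" unfolding adj_def by blast
      moreover have "(vs ! a, vs ! n) \<in> (adj F i t)\<^sup>*" using step by auto
      ultimately show ?case by (simp add: rtrancl_into_rtrancl)
    qed simp
    have "(vs ! 0, vs ! k) \<in> (adj F i t)\<^sup>*" using seg[of 0 k] k by simp
    moreover have "(vs ! Suc k, vs ! 0) \<in> (adj F i t)\<^sup>*" using seg[of "Suc k" "length es"] k vs by simp
    ultimately have con: "(vs ! Suc k, vs ! k) \<in> (adj F i t)\<^sup>*" by (meson rtrancl_trans)
    have "i X = vs ! k \<and> t X = vs ! Suc k \<or> t X = vs ! k \<and> i X = vs ! Suc k"
      using w k by (auto simp: is_walk_def)
    then show False using far con adj_rtrancl_sym[OF con] by auto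
  qed
qed

section \<open>Forests in the quotient graph and changes of their orientation\<close>

context tree_action begin

abbreviation "qi \<equiv> q_iota G \<alpha>S \<iota>"
abbreviation "qt \<equiv> q_iota G \<alpha>S \<tau>"
abbreviation "EO \<equiv> orbits G ES \<beta>S"
abbreviation "VO \<equiv> orbits G VS \<alpha>S"
abbreviation "out s X \<equiv> (if s X then qi X else qt X)"
abbreviation "fc \<equiv> forest_conditions G VS ES \<iota> \<tau> \<alpha>S \<beta>S"

text \<open>The value 0 stands for an infinite stabilizer, so \<open>0 < cv W\<close> expresses
  finiteness.\<close>

definition cv :: "'p set \<Rightarrow> nat" where "cv W = card (stabilizer G \<alpha>S (lift W))"
definition ce :: "'q set \<Rightarrow> nat" where "ce X = card (stabilizer G \<beta>S (lift X))"

lemma cv_eq: "v \<in> VS \<Longrightarrow> cv (orbit G \<alpha>S v) = card (stabilizer G \<alpha>S v)"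
  unfolding cv_def using V.card_stabilizer_orbit[OF _ V.lift_orbit] by blast

lemma ce_eq: "X \<in> EO \<Longrightarrow> e \<in> X \<Longrightarrow> ce X = card (stabilizer G \<beta>S e)"
  unfolding ce_def using E.card_stabilizer_orbit[of e "lift X"] E.orbits_elem[of X e] E.lift_orbits(1)[of X] by simp

lemma q_eq:
  assumes "X \<in> EO" "e \<in> X"
  shows "qi X = orbit G \<alpha>S (\<iota> e)" "qt X = orbit G \<alpha>S (\<tau> e)"
proof -
  have e: "e \<in> ES" "e \<in> orbit G \<beta>S (lift X)" using assms E.orbits_elem E.lift_orbits by auto
  then obtain g where "g \<in> carrier G" "e = \<beta>S g (lift X)" by (auto simp: E.in_orbit_iff)
  then show "qi X = orbit G \<alpha>S (\<iota> e)" "qt X = orbit G \<alpha>S (\<tau> e)"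
    using E.lift_orbits(2)[OF assms(1)] by (auto simp: q_iota_def ends_act V.orbit_act ends_closed)
qed

lemma q_in: "X \<in> EO \<Longrightarrow> qi X \<in> VO" "X \<in> EO \<Longrightarrow> qt X \<in> VO"
  using E.lift_orbits(2)[of X] by (auto simp: q_iota_def ends_closed V.in_orbits_orbit)

lemma ce_pos: "X \<in> EO \<Longrightarrow> 0 < ce X"
  unfolding ce_def card_gt_0_iff
  using E.lift_orbits(2)[of X] tree_fin_stab subgroup.one_closed[OF E.stabilizer_subgroup] by blast

lemma ce_le:
  assumes "X \<in> EO"
  shows "0 < cv (qi X) \<Longrightarrow> ce X \<le> cv (qi X)" "0 < cv (qt X) \<Longrightarrow> ce X \<le> cv (qt X)"
proof -
  have e: "lift X \<in> ES" "lift X \<in> X" using E.lift_orbits[OF assms] by auto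
  note q = q_eq[OF assms e(2)] cv_eq[OF ends_closed(1)[OF e(1)]] cv_eq[OF ends_closed(2)[OF e(1)]]
  show "0 < cv (qi X) \<Longrightarrow> ce X \<le> cv (qi X)"
    using stabilizer_ends(1)[OF e(1)] unfolding q ce_def by (auto simp: card_gt_0_iff intro: card_mono)
  show "0 < cv (qt X) \<Longrightarrow> ce X \<le> cv (qt X)"
    using stabilizer_ends(2)[OF e(1)] unfolding q ce_def by (auto simp: card_gt_0_iff intro: card_mono)
qed

context
  fixes F :: "'q set set" assumes finE: "finite EO"
begin

definition is_root :: "('q set \<Rightarrow> bool) \<Rightarrow> 'p set \<Rightarrow> bool" where
  "is_root s W \<longleftrightarrow> W \<in> VO \<and> (\<forall>X\<in>F. out s X \<noteq> W)"

text \<open>A bound \<open>card \<le> 1\<close> gives uniqueness only for finite sets; this is where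
  \<open>finE\<close> enters.\<close>

lemma fcD:
  assumes "fc F' s"
  shows "F' \<subseteq> EO" "has_no_cycle F' qi qt" "X \<in> F' \<Longrightarrow> Y \<in> F' \<Longrightarrow> out s X = out s Y \<Longrightarrow> X = Y"
    "X \<in> F' \<Longrightarrow> e \<in> X \<Longrightarrow> stabilizer G \<beta>S e = stabilizer G \<alpha>S (if s X then \<iota> e else \<tau> e)"
proof -
  show sub: "F' \<subseteq> EO" and "has_no_cycle F' qi qt"
    and "X \<in> F' \<Longrightarrow> e \<in> X \<Longrightarrow> stabilizer G \<beta>S e = stabilizer G \<alpha>S (if s X then \<iota> e else \<tau> e)"
    using assms unfolding forest_conditions_def by blast+
  assume XY: "X \<in> F'" "Y \<in> F'" "out s X = out s Y"
  have "out s X \<in> VO" using XY sub q_in by auto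
  then have "card {Z \<in> F'. out s Z = out s X} \<le> 1"
    using assms unfolding forest_conditions_def by blast
  moreover have fin: "finite {Z \<in> F'. out s Z = out s X}" using finite_subset[OF sub finE] by simp
  ultimately have "\<forall>Y\<in>{Z \<in> F'. out s Z = out s X}. \<forall>Y'\<in>{Z \<in> F'. out s Z = out s X}. Y = Y'"
    using card_le_Suc0_iff_eq[OF fin] by simp
  moreover have "X \<in> {Z \<in> F'. out s Z = out s X}" "Y \<in> {Z \<in> F'. out s Z = out s X}"
    using XY(1,2) XY(3)[symmetric] by simp_all
  ultimately show "X = Y" by blast
qed

lemma fcI:
  assumes "F' \<subseteq> EO" "has_no_cycle F' qi qt" "\<And>X Y. X \<in> F' \<Longrightarrow> Y \<in> F' \<Longrightarrow> out s X = out s Y \<Longrightarrow> X = Y"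
    "\<And>X e. X \<in> F' \<Longrightarrow> e \<in> X \<Longrightarrow> stabilizer G \<beta>S e = stabilizer G \<alpha>S (if s X then \<iota> e else \<tau> e)"
  shows "fc F' s"
  unfolding forest_conditions_def
proof (intro conjI ballI assms)
  fix W
  have "finite {X \<in> F'. out s X = W}" using finite_subset[OF assms(1) finE] by simp
  then show "card {X \<in> F'. out s X = W} \<le> 1"
    using assms(3) by (simp add: card_le_Suc0_iff_eq)
qed

lemma ce_out:
  assumes "fc F s" "X \<in> F"
  shows "ce X = cv (out s X)"
proof -
  have X: "X \<in> EO" using fcD(1)[OF assms(1)] assms(2) by blast
  have e: "lift X \<in> ES" "lift X \<in> X" using E.lift_orbits[OF X] by auto
  have "ce X = card (stabilizer G \<alpha>S (if s X then \<iota> (lift X) else \<tau> (lift X)))"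
    using fcD(4)[OF assms e(2)] by (simp add: ce_def)
  then show ?thesis using q_eq[OF X e(2)] cv_eq ends_closed[OF e(1)] by simp
qed

text \<open>Along a reduced walk in the forest whose first edge does not leave its initial vertex,
  every edge points backwards.\<close>

lemma walk_from_root:
  assumes fc: "fc F s"
  shows "walk F qi qt u es v \<Longrightarrow> distinct_adj es \<Longrightarrow> (es \<noteq> [] \<Longrightarrow> out s (hd es) \<noteq> u) \<Longrightarrow> 0 < cv u \<Longrightarrow>
    (es = [] \<or> out s (last es) = v) \<and> 0 < cv v \<and> cv v \<le> cv u"
proof (induction es arbitrary: u)
  case (Cons X es)
  then obtain w where w: "X \<in> F" "qi X = u \<and> qt X = w \<or> qt X = u \<and> qi X = w" "walk F qi qt w es v"
    by auto
  have X: "X \<in> EO" using fcD(1)[OF fc] w(1) by blast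
  have ow: "out s X = w" using Cons.prems(3) w(2) by (auto split: if_splits)
  have cw: "ce X = cv w" using ce_out[OF fc w(1)] ow by simp
  have "ce X \<le> cv u" using ce_le[OF X] w(2) Cons.prems(4) by auto
  then have le: "0 < cv w" "cv w \<le> cv u" using cw ce_pos[OF X] by auto
  have hd: "out s (hd es) \<noteq> w" if ne: "es \<noteq> []"
  proof
    assume "out s (hd es) = w"
    moreover have "hd es \<in> F" using walk_set[OF w(3)] ne by (meson hd_in_set subsetD)
    ultimately have "hd es = X" using fcD(3)[OF fc _ w(1)] ow by simp
    then show False using Cons.prems(2) ne by (auto simp: distinct_adj_Cons)
  qed
  have IH: "(es = [] \<or> out s (last es) = v) \<and> 0 < cv v \<and> cv v \<le> cv w"
    by (rule Cons.IH[OF w(3) _ hd le(1)]) (use Cons.prems(2) in \<open>auto simp: distinct_adj_Cons\<close>)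
  have "out s (last (X # es)) = v"
  proof (cases "es = []")
    case True
    then have "v = w" using w(3) by simp
    then show ?thesis using True ow by (simp split: if_splits)
  next
    case False
    then show ?thesis using IH by (simp split: if_splits)
  qed
  then show ?case using IH le(2) by linarith
qed simp

text \<open>The stabilizer of the edge is that of its end over \<open>w\<close>. By equality of
  orders it is also that of its end over \<open>u\<close>, so the edge may leave \<open>u\<close>
  instead, where no other edge leaves. As \<open>X\<close> was the only edge leaving
  \<open>w\<close>, the root moves to \<open>w\<close>.\<close>

lemma flip_edge:
  assumes fc: "fc F s" and root: "is_root s u" and X: "X \<in> F"
    and uw: "qi X = u \<and> qt X = w \<or> qt X = u \<and> qi X = w" and c: "cv u = cv w"
  shows "fc F (s(X := \<not> s X))" "is_root (s(X := \<not> s X)) w"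
proof -
  let ?s = "s(X := \<not> s X)"
  have XE: "X \<in> EO" using fcD(1)[OF fc] X by blast
  have ne: "u \<noteq> w" using no_loop[OF fcD(2)[OF fc] X] uw by auto
  have rt: "out s Y \<noteq> u" if "Y \<in> F" for Y using root that by (simp add: is_root_def)
  have ow: "out s X = w" using rt[OF X] uw by (auto split: if_splits)
  have ou: "out ?s X = u" using ow uw ne by (auto split: if_splits)
  have oth: "out ?s Y = out s Y" if "Y \<noteq> X" for Y using that by simp
  show "fc F ?s"
  proof (rule fcI)
    show "F \<subseteq> EO" "has_no_cycle F qi qt" using fcD[OF fc] by blast+
    show "Y = Z" if YZ: "Y \<in> F" "Z \<in> F" "out ?s Y = out ?s Z" for Y Z
    proof (rule ccontr)
      assume "Y \<noteq> Z"
      then consider "Y = X" "Z \<noteq> X" | "Z = X" "Y \<noteq> X" | "Y \<noteq> X" "Z \<noteq> X" by blast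
      then show False
      proof cases
        case 1
        then have "out s Z = u" using YZ(3) ou oth[of Z] by metis
        then show False using rt[OF YZ(2)] by blast
      next
        case 2
        then have "out s Y = u" using YZ(3) ou oth[of Y] by metis
        then show False using rt[OF YZ(1)] by blast
      next
        case 3
        then have "out s Y = out s Z" using YZ(3) by simp
        then show False using fcD(3)[OF fc YZ(1,2)] \<open>Y \<noteq> Z\<close> by blast
      qed
    qed
    show "stabilizer G \<beta>S e = stabilizer G \<alpha>S (if ?s Y then \<iota> e else \<tau> e)" if Y: "Y \<in> F" "e \<in> Y" for Y e
    proof (cases "Y = X")
      case True
      have e: "e \<in> ES" "e \<in> X" using E.orbits_elem[OF XE] Y True by auto
      let ?x = "if ?s X then \<iota> e else \<tau> e"
      have x: "?x \<in> VS" "orbit G \<alpha>S ?x = u"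
        using ends_closed[OF e(1)] q_eq[OF XE e(2)] ou by auto
      have sub: "stabilizer G \<beta>S e \<subseteq> stabilizer G \<alpha>S ?x" using stabilizer_ends[OF e(1)] by auto
      have card: "card (stabilizer G \<alpha>S ?x) = card (stabilizer G \<beta>S e)"
        using cv_eq[OF x(1)] x(2) c ce_out[OF fc X] ow ce_eq[OF XE e(2)] by simp
      have "0 < card (stabilizer G \<beta>S e)" using ce_pos[OF XE] ce_eq[OF XE e(2)] by simp
      then have "finite (stabilizer G \<alpha>S ?x)" using card_ge_0_finite card by metis
      then have "stabilizer G \<beta>S e = stabilizer G \<alpha>S ?x"
        by (rule card_subset_eq[OF _ sub card[symmetric]])
      then show ?thesis using True by simp
    next
      case False
      then show ?thesis using fcD(4)[OF fc Y] by simp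
    qed
  qed
  have "out ?s Y \<noteq> w" if Y: "Y \<in> F" for Y
  proof (cases "Y = X")
    case True
    then show ?thesis using ou ne by metis
  next
    case False
    then show ?thesis using fcD(3)[OF fc Y X] ow oth[OF False] by metis
  qed
  then show "is_root ?s w" using q_in[OF XE] uw by (auto simp: is_root_def)
qed

text \<open>The orders never increase along a reduced walk from a root and agree at its two ends, so
  they are constant and the edges can be reversed one by one.\<close>

lemma reroot:
  "fc F s \<Longrightarrow> is_root s u \<Longrightarrow> walk F qi qt u es v \<Longrightarrow> distinct_adj es \<Longrightarrow> cv u = cv v \<Longrightarrow> 0 < cv u \<Longrightarrow>
    \<exists>s'. fc F s' \<and> is_root s' v"
proof (induction es arbitrary: s u)
  case Nil
  then show ?case by auto
next
  case (Cons X es)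
  then obtain w where w: "X \<in> F" "qi X = u \<and> qt X = w \<or> qt X = u \<and> qi X = w" "walk F qi qt w es v"
    by auto
  have rt: "out s Y \<noteq> u" if "Y \<in> F" for Y using Cons.prems(2) that by (simp add: is_root_def)
  have one: "walk F qi qt u [X] w" using w by auto
  have "([X] = [] \<or> out s (last [X]) = w) \<and> 0 < cv w \<and> cv w \<le> cv u"
    by (rule walk_from_root[OF Cons.prems(1) one]) (use rt[OF w(1)] Cons.prems(6) in \<open>simp_all split: if_splits\<close>)
  then have ow: "out s X = w" and cw: "0 < cv w" "cv w \<le> cv u"
    by (simp_all split: if_splits)
  have hd: "out s (hd es) \<noteq> w" if ne: "es \<noteq> []"
  proof
    assume "out s (hd es) = w"
    moreover have "hd es \<in> F" using walk_set[OF w(3)] ne by (meson hd_in_set subsetD)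
    ultimately have "hd es = X" using fcD(3)[OF Cons.prems(1) _ w(1)] ow by simp
    then show False using Cons.prems(4) ne by (auto simp: distinct_adj_Cons)
  qed
  have d: "distinct_adj es" using Cons.prems(4) by (auto simp: distinct_adj_Cons)
  have "cv v \<le> cv w" using walk_from_root[OF Cons.prems(1) w(3) d hd cw(1)] by blast
  then have c: "cv u = cv w" using cw Cons.prems(5) by simp
  note fl = flip_edge[OF Cons.prems(1,2) w(1,2) c]
  show ?case using Cons.IH[OF fl w(3) d] c cw Cons.prems(5) by simp
qed

context
  fixes ori assumes forest: "compressing_forest G VS ES \<iota> \<tau> \<alpha>S \<beta>S F ori"
begin

text \<open>If the forest did not join the two orbits, the edge orbit of the arrow, oriented away
  from the root, could be added to \<open>F\<close>, against maximality. Once they are joined,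
  \<open>cv\<close> cannot increase away from the root, whereas stabilizers grow along an arrow. So
  the orders agree, and the root can be moved to the end of the arrow.\<close>

lemma arrow_from_root:
  assumes fc: "fc F s" and root: "is_root s (orbit G \<alpha>S x)" and fin: "0 < cv (orbit G \<alpha>S x)"
    and arr: "(x, y) \<in> arr"
  shows "(orbit G \<alpha>S x, orbit G \<alpha>S y) \<in> (adj F qi qt)\<^sup>* \<and> cv (orbit G \<alpha>S y) = cv (orbit G \<alpha>S x) \<and>
    (\<exists>s'. fc F s' \<and> is_root s' (orbit G \<alpha>S y))"
proof -
  let ?u = "orbit G \<alpha>S x" and ?w = "orbit G \<alpha>S y"
  have xy: "x \<in> VS" "y \<in> VS" using arrow_verts[OF arr] by auto
  have rt: "out s Y \<noteq> ?u" if "Y \<in> F" for Y using root that by (simp add: is_root_def)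
  have con: "(?u, ?w) \<in> (adj F qi qt)\<^sup>*"
  proof (rule ccontr)
    assume far: "(?u, ?w) \<notin> (adj F qi qt)\<^sup>*"
    obtain e where e: "e \<in> ES" "\<iota> e = x \<and> \<tau> e = y \<or> \<tau> e = x \<and> \<iota> e = y"
      "stabilizer G \<beta>S e = stabilizer G \<alpha>S x"
      using arr by (auto simp: arrows_def)
    define X where "X = orbit G \<beta>S e"
    have X: "X \<in> EO" "e \<in> X" using e E.in_orbits_orbit E.orbit_refl by (auto simp: X_def)
    have q: "qi X = ?u \<and> qt X = ?w \<or> qt X = ?u \<and> qi X = ?w" using e q_eq[OF X] by auto
    have XF: "X \<notin> F"
    proof
      assume "X \<in> F"
      then have "(?u, ?w) \<in> adj F qi qt" using q unfolding adj_def by blast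
      with far show False by blast
    qed
    define s' where "s' = s(X := (\<iota> e = x))"
    have oX: "out s' X = ?u" using e q_eq[OF X] by (auto simp: s'_def)
    have oY: "out s' Y = out s Y" "s' Y = s Y" if "Y \<in> F" for Y using that XF by (auto simp: s'_def)
    have far': "(qi X, qt X) \<notin> (adj F qi qt)\<^sup>*"
      using q far adj_rtrancl_sym[of ?w ?u F qi qt] by auto
    have "fc (insert X F) s'"
    proof (rule fcI)
      show "insert X F \<subseteq> EO" using X fcD(1)[OF fc] by blast
      show "has_no_cycle (insert X F) qi qt" by (rule no_cycle_insert[OF fcD(2)[OF fc] far'])
      show "Y = Z" if YZ: "Y \<in> insert X F" "Z \<in> insert X F" "out s' Y = out s' Z" for Y Z
      proof (rule ccontr)
        assume "Y \<noteq> Z"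
        then consider "Y = X" "Z \<in> F" | "Z = X" "Y \<in> F" | "Y \<in> F" "Z \<in> F" using YZ by blast
        then show False
        proof cases
          case 1
          then show False using YZ(3) oX oY(1)[of Z] rt[of Z] by metis
        next
          case 2
          then show False using YZ(3) oX oY(1)[of Y] rt[of Y] by metis
        next
          case 3
          then show False using YZ(3) oY(1)[of Y] oY(1)[of Z] fcD(3)[OF fc 3] \<open>Y \<noteq> Z\<close> by metis
        qed
      qed
      show "stabilizer G \<beta>S f = stabilizer G \<alpha>S (if s' Y then \<iota> f else \<tau> f)" if Y: "Y \<in> insert X F" "f \<in> Y" for Y f
      proof (cases "Y = X")
        case True
        then obtain g where g: "g \<in> carrier G" "f = \<beta>S g e" using Y by (auto simp: X_def E.in_orbit_iff)
        have "(if s' Y then \<iota> f else \<tau> f) = \<alpha>S g x"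
          using True g e ends_act by (auto simp: s'_def)
        then show ?thesis
          using g e xy by (simp add: E.stabilizer_act V.stabilizer_act)
      next
        case False
        then have "Y \<in> F" using Y by blast
        then show ?thesis using fcD(4)[OF fc _ Y(2)] oY(2) by simp
      qed
    qed
    moreover have "F \<subset> insert X F" using XF by blast
    ultimately show False using forest unfolding compressing_forest_def by blast
  qed
  obtain es where es: "walk F qi qt ?u es ?w" "distinct_adj es"
    using reduced_walk_exists[OF con] .
  have hd: "out s (hd es) \<noteq> ?u" if ne: "es \<noteq> []"
    using rt walk_set[OF es(1)] ne by (meson hd_in_set subsetD)
  have w: "0 < cv ?w" "cv ?w \<le> cv ?u" using walk_from_root[OF fc es hd fin] by auto
  have "finite (stabilizer G \<alpha>S y)" using w(1) cv_eq[OF xy(2)] by (simp add: card_gt_0_iff)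
  then have "cv ?u \<le> cv ?w"
    using card_mono[OF _ arrow_stabilizer[OF arr]] cv_eq[OF xy(1)] cv_eq[OF xy(2)] by simp
  then have c: "cv ?u = cv ?w" using w by simp
  show ?thesis using con c reroot[OF fc root es c fin] by simp
qed

text \<open>After each arrow the orbit reached is a root for some other orientation of
  \<open>F\<close>. Maximality refers to all orientations, so \<open>arrow_from_root\<close> applies
  again.\<close>

lemma root_to_absorbing:
  assumes r: "is_root ori W" "0 < cv W" and R: "absorbing G VS \<alpha>S ES \<beta>S \<iota> \<tau> R"
  shows "\<exists>U\<in>orbits G R \<alpha>S. (W, U) \<in> (adj F qi qt)\<^sup>* \<and> cv U = cv W"
proof -
  have fc: "fc F ori" using forest by (simp add: compressing_forest_def)
  have W: "W \<in> VO" using r by (simp add: is_root_def)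
  then have x: "lift W \<in> VS" "orbit G \<alpha>S (lift W) = W" using V.lift_orbits by auto
  obtain z where z: "z \<in> R" "(lift W, z) \<in> arr\<^sup>*" using R x unfolding absorbing_def by blast
  have "(W, orbit G \<alpha>S z) \<in> (adj F qi qt)\<^sup>* \<and> cv (orbit G \<alpha>S z) = cv W \<and>
      (\<exists>s. fc F s \<and> is_root s (orbit G \<alpha>S z))"
    using z(2)
  proof (induction rule: rtrancl_induct)
    case base
    then show ?case using x fc r by auto
  next
    case (step y z)
    then obtain s where s: "fc F s" "is_root s (orbit G \<alpha>S y)" by blast
    have "0 < cv (orbit G \<alpha>S y)" using step r by simp
    from arrow_from_root[OF s this step.hyps(2)] step.IH show ?case
      by (metis rtrancl_trans)
  qed
  moreover have "orbit G \<alpha>S z \<in> orbits G R \<alpha>S" using z by (auto simp: orbits_def)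
  ultimately show ?thesis by blast
qed

text \<open>By \<open>walk_from_root\<close> a nonempty reduced walk from \<open>W\<close> ends with
  an edge leaving its last vertex, which therefore is not a root.\<close>

lemma roots_disconnected:
  assumes "is_root ori W" "0 < cv W" "is_root ori W'" "(W, W') \<in> (adj F qi qt)\<^sup>*"
  shows "W = W'"
proof -
  have fc: "fc F ori" using forest by (simp add: compressing_forest_def)
  obtain es where es: "walk F qi qt W es W'" "distinct_adj es"
    using reduced_walk_exists[OF assms(4)] .
  have F: "X \<in> F" if "X \<in> set es" for X using walk_set[OF es(1)] that by blast
  have hd: "out ori (hd es) \<noteq> W" if "es \<noteq> []"
    using assms(1) F[OF hd_in_set[OF that]] by (simp add: is_root_def)
  have "es = [] \<or> out ori (last es) = W'"
    using walk_from_root[OF fc es hd assms(2)] by blast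
  moreover have "out ori (last es) \<noteq> W'" if "es \<noteq> []"
    using assms(3) F[OF last_in_set[OF that]] by (simp add: is_root_def)
  ultimately have "es = []" by blast
  then show ?thesis using es(1) by simp
qed

lemma forest_sum_le_cost:
  assumes R: "absorbing G VS \<alpha>S ES \<beta>S \<iota> \<tau> R"
  shows "(\<Sum>X\<in>EO - F. 1 / real (ce X)) \<le> cost G VS \<alpha>S ES \<beta>S R"
proof -
  have fc: "fc F ori" using forest by (simp add: compressing_forest_def)
  have sub: "F \<subseteq> EO" using fcD(1)[OF fc] .
  have finF: "finite F" using finite_subset[OF sub finE] .
  have RO: "orbits G R \<alpha>S \<subseteq> VO" using R orbits_mono[of R VS] by (simp add: absorbing_def)
  have finR: "finite (orbits G R \<alpha>S)" using finite_subset[OF RO tree_fin_orbits] .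
  let ?roots = "{W \<in> VO. is_root ori W}"
  let ?P = "{W \<in> VO. is_root ori W \<and> 0 < cv W}"
  have E: "orbit_sum G (weight G \<beta>S) \<beta>S ES = (\<Sum>X\<in>EO - F. 1 / real (ce X)) + (\<Sum>X\<in>F. 1 / real (ce X))"
    unfolding orbit_sum_def weight_def ce_def[symmetric]
    by (rule sum.subset_diff[OF sub finE])
  \<comment> \<open>Each vertex orbit that is not a root is the origin of exactly one forest edge,
    of the same weight. In the cost these cancel, and only the roots remain.\<close>
  have inj: "inj_on (out ori) F" using fcD(3)[OF fc] by (intro inj_onI) blast
  have "(\<Sum>X\<in>F. 1 / real (ce X)) = (\<Sum>X\<in>F. 1 / real (cv (out ori X)))"
    using ce_out[OF fc] by (intro sum.cong) auto
  also have "\<dots> = (\<Sum>W\<in>out ori ` F. 1 / real (cv W))"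
    by (simp only: sum.reindex[OF inj] o_def)
  finally have Fsum: "(\<Sum>X\<in>F. 1 / real (ce X)) = (\<Sum>W\<in>out ori ` F. 1 / real (cv W))" .
  have img: "out ori ` F \<subseteq> VO" using sub q_in by auto
  have split: "VO - out ori ` F = ?roots" unfolding is_root_def by blast
  have V: "orbit_sum G (weight G \<alpha>S) \<alpha>S VS = (\<Sum>W\<in>?roots. 1 / real (cv W)) + (\<Sum>W\<in>out ori ` F. 1 / real (cv W))"
    unfolding orbit_sum_def weight_def cv_def[symmetric] split[symmetric]
    by (rule sum.subset_diff[OF img tree_fin_orbits])
  have ex: "\<forall>W\<in>?P. \<exists>U. U \<in> orbits G R \<alpha>S \<and> (W, U) \<in> (adj F qi qt)\<^sup>* \<and> cv U = cv W"
    using root_to_absorbing[OF _ _ R] by blast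
  obtain f where f0: "\<forall>W\<in>?P. f W \<in> orbits G R \<alpha>S \<and> (W, f W) \<in> (adj F qi qt)\<^sup>* \<and> cv (f W) = cv W"
    using bchoice[OF ex] ..
  note f = bspec[OF f0]
  have injf: "inj_on f ?P"
  proof (rule inj_onI)
    fix W W' assume W: "W \<in> ?P" "W' \<in> ?P" "f W = f W'"
    have "(f W, W') \<in> (adj F qi qt)\<^sup>*" using adj_rtrancl_sym f[OF W(2)] W(3) by metis
    then have "(W, W') \<in> (adj F qi qt)\<^sup>*" using f[OF W(1)] by (meson rtrancl_trans)
    then show "W = W'" using roots_disconnected W by blast
  qed
  \<comment> \<open>Roots with infinite stabilizer contribute \<open>1 / 0 = 0\<close>, so it is
    enough to map the finite ones into \<open>R\<close>.\<close>
  have "(\<Sum>W\<in>?roots. 1 / real (cv W)) = (\<Sum>W\<in>?P. 1 / real (cv W))"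
    using tree_fin_orbits by (intro sum.mono_neutral_right) auto
  also have "\<dots> = (\<Sum>W\<in>?P. 1 / real (cv (f W)))"
    using f by (intro sum.cong) auto
  also have "\<dots> = (\<Sum>U\<in>f ` ?P. 1 / real (cv U))"
    by (simp only: sum.reindex[OF injf] o_def)
  also have "\<dots> \<le> (\<Sum>U\<in>orbits G R \<alpha>S. 1 / real (cv U))"
    using f finR by (intro sum_mono2) auto
  also have "\<dots> = orbit_sum G (weight G \<alpha>S) \<alpha>S R"
    by (simp add: orbit_sum_def weight_def cv_def)
  finally show ?thesis unfolding cost_def E V Fsum by simp
qed

end

end

end

theorem theorem2p3:
  fixes G :: "('g, 'b) monoid_scheme"
    and V :: "'v set" and E :: "'e set"
    and \<iota> \<tau> :: "'e \<Rightarrow> 'v"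
    and \<phi>V :: "'g \<Rightarrow> 'v \<Rightarrow> 'v" and \<phi>E :: "'g \<Rightarrow> 'e \<Rightarrow> 'e"
    and F :: "'e set set" and ori :: "'e set \<Rightarrow> bool"
  assumes "group G"
    and "finitely_generated G"
    and "G_tree G V E \<iota> \<tau> \<phi>V \<phi>E"
    and "finite (orbits G V \<phi>V)"
    and "finite (orbits G E \<phi>E)"
    and "\<forall>e\<in>E. finite (stabilizer G \<phi>E e)"
    and "compressing_forest G V E \<iota> \<tau> \<phi>V \<phi>E F ori"
  shows "(\<Sum>X\<in>orbits G E \<phi>E - F. 1 / real (card (stabilizer G \<phi>E (lift X))))
           \<le> real (min_gens G)"
proof -
  interpret AV: group_action G V \<phi>V using assms(3) by (simp add: G_tree_def)
  interpret AE: group_action G E \<phi>E using assms(3) by (simp add: G_tree_def)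
  interpret G: group G by fact
  have tree: "is_tree V E \<iota> \<tau>" and equi: "\<And>g e. g \<in> carrier G \<Longrightarrow> e \<in> E \<Longrightarrow>
      \<iota> (\<phi>E g e) = \<phi>V g (\<iota> e) \<and> \<tau> (\<phi>E g e) = \<phi>V g (\<tau> e)"
    using assms(3) by (auto simp: G_tree_def)
  interpret gV: gset G V \<phi>V
  proof unfold_locales
    show "\<phi>V g x \<in> V" if "g \<in> carrier G" "x \<in> V" for g x using AV.element_image that by blast
    show "\<phi>V \<one>\<^bsub>G\<^esub> x = x" if "x \<in> V" for x using AV.id_eq_one that by (metis restrict_apply')
    show "\<phi>V (g \<otimes>\<^bsub>G\<^esub> h) x = \<phi>V g (\<phi>V h x)" if "g \<in> carrier G" "h \<in> carrier G" "x \<in> V" for g h x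
      using AV.composition_rule that by blast
  qed
  interpret gE: gset G E \<phi>E
  proof unfold_locales
    show "\<phi>E g x \<in> E" if "g \<in> carrier G" "x \<in> E" for g x using AE.element_image that by blast
    show "\<phi>E \<one>\<^bsub>G\<^esub> x = x" if "x \<in> E" for x using AE.id_eq_one that by (metis restrict_apply')
    show "\<phi>E (g \<otimes>\<^bsub>G\<^esub> h) x = \<phi>E g (\<phi>E h x)" if "g \<in> carrier G" "h \<in> carrier G" "x \<in> E" for g h x
      using AE.composition_rule that by blast
  qed
  have connected: "(u, v) \<in> (adj E \<iota> \<tau>)\<^sup>*" if uv: "u \<in> V" "v \<in> V" for u v
  proof -
    obtain vs es where w: "is_walk E \<iota> \<tau> vs es" "hd vs = u" "last vs = v"
      using tree uv unfolding is_tree_def by blast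
    then have "(vs ! 0, vs ! length es) \<in> (adj (set es) \<iota> \<tau>)\<^sup>*"
      using is_walk_rtrancl[OF w(1), of 0 "length es"] by simp
    moreover have "adj (set es) \<iota> \<tau> \<subseteq> adj E \<iota> \<tau>" using w(1) by (auto simp: is_walk_def adj_def)
    moreover have "vs \<noteq> []" using w(1) by (auto simp: is_walk_def)
    then have "vs ! 0 = u" "vs ! length es = v"
      using w by (auto simp: is_walk_def hd_conv_nth last_conv_nth)
    ultimately show ?thesis using rtrancl_mono by blast
  qed
  interpret T: tree_action G V \<phi>V E \<phi>E \<iota> \<tau>
    by unfold_locales (use tree equi connected assms(4,6) in \<open>auto simp: is_tree_def is_graph_def\<close>)
  have "\<exists>A. A \<subseteq> carrier G \<and> finite A \<and> card A = min_gens G \<and> generate G A = carrier G"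
    unfolding min_gens_def
    by (rule LeastI_ex) (use assms(2) in \<open>auto simp: finitely_generated_def\<close>)
  then obtain A where A: "A \<subseteq> carrier G" "finite A" "card A = min_gens G" "generate G A = carrier G"
    by blast
  obtain v0 where v0: "v0 \<in> V" using tree by (auto simp: is_tree_def)
  obtain R where R: "absorbing G V \<phi>V E \<phi>E \<iota> \<tau> R" "cost G V \<phi>V E \<phi>E R \<le> real (card A)"
    using T.absorbing_cost_le_generators[OF A(1,2,4) v0] by blast
  show ?thesis
    using T.forest_sum_le_cost[OF assms(5,7) R(1)] R(2) A(3) by (simp add: T.ce_def)
qed

end
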